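(* Let $\alpha\in(0,2)$, let $G\subset O(\mathbb{T})\times O(3)\times\Sigma_n$ be a finite symmetry group of the action functional $\mathcal{A}_\omega$, let $x\in\Lambda^G$ be a local minimizer of $\mathcal{A}_\omega$ restricted to $\Lambda^G$ with a colliding cluster $\mathbf{k}$ at time $0$, let $\bar q$ be a blow-up of $x$ at this collision, and let $G_*$ be the symmetry group of the blow-up $\bar q$. If $\det\rho(g)=1$ for every $g\in G_*$ (i.e. $G_*$ acts orientation-preservingly on $\mathbb{R}^3$), and for some index $i\in\mathbf{k}$ the permutation isotropy $H_i=\{g\in G_*: gi=i\}$ is trivial, then there exists a V-variation for $\bar q$, and it can be found on an equivariant $2$-sphere: there is a $2$-sphere $S^2\subset\mathbb{R}^3$ centred at $0$ and a point $v\in S^2$ such that $\delta=\iota_i(v)\in X_{\mathbf{k}}^{G_*}$ is a V-variation.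
   Context: Setting. $\mathbb{T}=\mathbb{R}/T_0\mathbb{Z}$, $X=(\mathbb{R}^3)^n$, $\Lambda=H^1(\mathbb{T},X)$, masses $m_i>0$, and $$\mathcal{A}_\omega(x)=\int_{\mathbb{T}}\Big(\sum_{i} \frac{m_i}{2}|\dot x_i+\Omega x_i|^2+\sum_{i<j} m_im_j|x_i-x_j|^{-\alpha}\Big)dt,\qquad \Omega v=\omega\times v.$$ A symmetry group is a subgroup $G\subset O(\mathbb{T})\times O(3)\times\Sigma_n$ with projections $\tau,\rho,\sigma$; it is a symmetry group of $\mathcal{A}_\omega$ if it leaves $\mathcal{A}_\omega$ invariant under the action on loops $(gx)_{\sigma(g)i}(\tau(g)t)=\rho(g)x_i(t)$. $\Lambda^G$ is the space of $G$-equivariant loops. A local minimizer is a loop in $\Lambda^G$ of finite action minimizing $\mathcal{A}_\omega$ in an $H^1$-neighbourhood in $\Lambda^G$. Write $gi=\sigma(g)i$. Cluster, blow-up and $G_*$. A colliding cluster $\mathbf{k}$ at time $0$ is a set of at least two indices whose bodies coincide at time $0$ while bodies not in $\mathbf{k}$ are at time $0$ at different positions from those in $\mathbf{k}$. $X_{\mathbf{k}}=(\mathbb{R}^3)^{\mathbf{k}}$. $G_*$ is the group of elements $g\in G$ fixing the time $0$ and mapping $\mathbf{k}$ to itself, with permutation action restricted to $\mathbf{k}$; it acts on $X_{\mathbf{k}}$ by $(g\delta)_{gi}=\rho(g)\delta_i$, and $X_{\mathbf{k}}^{G_*}$ is the space of fixed configurations. A blow-up $\bar q:\mathbb{R}\to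 X_{\mathbf{k}}$ is a limit, uniform on compact sets, along a sequence $\lambda_k\to0^+$, of the rescaled trajectories $\lambda_k^{-2/(2+\alpha)}\big(x_i(\lambda_k t)-x_0(\lambda_k t)\big)_{i\in\mathbf{k}}$, where $x_0$ is the centre of mass of the bodies in $\mathbf{k}$; it is $G_*$-equivariant and of the form $\bar q(t)=|t|^{2/(2+\alpha)}\bar s^{\pm}$ for $\pm t\geq 0$, where $\bar s^{\pm}\in X_{\mathbf{k}}$ are central configurations. Equivariant sphere. If $H_i$ is trivial, define $\iota_i:\mathbb{R}^3\to X_{\mathbf{k}}^{G_*}$ by $\iota_i(v)_{gi}=\rho(g)v$ for $g\in G_*$ and $\iota_i(v)_j=0$ for indices $j\in\mathbf{k}$ not in the $G_*$-orbit of $i$. V-variation. For $\delta\in X_{\mathbf{k}}\setminus\{0\}$ and $R>|\delta|$ the standard variation is the function $v^\delta:\mathbb{R}\to X_{\mathbf{k}}$ with $v^\delta(t)=\delta$ for $|t|\le R-|\delta|$, $v^\delta(t)=(R-|t|)\,\delta/|\delta|$ for $R-|\delta|\le|t|\le R$, and $v^\delta(t)=0$ for $|t|\ge R$. A V-variation is a configuration $\delta\in X_{\mathbf{k}}^{G_*}$ that makes the action decrease along the standard variation: for some $R>|\delta|$, $$\int_{-\infty}^{\infty}\big[L(\bar q+v^\delta)-L(\bar q)\big]\,dt<0,\qquad L(q)=\sum_{i\in\mathbf{k}}\frac{m_i}{2}|\dot q_i|^2+\sum_{i<j,\ i,j\in\mathbf{k}}m_im_j|q_i-q_j|^{-\a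lpha}.$$
   Formalization: Added assumption: some G-equivariant loop does not have all bodies of k coinciding at time 0. Without it the claim fails, e.g. for two equal masses, ω=0, with x_2(t)=x_1(-t), where every ι_i(v) merely translates the cluster. *)

theory Defs
  imports "HOL-Analysis.Analysis" "HOL-Algebra.Bij" "HOL-Library.Real_Mod"
begin

section \<open>Symmetry groups\<close>

text \<open>
  The isometries of the circle \<open>\<real>/T0\<int>\<close> are the maps \<open>t \<mapsto> e t + c\<close> with \<open>e = 1\<close> or \<open>e = -1\<close>;
  such a map is encoded by the pair \<open>(e, c)\<close>, where \<open>c\<close> is the representative in \<open>[0, T0)\<close>.
\<close>

definition O_circle :: "real \<Rightarrow> (real \<times> real) monoid" where
  "O_circle T0 = \<lparr>carrier = {(e, c). e \<in> {1, -1} \<and> 0 \<le> c \<and> c < T0},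
                  mult = (\<lambda>(e, c) (e', c'). (e * e', (e * c' + c) rmod T0)),
                  one = (1, 0)\<rparr>"

definition O3 :: "(real^3^3) monoid" where
  "O3 = \<lparr>carrier = {A. orthogonal_matrix A}, mult = (**), one = mat 1\<rparr>"

type_synonym 'n sym = "(real \<times> real) \<times> (real^3^3) \<times> ('n \<Rightarrow> 'n)"

text \<open>\<open>sym_group T0 UNIV\<close> is \<open>O(\<real>/T0\<int>) \<times> O(3) \<times> \<Sigma>\<^sub>n\<close>; for a cluster \<open>k\<close> the last factor
  is the symmetric group of \<open>k\<close>.\<close>

definition sym_group :: "real \<Rightarrow> 'n set \<Rightarrow> 'n sym monoid" where
  "sym_group T0 k = O_circle T0 \<times>\<times> O3 \<times>\<times> BijGroup k"

definition tau :: "'n sym \<Rightarrow> real \<Rightarrow> real" where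
  "tau g t = fst (fst g) * t + snd (fst g)"

definition tau_inv :: "'n sym \<Rightarrow> real \<Rightarrow> real" where
  "tau_inv g t = fst (fst g) * (t - snd (fst g))"

definition rho :: "'n sym \<Rightarrow> real^3^3" where
  "rho g = fst (snd g)"

definition perm :: "'n sym \<Rightarrow> 'n \<Rightarrow> 'n" where
  "perm g = snd (snd g)"

lemma group_O_circle:
  assumes "T0 > 0"
  shows "group (O_circle T0)"
proof (rule groupI)
  have small: "c rmod T0 = c" if "0 \<le> c" "c < T0" for c
    using that assms by (intro rmod_unique[where n = 0]) auto
  have shift: "(e * (c rmod T0) + d) rmod T0 = (e * c + d) rmod T0"
    if "e \<in> {1, -1}" for e c d :: real
  proof -
    have "e = 1 \<or> e = -1" using that by auto
    then show ?thesis
    proof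
      assume "e = 1"
      then show ?thesis
        by (metis mult_1 rmod_add rmod_rmod)
    next
      assume "e = -1"
      then show ?thesis
        using rmod_diff[of d T0 c] rmod_diff[of d T0 "c rmod T0"] by simp
    qed
  qed
  show "g \<otimes>\<^bsub>O_circle T0\<^esub> h \<in> carrier (O_circle T0)"
    if "g \<in> carrier (O_circle T0)" "h \<in> carrier (O_circle T0)" for g h
    using that assms by (auto simp: O_circle_def rmod_nonneg rmod_less)
  show "\<one>\<^bsub>O_circle T0\<^esub> \<in> carrier (O_circle T0)"
    using assms by (simp add: O_circle_def)
  show "(g \<otimes>\<^bsub>O_circle T0\<^esub> h) \<otimes>\<^bsub>O_circle T0\<^esub> l = g \<otimes>\<^bsub>O_circle T0\<^esub> (h \<otimes>\<^bsub>O_circle T0\<^esub> l)"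
    if "g \<in> carrier (O_circle T0)" "h \<in> carrier (O_circle T0)" "l \<in> carrier (O_circle T0)" for g h l
  proof -
    obtain a b c d e f where eq: "g = (a, b)" "h = (c, d)" "l = (e, f)"
      by (metis surj_pair)
    have ac: "a \<in> {1, -1}" "c \<in> {1, -1}"
      using that eq by (auto simp: O_circle_def)
    have "(a * c * f + (a * d + b) rmod T0) rmod T0 = (a * c * f + (a * d + b)) rmod T0"
      using shift[of 1 "a * d + b" "a * c * f"] by (simp add: add.commute)
    also have "\<dots> = (a * (c * f + d) + b) rmod T0"
      by (simp add: algebra_simps)
    also have "\<dots> = (a * ((c * f + d) rmod T0) + b) rmod T0"
      using shift[OF ac(1)] by simp
    finally show ?thesis
      by (simp add: O_circle_def eq mult.assoc)
  qed
  show "\<one>\<^bsub>O_circle T0\<^esub> \<otimes>\<^bsub>O_circle T0\<^esub> g = g" if "g \<in> carrier (O_circle T0)" for g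
    using that by (auto simp: O_circle_def small)
  show "\<exists>h\<in>carrier (O_circle T0). h \<otimes>\<^bsub>O_circle T0\<^esub> g = \<one>\<^bsub>O_circle T0\<^esub>"
    if g: "g \<in> carrier (O_circle T0)" for g
  proof -
    obtain e c where eq: "g = (e, c)" by (metis surj_pair)
    have e: "e \<in> {1, -1}" using g eq by (auto simp: O_circle_def)
    have "(e * c + (- e * c) rmod T0) rmod T0 = 0"
      using shift[of 1 "- e * c" "e * c"] by (simp add: add.commute)
    then show ?thesis
      using assms e
      by (intro bexI[of _ "(e, (- e * c) rmod T0)"])
         (auto simp: O_circle_def eq rmod_nonneg rmod_less)
  qed
qed

lemma group_O3: "group O3"
proof (rule groupI)
  show "\<exists>B\<in>carrier O3. B \<otimes>\<^bsub>O3\<^esub> A = \<one>\<^bsub>O3\<^esub>" if "A \<in> carrier O3" for A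
    using that by (intro bexI[of _ "transpose A"]) (auto simp: O3_def orthogonal_matrix_def)
qed (auto simp: O3_def orthogonal_matrix_mul orthogonal_matrix_id matrix_mul_assoc)

lemma group_sym_group: "T0 > 0 \<Longrightarrow> group (sym_group T0 k)"
  unfolding sym_group_def
  by (intro DirProd_group group_O_circle group_O3 group_BijGroup)

section \<open>Loops and the action functional\<close>

text \<open>
  A loop is a \<open>T0\<close>-periodic function on the line with values in \<open>(\<real>\<^sup>3)\<^sup>n\<close>, where \<open>n = CARD('n)\<close>.
  An \<open>H\<^sup>1\<close> function is the primitive of a square integrable function \<open>u\<close>; by Lebesgue's
  theorem \<open>u t\<close> is \<open>vector_derivative x (at t)\<close> for almost all \<open>t\<close>.
\<close>

definition H1_loops :: "real \<Rightarrow> (real \<Rightarrow> real^3^'n) set" where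
  "H1_loops T0 = {x. (\<forall>t. x (t + T0) = x t) \<and>
     (\<exists>u. u \<in> borel_measurable lborel \<and>
          set_integrable lborel {0..T0} (\<lambda>t. (norm (u t))\<^sup>2) \<and>
          (\<forall>t\<in>{0..T0}. x t = x 0 + (LBINT s:{0..t}. u s)))}"

definition H1_norm :: "real \<Rightarrow> (real \<Rightarrow> real^3^'n) \<Rightarrow> real" where
  "H1_norm T0 x = sqrt (enn2real (\<integral>\<^sup>+t\<in>{0..T0}.
     ennreal ((norm (x t))\<^sup>2 + (norm (vector_derivative x (at t)))\<^sup>2) \<partial>lborel))"

text \<open>The potential takes the value \<open>\<infinity>\<close> at collisions, whereas \<open>0 powr (- \<alpha>) = 0\<close>.\<close>

definition potential :: "('n::{finite,linorder} \<Rightarrow> real) \<Rightarrow> real \<Rightarrow> 'n set \<Rightarrow> real^3^('n::{finite,linorder}) \<Rightarrow> ennreal" where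
  "potential m \<alpha> k p = (\<Sum>(i, j)\<in>{(i, j). i \<in> k \<and> j \<in> k \<and> i < j}.
     if p $ i = p $ j then \<infinity> else ennreal (m i * m j * norm (p $ i - p $ j) powr (- \<alpha>)))"

definition action ::
  "real \<Rightarrow> real \<Rightarrow> real^3 \<Rightarrow> ('n::{finite,linorder} \<Rightarrow> real) \<Rightarrow> (real \<Rightarrow> real^3^('n::{finite,linorder})) \<Rightarrow> ennreal" where
  "action T0 \<alpha> \<omega> m x = (\<integral>\<^sup>+t\<in>{0..T0}.
     (ennreal (\<Sum>i\<in>UNIV. m i / 2 * (norm (vector_derivative x (at t) $ i + cross3 \<omega> (x t $ i)))\<^sup>2)
      + potential m \<alpha> UNIV (x t)) \<partial>lborel)"

definition loop_act :: "'n sym \<Rightarrow> (real \<Rightarrow> real^3^'n) \<Rightarrow> real \<Rightarrow> real^3^'n" where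
  "loop_act g x = (\<lambda>t. \<chi> i. rho g *v (x (tau_inv g t) $ inv_into UNIV (perm g) i))"

definition symmetry_group_of_action ::
  "real \<Rightarrow> real \<Rightarrow> real^3 \<Rightarrow> ('n::{finite,linorder} \<Rightarrow> real) \<Rightarrow> 'n sym set \<Rightarrow> bool" where
  "symmetry_group_of_action T0 \<alpha> \<omega> m G \<longleftrightarrow>
     subgroup G (sym_group T0 UNIV) \<and>
     (\<forall>g\<in>G. \<forall>x\<in>H1_loops T0. action T0 \<alpha> \<omega> m (loop_act g x) = action T0 \<alpha> \<omega> m x)"

definition equivariant_loops :: "real \<Rightarrow> 'n sym set \<Rightarrow> (real \<Rightarrow> real^3^'n) set" where
  "equivariant_loops T0 G = {x \<in> H1_loops T0. \<forall>g\<in>G. loop_act g x = x}"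

definition local_minimizer ::
  "real \<Rightarrow> real \<Rightarrow> real^3 \<Rightarrow> ('n::{finite,linorder} \<Rightarrow> real) \<Rightarrow> 'n sym set \<Rightarrow> (real \<Rightarrow> real^3^('n::{finite,linorder})) \<Rightarrow> bool" where
  "local_minimizer T0 \<alpha> \<omega> m G x \<longleftrightarrow>
     x \<in> equivariant_loops T0 G \<and> action T0 \<alpha> \<omega> m x < \<infinity> \<and>
     (\<exists>\<epsilon>>0. \<forall>y\<in>equivariant_loops T0 G.
        H1_norm T0 (\<lambda>t. y t - x t) < \<epsilon> \<longrightarrow> action T0 \<alpha> \<omega> m x \<le> action T0 \<alpha> \<omega> m y)"

section \<open>Clusters and blow-ups\<close>

definition colliding_cluster :: "(real \<Rightarrow> real^3^'n) \<Rightarrow> 'n set \<Rightarrow> bool" where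
  "colliding_cluster x k \<longleftrightarrow> card k \<ge> 2 \<and>
     (\<forall>i\<in>k. \<forall>j\<in>k. x 0 $ i = x 0 $ j) \<and> (\<forall>i\<in>k. \<forall>j. j \<notin> k \<longrightarrow> x 0 $ i \<noteq> x 0 $ j)"

text \<open>\<open>X\<^sub>k\<close> is embedded in \<open>(\<real>\<^sup>3)\<^sup>n\<close> by setting the components outside \<open>k\<close> to zero.\<close>

definition cluster_space :: "'n set \<Rightarrow> (real^3^'n) set" where
  "cluster_space k = {p. \<forall>j. j \<notin> k \<longrightarrow> p $ j = 0}"

text \<open>An element of \<open>G\<close> fixes the time \<open>0\<close> of the circle iff its translation part is \<open>0\<close>.\<close>

definition G_star :: "'n sym set \<Rightarrow> 'n set \<Rightarrow> 'n sym set" where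
  "G_star G k = (\<lambda>g. (fst g, rho g, restrict (perm g) k)) ` {g \<in> G. tau g 0 = 0 \<and> perm g ` k = k}"

definition fixed_configurations :: "'n sym set \<Rightarrow> 'n set \<Rightarrow> (real^3^'n) set" where
  "fixed_configurations G k =
     {\<delta> \<in> cluster_space k. \<forall>g\<in>G_star G k. \<forall>i\<in>k. \<delta> $ perm g i = rho g *v (\<delta> $ i)}"

definition perm_isotropy :: "'n sym set \<Rightarrow> 'n set \<Rightarrow> 'n \<Rightarrow> 'n sym set" where
  "perm_isotropy G k i = {g \<in> G_star G k. perm g i = i}"

definition center_of_mass :: "('n \<Rightarrow> real) \<Rightarrow> 'n set \<Rightarrow> real^3^'n \<Rightarrow> real^3" where
  "center_of_mass m k p = (\<Sum>i\<in>k. m i *\<^sub>R (p $ i)) /\<^sub>R (\<Sum>i\<in>k. m i)"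

text \<open>Central configurations of \<open>k\<close>: collision-free solutions of \<open>\<nabla>U(s) = - \<mu> M s\<close>, where
  \<open>U(s)\<close> is the sum of \<open>m\<^sub>i m\<^sub>j |s\<^sub>i - s\<^sub>j| powr (- \<alpha>)\<close> over pairs and \<open>M\<close> is the mass matrix.\<close>

definition central_configuration :: "('n \<Rightarrow> real) \<Rightarrow> real \<Rightarrow> 'n set \<Rightarrow> real^3^'n \<Rightarrow> bool" where
  "central_configuration m \<alpha> k s \<longleftrightarrow> s \<in> cluster_space k \<and>
     (\<forall>i\<in>k. \<forall>j\<in>k. i \<noteq> j \<longrightarrow> s $ i \<noteq> s $ j) \<and>
     (\<exists>\<mu>. \<forall>i\<in>k. (\<Sum>j\<in>k - {i}.
        (\<alpha> * m i * m j * norm (s $ j - s $ i) powr (- \<alpha> - 2)) *\<^sub>R (s $ j - s $ i))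
        = - (\<mu> * m i) *\<^sub>R (s $ i))"

definition rescaled ::
  "('n \<Rightarrow> real) \<Rightarrow> real \<Rightarrow> 'n set \<Rightarrow> (real \<Rightarrow> real^3^'n) \<Rightarrow> real \<Rightarrow> real \<Rightarrow> real^3^'n" where
  "rescaled m \<alpha> k x l t = (\<chi> i. if i \<in> k
     then l powr (- 2 / (2 + \<alpha>)) *\<^sub>R (x (l * t) $ i - center_of_mass m k (x (l * t))) else 0)"

definition blow_up ::
  "('n \<Rightarrow> real) \<Rightarrow> real \<Rightarrow> 'n sym set \<Rightarrow> 'n set \<Rightarrow> (real \<Rightarrow> real^3^'n) \<Rightarrow> (real \<Rightarrow> real^3^'n) \<Rightarrow> bool" where
  "blow_up m \<alpha> G k x q \<longleftrightarrow>
     (\<exists>l. (\<forall>n::nat. l n > 0) \<and> l \<longlonglongrightarrow> 0 \<and>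
        (\<forall>K. compact K \<longrightarrow> uniform_limit K (\<lambda>n. rescaled m \<alpha> k x (l n)) q sequentially)) \<and>
     (\<forall>g\<in>G_star G k. \<forall>t. \<forall>i\<in>k. q (tau g t) $ perm g i = rho g *v (q t $ i)) \<and>
     (\<exists>sp sm. central_configuration m \<alpha> k sp \<and> central_configuration m \<alpha> k sm \<and>
        (\<forall>t. q t = \<bar>t\<bar> powr (2 / (2 + \<alpha>)) *\<^sub>R (if t \<ge> 0 then sp else sm)))"

section \<open>V-variations\<close>

definition standard_variation :: "real \<Rightarrow> real^3^'n \<Rightarrow> real \<Rightarrow> real^3^'n" where
  "standard_variation R \<delta> t =
     (if \<bar>t\<bar> \<le> R - norm \<delta> then \<delta>
      else if \<bar>t\<bar> \<le> R then ((R - \<bar>t\<bar>) / norm \<delta>) *\<^sub>R \<delta>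
      else 0)"

definition lagrangian ::
  "('n::{finite,linorder} \<Rightarrow> real) \<Rightarrow> real \<Rightarrow> 'n set \<Rightarrow> (real \<Rightarrow> real^3^('n::{finite,linorder})) \<Rightarrow> real \<Rightarrow> ennreal" where
  "lagrangian m \<alpha> k q t =
     ennreal (\<Sum>i\<in>k. m i / 2 * (norm (vector_derivative q (at t) $ i))\<^sup>2) + potential m \<alpha> k (q t)"

text \<open>The first two conditions on \<open>R\<close> rule out the default values of \<open>enn2real\<close> at \<open>\<infinity>\<close> and of the
  integral of a non-integrable function.\<close>

definition V_variation ::
  "('n::{finite,linorder} \<Rightarrow> real) \<Rightarrow> real \<Rightarrow> 'n sym set \<Rightarrow> 'n set \<Rightarrow> (real \<Rightarrow> real^3^('n::{finite,linorder})) \<Rightarrow> real^3^('n::{finite,linorder}) \<Rightarrow> bool" where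
  "V_variation m \<alpha> G k q \<delta> \<longleftrightarrow>
     \<delta> \<in> fixed_configurations G k \<and> \<delta> \<noteq> 0 \<and>
     (\<exists>R > norm \<delta>.
        let q' = (\<lambda>t. q t + standard_variation R \<delta> t);
            dL = (\<lambda>t. enn2real (lagrangian m \<alpha> k q' t) - enn2real (lagrangian m \<alpha> k q t))
        in (AE t in lborel. lagrangian m \<alpha> k q' t < \<infinity> \<and> lagrangian m \<alpha> k q t < \<infinity>) \<and>
           integrable lborel dL \<and> (LINT t|lborel. dL t) < 0)"

text \<open>The choice of \<open>g\<close> is unique when \<open>perm_isotropy G k i\<close> is trivial.\<close>

definition iota :: "'n sym set \<Rightarrow> 'n set \<Rightarrow> 'n \<Rightarrow> real^3 \<Rightarrow> real^3^'n" where
  "iota G k i v = (\<chi> j. if \<exists>g\<in>G_star G k. perm g i = j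
     then rho (THE g. g \<in> G_star G k \<and> perm g i = j) *v v else 0)"

end

theory Submission
  imports Defs "HOL-Probability.Probability_Measure"
begin

text \<open>
  Replace the standard variation along \<open>\<iota>\<^sub>i(v)\<close> by the constant translation \<open>q + \<iota>\<^sub>i(v)\<close> and let
  \<open>S(v)\<close> be the resulting change of the potential part of the action. Then \<open>S(r v) = r powr (1 - \<alpha>/2) S(v)\<close>,
  while cutting off in time and the kinetic energy cost only \<open>O(r)\<close>. Hence it suffices to find a \<open>v\<close>
  with \<open>S(v) < 0\<close>, and for this that the average of \<open>S\<close> over a Gaussian measure is negative.
  The pair \<open>j, l\<close> contributes to \<open>S(v)\<close> the integral over \<open>t\<close> of \<open>|a(t) + D v| powr (- \<alpha>) - |a(t)| powr (- \<alpha>)\<close>, where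
  \<open>a(t)\<close> is a multiple \<open>|t| powr (2/(2 + \<alpha>))\<close> of a fixed vector on each half-line and \<open>D\<close> is \<open>0\<close>, an orthogonal
  matrix up to sign, or a difference of two rotations of space, which is a similarity on a plane and vanishes on its normal.
  Writing \<open>|x| powr (- \<alpha>)\<close> as an integral of \<open>s powr (\<alpha>/2 - 1) exp (- s |x|\<^sup>2)\<close>, one bounds the Gaussian average explicitly and evaluates the integral over
  \<open>t\<close>; the result is a negative integral over \<open>s\<close>.
\<close>

section \<open>Rotations of three-dimensional space\<close>

text \<open>The sign is decided by counting the directions in which \<open>D\<close> spreads the
  Gaussian. Averaging turns \<open>exp (- s |a|^2)\<close> into at most
  \<open>exp (- s |a|^2 / x) / x\<close> with \<open>x = 1 + s * \<tau>\<close>; the factor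
  \<open>1 / x\<close> is the gain from two directions. Integrating the wider Gaussian over time
  costs a factor \<open>x powr \<kappa>\<close> with
  \<open>\<kappa> = 1 / (2 * \<beta>) = (2 + \<alpha>) / 4\<close>. The product
  \<open>x powr (\<kappa> - 1)\<close> is below 1 precisely because \<alpha> < 2. A map of rank one,
  such as a reflection minus the identity, would only leave the exponent
  \<open>\<kappa> - 1/2\<close>, which is positive. This is the role of determinant one: two
  distinct rotations differ by a map of rank two. The Gaussian replaces the uniform measure on a
  sphere because the Laplace integral of \<open>|x| powr (- \<alpha>)\<close> then leads to explicit
  Gaussian integrals. By homogeneity of \<open>S\<close> the sign depends only on the direction of
  \<open>v\<close>, so the radius of the sphere stays free and is fixed at the very end, when the
  gain has to beat the cost of the cut-off.\<close>

lemma rotation_transpose_eq_adjugate: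
  fixes R :: "real^3^3"
  assumes "orthogonal_matrix R" "det R = 1"
  shows "transpose R = vector [
     vector [R$2$2*R$3$3 - R$2$3*R$3$2, R$1$3*R$3$2 - R$1$2*R$3$3, R$1$2*R$2$3 - R$1$3*R$2$2],
     vector [R$2$3*R$3$1 - R$2$1*R$3$3, R$1$1*R$3$3 - R$1$3*R$3$1, R$1$3*R$2$1 - R$1$1*R$2$3],
     vector [R$2$1*R$3$2 - R$2$2*R$3$1, R$1$2*R$3$1 - R$1$1*R$3$2, R$1$1*R$2$2 - R$1$2*R$2$1]]"
    (is "_ = ?adj")
proof -
  define a b c d e f g h i where v: "a = R$1$1" "b = R$1$2" "c = R$1$3" "d = R$2$1" "e = R$2$2"
    "f = R$2$3" "g = R$3$1" "h = R$3$2" "i = R$3$3"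
  have det: "a*e*i + b*f*g + c*d*h - a*f*h - b*d*i - c*e*g = 1"
    using assms(2) unfolding det_3 v by simp
  have "R ** ?adj = mat 1"
    unfolding vec_eq_iff forall_3 matrix_matrix_mult_def sum_3 mat_def vec_lambda_beta vector_3
      v[symmetric]
    apply simp
    apply (intro conjI)
    subgoal using det by algebra
    subgoal by algebra
    subgoal by algebra
    subgoal by algebra
    subgoal using det by algebra
    subgoal by algebra
    subgoal by algebra
    subgoal by algebra
    subgoal using det by algebra
    done
  then have "transpose R ** (R ** ?adj) = transpose R" by simp
  then show ?thesis
    using assms(1) by (simp add: matrix_mul_assoc orthogonal_matrix_def)
qed

lemma rotation_cofactors:
  fixes R :: "real^3^3"
  assumes "orthogonal_matrix R" "det R = 1"
  shows "R$1$1 = R$2$2*R$3$3 - R$2$3*R$3$2" "R$2$1 = R$1$3*R$3$2 - R$1$2*R$3$3"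
    "R$3$1 = R$1$2*R$2$3 - R$1$3*R$2$2" "R$1$2 = R$2$3*R$3$1 - R$2$1*R$3$3"
    "R$2$2 = R$1$1*R$3$3 - R$1$3*R$3$1" "R$3$2 = R$1$3*R$2$1 - R$1$1*R$2$3"
    "R$1$3 = R$2$1*R$3$2 - R$2$2*R$3$1" "R$2$3 = R$1$2*R$3$1 - R$1$1*R$3$2"
    "R$3$3 = R$1$1*R$2$2 - R$1$2*R$2$1"
  using rotation_transpose_eq_adjugate[OF assms]
  unfolding vec_eq_iff forall_3 transpose_def vec_lambda_beta vector_3 by - (elim conjE, assumption)+

text \<open>The second coefficient of the characteristic polynomial is the trace of the adjugate,
  here that of R^T, hence equal to \<open>trace R\<close>. Thus R^3 - (trace R) R^2 + (trace R) R -
  1 = 0, and multiplication by R^T gives the stated form.\<close>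

lemma rotation_Cayley_Hamilton:
  fixes R :: "real^3^3"
  assumes "orthogonal_matrix R" "det R = 1"
  shows "transpose R *v u = R *v (R *v u) - trace R *\<^sub>R (R *v u) + trace R *\<^sub>R u"
proof -
  define a b c d e f g h i where v: "a = R$1$1" "b = R$1$2" "c = R$1$3" "d = R$2$1" "e = R$2$2"
    "f = R$2$3" "g = R$3$1" "h = R$3$2" "i = R$3$3"
  note cof = rotation_cofactors[OF assms, folded v]
  have "transpose R = R ** R - trace R *\<^sub>R R + trace R *\<^sub>R mat 1"
    unfolding vec_eq_iff forall_3 matrix_matrix_mult_def sum_3 mat_def vec_lambda_beta trace_def
      transpose_def vector_add_component vector_minus_component vector_scaleR_component v[symmetric]
    apply simp
    apply (intro conjI)
    subgoal using cof(1,5,9) by algebra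
    subgoal using cof(2) by algebra
    subgoal using cof(3) by algebra
    subgoal using cof(4) by algebra
    subgoal using cof(1,5,9) by algebra
    subgoal using cof(6) by algebra
    subgoal using cof(7) by algebra
    subgoal using cof(8) by algebra
    subgoal using cof(1,5,9) by algebra
    done
  then show ?thesis
    by (simp only: matrix_vector_mul_assoc matrix_vector_mult_diff_rdistrib
      matrix_vector_mult_add_rdistrib scaleR_matrix_vector_assoc[symmetric] matrix_vector_mul_lid)
qed

text \<open>For a rotation by the angle phi, R - 1 vanishes on the axis and is 2 sin (phi/2) times
  an isometry of the orthogonal plane, so A^T A is \<open>3 - trace R\<close> = 2 - 2 cos phi times
  the projection onto that plane. The identity expresses this without choosing an axis or an
  angle.\<close>

lemma rotation_diff_triple_product:
  fixes R :: "real^3^3"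
  assumes R: "orthogonal_matrix R" "det R = 1"
  defines "A \<equiv> R - mat 1"
  shows "transpose A *v (A *v (transpose A *v u)) = (3 - trace R) *\<^sub>R (transpose A *v u)"
proof -
  define P where "P = transpose R"
  have P: "orthogonal_matrix P" "det P = 1" "trace P = trace R"
    using R by (auto simp: P_def trace_def transpose_def[of R] det_transpose[of R, unfolded transpose_def]
        orthogonal_matrix_transpose[of R, unfolded transpose_def])
  have AT: "transpose A = P - mat 1"
    by (simp add: A_def P_def transpose_def vec_eq_iff mat_def)
  have PR: "P *v (R *v w) = w" "R *v (P *v w) = w" for w
    using R(1) by (simp_all add: P_def matrix_vector_mul_assoc orthogonal_matrix_def del: transpose_matrix_vector)
  \<comment> \<open>Cayley-Hamilton is applied to the inverse P of R: it cancels the quadratic term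
    in P that arises from expanding the triple product.\<close>
  have CH: "R *v w = P *v (P *v w) - trace R *\<^sub>R (P *v w) + trace R *\<^sub>R w" for w
    using rotation_Cayley_Hamilton[OF P(1,2), of w] P(3) by (simp add: P_def)
  show ?thesis
  proof -
    have "transpose A *v (A *v (transpose A *v u)) =
        P *v u + P *v u + P *v u - u - u - u - P *v (P *v u) + R *v u"
      unfolding AT unfolding A_def
      by (simp only: matrix_vector_mult_diff_distrib matrix_vector_mult_diff_rdistrib PR
          matrix_vector_mul_lid) (simp add: vec_eq_iff)
    also have "\<dots> = (3 - trace R) *\<^sub>R (P *v u - u)"
      unfolding CH[of u] by (simp add: vec_eq_iff algebra_simps)
    also have "P *v u - u = transpose A *v u"
      unfolding AT by (simp add: matrix_vector_mult_diff_rdistrib)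
    finally show ?thesis .
  qed
qed

lemma inner_matrix_transpose:
  fixes A :: "real^'n^'m"
  shows "(A *v x) \<bullet> y = x \<bullet> (transpose A *v y)"
  by (metis dot_lmul_matrix inner_commute transpose_matrix_vector)

lemma norm_orthogonal_matrix_mult:
  fixes R :: "real^'n^'n"
  assumes "orthogonal_matrix R"
  shows "norm (R *v x) = norm x"
  using assms by (simp add: orthogonal_matrix_def norm_eq_sqrt_inner inner_matrix_transpose matrix_vector_mul_assoc)

lemma trace_orthogonal_matrix_le:
  fixes R :: "real^'n^'n"
  assumes "orthogonal_matrix R"
  shows "trace R \<le> real CARD('n)"
proof -
  have "R $ i $ i \<le> 1" for i
    using component_le_norm_cart[of "row i R" i] assms
    by (simp add: orthogonal_matrix_orthonormal_rows row_def)
  then have "(\<Sum>i\<in>UNIV. R $ i $ i) \<le> (\<Sum>i\<in>(UNIV::'n set). 1)"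
    by (intro sum_mono)
  then show ?thesis by (simp add: trace_def)
qed

text \<open>For y = A^T u the triple product gives |A y|^2 = (3 - trace R) |y|^2, and |y| = |A u|
  because R A^T = - A. Cauchy-Schwarz in |y|^2 = (A y) . u then yields the bound without a spectral
  decomposition.\<close>

lemma rotation_diff_norm_le:
  fixes R :: "real^3^3"
  assumes R: "orthogonal_matrix R" "det R = 1"
  shows "(norm ((R - mat 1) *v u))\<^sup>2 \<le> (3 - trace R) * (norm u)\<^sup>2"
proof -
  define A where "A = R - mat 1"
  define P where "P = transpose R"
  have PR: "R *v (P *v w) = w" for w
    using R(1) by (simp add: P_def matrix_vector_mul_assoc orthogonal_matrix_def del: transpose_matrix_vector)
  have AT: "transpose A = P - mat 1"
    by (simp add: A_def P_def transpose_def vec_eq_iff mat_def)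
  define y where "y = transpose A *v u"
  have "norm y = norm (R *v y)" using R(1) by (simp add: norm_orthogonal_matrix_mult)
  also have "R *v y = - (A *v u)"
    unfolding y_def AT unfolding A_def
    by (simp add: matrix_vector_mult_diff_distrib matrix_vector_mult_diff_rdistrib PR)
  finally have ny: "norm y = norm (A *v u)" by simp
  have "(norm (A *v y))\<^sup>2 = y \<bullet> (transpose A *v (A *v y))"
    by (simp add: power2_norm_eq_inner inner_matrix_transpose)
  also have "\<dots> = (3 - trace R) * (norm y)\<^sup>2"
    unfolding y_def A_def rotation_diff_triple_product[OF R] by (simp add: power2_norm_eq_inner)
  finally have Ay: "(norm (A *v y))\<^sup>2 = (3 - trace R) * (norm y)\<^sup>2" .
  have "(norm y)\<^sup>2 = (A *v y) \<bullet> u"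
    by (simp add: power2_norm_eq_inner inner_matrix_transpose y_def)
  also have "\<dots> \<le> norm (A *v y) * norm u" by (rule norm_cauchy_schwarz)
  finally have "((norm y)\<^sup>2)\<^sup>2 \<le> (norm (A *v y) * norm u)\<^sup>2" by (intro power_mono) auto
  then have "(norm y)\<^sup>2 * (norm y)\<^sup>2 \<le> ((3 - trace R) * (norm u)\<^sup>2) * (norm y)\<^sup>2"
    by (simp add: power_mult_distrib Ay power2_eq_square[of "(norm y)\<^sup>2"] mult_ac)
  then have "(norm y)\<^sup>2 \<le> (3 - trace R) * (norm u)\<^sup>2"
    using trace_orthogonal_matrix_le[OF R(1)]
    by (cases "norm y = 0") (simp_all only: mult_le_cancel_right, auto)
  then show ?thesis by (simp add: ny A_def)
qed

text \<open>With the eigenvalues 1, exp (i phi), exp (- i phi) of R the determinant is |1 + y (exp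
  (i phi) - 1)|^2, while trace R = 1 + 2 cos phi. The matrix will serve as a square root of 1 + s (R
  - 1)^T (R - 1).\<close>

lemma det_rotation_affine:
  fixes R :: "real^3^3"
  assumes R: "orthogonal_matrix R" "det R = 1"
  shows "det (mat 1 + y *\<^sub>R (R - mat 1)) = 1 + (y\<^sup>2 - y) * (3 - trace R)"
proof -
  define a b c d e f g h i where v: "a = R$1$1" "b = R$1$2" "c = R$1$3" "d = R$2$1" "e = R$2$2"
    "f = R$2$3" "g = R$3$1" "h = R$3$2" "i = R$3$3"
  note cof = rotation_cofactors(1,5,9)[OF R, folded v]
  have det: "a*e*i + b*f*g + c*d*h - a*f*h - b*d*i - c*e*g = 1"
    using R(2) unfolding det_3 v by simp
  show ?thesis
    unfolding det_3 sum_3 mat_def vec_lambda_beta trace_def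
      vector_add_component vector_minus_component vector_scaleR_component v[symmetric]
    apply simp
    using cof det by algebra
qed

section \<open>Integrals of powers and exponentials\<close>

text \<open>The common shape of the majorants below: the first power is integrable at 0, the second
  at infinity.\<close>

lemma integrable_min_powr:
  fixes a b :: real
  assumes "a < 1" "1 < b"
  shows "integrable lborel (\<lambda>t. min (\<bar>t\<bar> powr - a) (\<bar>t\<bar> powr - b))"
proof -
  define g where "g t = indicator {0..1} t * t powr - a + indicator {1..} t * t powr - b" for t :: real
  have "integrable lborel (\<lambda>t. indicator {0..1} t *\<^sub>R t powr - a)"
  proof -
    have "(\<lambda>t. t powr - a) integrable_on {0..1}"
      using assms by (intro integrable_on_powr_from_0) auto
    then have "integrable lebesgue (\<lambda>t. indicator {0..1} t *\<^sub>R t powr - a)"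
      by (intro nonnegative_absolutely_integrable_1[unfolded set_integrable_def]) auto
    then show ?thesis by (subst (asm) integrable_completion) auto
  qed
  moreover have "integrable lborel (\<lambda>t. indicator {1..} t *\<^sub>R t powr - b)"
  proof -
    have "(\<lambda>t. t powr - b) integrable_on {1..}"
      using has_integral_powr_to_inf[of "- b" 1] assms by (intro has_integral_integrable[of _ "- (1 powr (- b + 1)) / (- b + 1)"]) simp
    then have "integrable lebesgue (\<lambda>t. indicator {1..} t *\<^sub>R t powr - b)"
      by (intro nonnegative_absolutely_integrable_1[unfolded set_integrable_def]) auto
    then show ?thesis by (subst (asm) integrable_completion) auto
  qed
  ultimately have g: "integrable lborel g"
    unfolding g_def by simp
  then have "integrable lborel (\<lambda>t. g t + g (- t))"
    using lborel_integrable_real_affine[OF g, of "-1" 0] by simp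
  then show ?thesis
  proof (rule Bochner_Integration.integrable_bound)
    show "AE t in lborel. norm (min (\<bar>t\<bar> powr - a) (\<bar>t\<bar> powr - b)) \<le> norm (g t + g (- t))"
    proof (intro always_eventually allI)
      fix t :: real
      have nn: "g u \<ge> 0" for u by (auto simp: g_def)
      have g: "min (u powr - a) (u powr - b) \<le> g u" if "u \<ge> 0" for u
      proof (cases "u \<le> 1")
        case True
        then have "u powr - a \<le> g u" using that by (simp add: g_def)
        then show ?thesis by linarith
      next
        case False
        then have "u powr - b \<le> g u" using that by (simp add: g_def)
        then show ?thesis by linarith
      qed
      have "min (\<bar>t\<bar> powr - a) (\<bar>t\<bar> powr - b) \<le> g \<bar>t\<bar>" by (rule g) simp
      also have "\<dots> \<le> g t + g (- t)" using nn[of t] nn[of "- t"] by (cases "t \<ge> 0") auto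
      finally show "norm (min (\<bar>t\<bar> powr - a) (\<bar>t\<bar> powr - b)) \<le> norm (g t + g (- t))"
        by simp
    qed
  qed auto
qed

text \<open>With \<open>p = \<alpha> / 2\<close> and y = |x|^2 this writes
  \<open>|x| powr (- \<alpha>)\<close> as a superposition of Gaussians in x.\<close>

lemma nn_integral_powr_exp:
  fixes p y :: real
  assumes "p > 0" "y > 0"
  shows "(\<integral>\<^sup>+s. ennreal (indicator {0<..} s * s powr (p - 1) * exp (- (s * y))) \<partial>lborel)
    = ennreal (Gamma p * y powr - p)"
proof -
  define f where "f s = indicator {0<..} s * s powr (p - 1) * exp (- s)" for s :: real
  have "((\<lambda>t. t powr (p - 1) / exp t) has_integral Gamma p) {0..}"
    by (rule Gamma_integral_real[OF assms(1)])
  then have "((\<lambda>t. if t \<in> {0..} then t powr (p - 1) / exp t else 0) has_integral Gamma p) UNIV"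
    by (subst has_integral_restrict_UNIV)
  also have "(\<lambda>t. if t \<in> {0..} then t powr (p - 1) / exp t else 0) = f"
    by (auto simp: f_def indicator_def exp_minus divide_inverse fun_eq_iff)
  finally have I: "(\<integral>\<^sup>+s. ennreal (f s) \<partial>lborel) = ennreal (Gamma p)"
    by (intro nn_integral_has_integral_lborel) (auto simp: f_def)
  have "ennreal (Gamma p) = ennreal \<bar>y\<bar> * (\<integral>\<^sup>+s. ennreal (f (0 + y * s)) \<partial>lborel)"
    using assms unfolding I[symmetric] by (intro nn_integral_real_affine) (auto simp: f_def)
  also have "\<dots> = (\<integral>\<^sup>+s. ennreal (y powr p) * ennreal (indicator {0<..} s * s powr (p - 1) * exp (- (s * y))) \<partial>lborel)"
    using assms by (subst nn_integral_cmult[symmetric])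
      (auto simp: f_def indicator_def zero_less_mult_iff powr_mult ennreal_mult'[symmetric] powr_diff mult_ac
        intro!: nn_integral_cong)
  also have "\<dots> = ennreal (y powr p) * (\<integral>\<^sup>+s. ennreal (indicator {0<..} s * s powr (p - 1) * exp (- (s * y))) \<partial>lborel)"
    by (intro nn_integral_cmult) auto
  finally have "ennreal (y powr - p) * ennreal (Gamma p) = ennreal (y powr - p) * (ennreal (y powr p) *
     (\<integral>\<^sup>+s. ennreal (indicator {0<..} s * s powr (p - 1) * exp (- (s * y))) \<partial>lborel))" by simp
  also have "\<dots> = (\<integral>\<^sup>+s. ennreal (indicator {0<..} s * s powr (p - 1) * exp (- (s * y))) \<partial>lborel)"
    using assms by (simp add: mult.assoc[symmetric] ennreal_mult'[symmetric] powr_add[symmetric])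
  finally show ?thesis
    using assms by (simp add: ennreal_mult'[symmetric] mult.commute[of _ "Gamma p"])
qed

text \<open>The norm of a path that is \<open>|t| powr \<beta>\<close> times a fixed vector on each
  half-line; \<open>c\<close> and \<open>d\<close> are the norms of the two vectors.\<close>

definition radius :: "real \<Rightarrow> real \<Rightarrow> real \<Rightarrow> real \<Rightarrow> real" where
  "radius \<beta> c d t = \<bar>t\<bar> powr \<beta> * (if t \<ge> 0 then c else d)"

lemma radius_measurable [measurable]: "radius \<beta> c d \<in> borel_measurable borel"
  unfolding radius_def by measurable

lemma integrable_exp_radius:
  assumes "\<beta> > 1/2" "c > 0" "d > 0"
  shows "integrable lborel (\<lambda>t. exp (- (radius \<beta> c d t)\<^sup>2))"
proof -
  define e where "e = min c d"
  have e: "e > 0" "e \<le> c" "e \<le> d" using assms by (auto simp: e_def)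
  \<comment> \<open>The summand 1 serves near 0, where the integrand is at most 1; the summand
    \<open>1 / e^2\<close> comes from exp (- y) <= 1 / y at infinity. The exponent 1/2 below is an
    arbitrary choice less than 1.\<close>
  define K where "K = 1 + 1 / e\<^sup>2"
  have "integrable lborel (\<lambda>t. K * min (\<bar>t\<bar> powr - (1/2)) (\<bar>t\<bar> powr - (2 * \<beta>)))"
    using assms by (intro integrable_mult_right integrable_min_powr) auto
  then show ?thesis
  proof (rule Bochner_Integration.integrable_bound)
    have "exp (- (radius \<beta> c d t)\<^sup>2) \<le> K * min (\<bar>t\<bar> powr - (1/2)) (\<bar>t\<bar> powr - (2 * \<beta>))" if "t \<noteq> 0" for t
    proof -
      define y where "y = (\<bar>t\<bar> powr \<beta> * e)\<^sup>2"
      have y: "y > 0" using that e by (simp add: y_def)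
      have "(\<bar>t\<bar> powr \<beta> * e)\<^sup>2 \<le> (radius \<beta> c d t)\<^sup>2"
        using e unfolding radius_def by (intro power_mono mult_left_mono) auto
      then have 1: "exp (- (radius \<beta> c d t)\<^sup>2) \<le> exp (- y)" by (simp add: y_def)
      have "y \<le> exp y" using exp_ge_add_one_self[of y] by linarith
      then have "exp (- y) \<le> 1 / y" using y by (simp add: exp_minus field_simps)
      also have "1 / y = (1 / e\<^sup>2) * \<bar>t\<bar> powr - (2 * \<beta>)"
        using that by (simp add: y_def power_mult_distrib powr_minus field_simps powr_power mult.commute)
      also have "\<dots> \<le> K * \<bar>t\<bar> powr - (2 * \<beta>)"
        unfolding K_def by (intro mult_right_mono) auto
      finally have 2: "exp (- y) \<le> K * \<bar>t\<bar> powr - (2 * \<beta>)" .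
      show ?thesis
      proof (cases "\<bar>t\<bar> \<le> 1")
        case True
        have "\<bar>t\<bar> powr - (1/2) \<ge> 1" using True that by (simp add: powr_minus powr_le1 one_le_inverse)
        then have "1 \<le> K * \<bar>t\<bar> powr - (1/2)"
          using mult_mono[of 1 K 1 "\<bar>t\<bar> powr - (1/2)"] by (simp add: K_def)
        moreover have "exp (- y) \<le> 1" using y by simp
        ultimately have 3: "exp (- (radius \<beta> c d t)\<^sup>2) \<le> K * \<bar>t\<bar> powr - (1/2)" using 1 by linarith
        from 1 2 have "exp (- (radius \<beta> c d t)\<^sup>2) \<le> K * \<bar>t\<bar> powr - (2 * \<beta>)" by (rule order_trans)
        with 3 show ?thesis unfolding min_def by presburger
      next
        case False
        then have "\<bar>t\<bar> powr - (2 * \<beta>) \<le> \<bar>t\<bar> powr - (1/2)"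
          using assms by (intro powr_mono) auto
        then show ?thesis using order_trans[OF 1 2] by (simp add: min.absorb2)
      qed
    qed
    moreover have "AE t in lborel. t \<noteq> (0::real)" by (rule AE_lborel_singleton)
    ultimately show "AE t in lborel. norm (exp (- (radius \<beta> c d t)\<^sup>2)) \<le> norm (K * min (\<bar>t\<bar> powr - (1/2)) (\<bar>t\<bar> powr - (2 * \<beta>)))"
      by (auto simp: abs_mult K_def)
  qed auto
qed

lemma radius_scale: "C > 0 \<Longrightarrow> radius \<beta> c d (C * t) = C powr \<beta> * radius \<beta> c d t"
  by (auto simp: radius_def abs_mult powr_mult zero_le_mult_iff)

text \<open>As \<open>radius\<close> is homogeneous of degree \<beta> in t, rescaling time by C with
  (C powr \<beta>)^2 = l absorbs the factor l.\<close>

lemma has_bochner_integral_exp_radius: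
  assumes "\<beta> > 1/2" "c > 0" "d > 0" "l > 0"
  shows "has_bochner_integral lborel (\<lambda>t. exp (- (l * (radius \<beta> c d t)\<^sup>2)))
     (l powr - (1 / (2 * \<beta>)) * (\<integral>t. exp (- (radius \<beta> c d t)\<^sup>2) \<partial>lborel))"
proof -
  define f where "f t = exp (- (radius \<beta> c d t)\<^sup>2)" for t
  define C where "C = l powr (1 / (2 * \<beta>))"
  have C: "C > 0" using assms by (simp add: C_def)
  have "(C powr \<beta>)\<^sup>2 = l" using assms by (simp add: C_def powr_powr powr_power)
  then have eq: "exp (- (l * (radius \<beta> c d t)\<^sup>2)) = f (0 + C * t)" for t
    using C by (simp add: f_def radius_scale power_mult_distrib)
  have i: "integrable lborel f"
    unfolding f_def using assms by (intro integrable_exp_radius)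
  then have "integrable lborel (\<lambda>t. f (0 + C * t))"
    using C by (intro lborel_integrable_real_affine) auto
  moreover have "integral\<^sup>L lborel (\<lambda>t. f (0 + C * t)) = (1 / C) * integral\<^sup>L lborel f"
    using C lborel_integral_real_affine[of C f 0] by (simp add: field_simps)
  moreover have "1 / C = l powr - (1 / (2 * \<beta>))" by (simp add: C_def powr_minus_divide)
  ultimately show ?thesis
    unfolding eq has_bochner_integral_iff f_def[symmetric] by simp
qed

section \<open>Gaussian averages\<close>

text \<open>It suffices to compare both measures on boxes. The preimage of a box under B is its
  image under the inverse matrix, and the density compensates the determinant of that
  inverse.\<close>

lemma lborel_matrix:
  fixes B :: "real^'n::{finite,wellorder}^'n::_"
  assumes "det B \<noteq> 0"
  shows "lborel = density (distr lborel borel ((*v) B)) (\<lambda>_. ennreal \<bar>det B\<bar>)"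
proof (rule lborel_eqI)
  have meas [measurable]: "(*v) B \<in> borel_measurable borel"
    by (intro borel_measurable_continuous_onI linear_continuous_on matrix_vector_mul_bounded_linear)
  obtain C where inv: "B ** C = mat 1" "C ** B = mat 1"
    using assms by (auto simp: invertible_det_nz[symmetric] invertible_def)
  have "det B * det C = 1"
    using arg_cong[OF inv(1), of det] by (simp add: det_mul)
  then have detC: "\<bar>det B\<bar> * \<bar>det C\<bar> = 1" by (metis abs_mult abs_one)
  fix l u :: "real^'n::_" assume le: "\<And>b. b \<in> Basis \<Longrightarrow> l \<bullet> b \<le> u \<bullet> b"
  have vim: "(*v) B -` box l u = (*v) C ` box l u"
    by (force simp: matrix_vector_mul_assoc inv image_iff)
  have bm: "(*v) C ` box l u \<in> sets borel"
    unfolding vim[symmetric] by (rule measurable_sets_borel[OF meas]) simp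
  have lm: "box l u \<in> lmeasurable" by simp
  have fin: "(*v) C ` box l u \<in> lmeasurable"
    by (intro measurable_linear_image lm matrix_vector_mul_linear)
  have "emeasure lborel ((*v) C ` box l u) = emeasure lebesgue ((*v) C ` box l u)"
    using bm by simp
  also have "\<dots> = ennreal (measure lebesgue ((*v) C ` box l u))"
    by (rule emeasure_eq_measure2[OF fin])
  also have "measure lebesgue ((*v) C ` box l u) = \<bar>det C\<bar> * measure lebesgue (box l u)"
    using measure_linear_image[OF matrix_vector_mul_linear lm] by (simp add: matrix_of_matrix_vector_mul)
  also have "measure lebesgue (box l u) = (\<Prod>b\<in>Basis. (u - l) \<bullet> b)"
    using le by (simp add: measure_lborel_box_eq)
  finally have "emeasure lborel ((*v) B -` box l u) = ennreal (\<bar>det C\<bar> * (\<Prod>b\<in>Basis. (u - l) \<bullet> b))"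
    by (simp add: vim)
  then have "emeasure (density (distr lborel borel ((*v) B)) (\<lambda>_. ennreal \<bar>det B\<bar>)) (box l u)
      = ennreal \<bar>det B\<bar> * ennreal (\<bar>det C\<bar> * (\<Prod>b\<in>Basis. (u - l) \<bullet> b))"
    by (simp add: emeasure_density nn_integral_cmult emeasure_distr)
  also have "\<dots> = ennreal (\<Prod>b\<in>Basis. (u - l) \<bullet> b)"
    by (simp add: ennreal_mult'[symmetric] mult.assoc[symmetric] detC)
  finally show "emeasure (density (distr lborel borel ((*v) B)) (\<lambda>_. ennreal \<bar>det B\<bar>)) (box l u)
      = ennreal (\<Prod>b\<in>Basis. (u - l) \<bullet> b)" .
qed simp

lemma borel_measurable_matrix_vector_mult [measurable]:
  fixes B :: "real^'n^'m"
  shows "f \<in> borel_measurable M \<Longrightarrow> (\<lambda>x. B *v f x) \<in> borel_measurable M"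
  by (rule measurable_compose[where g="(*v) B"], assumption)
     (intro borel_measurable_continuous_onI linear_continuous_on matrix_vector_mul_bounded_linear)

lemma nn_integral_matrix:
  fixes B :: "real^'n::{finite,wellorder}^'n::_"
  assumes "det B \<noteq> 0" and [measurable]: "f \<in> borel_measurable borel"
  shows "(\<integral>\<^sup>+x. f (B *v x) \<partial>lborel) = ennreal (1 / \<bar>det B\<bar>) * (\<integral>\<^sup>+x. f x \<partial>lborel)"
proof -
  have "(\<integral>\<^sup>+x. f x \<partial>lborel) = ennreal \<bar>det B\<bar> * (\<integral>\<^sup>+x. f (B *v x) \<partial>lborel)"
    by (subst lborel_matrix[OF assms(1)]) (simp add: nn_integral_density nn_integral_distr nn_integral_cmult)
  then show ?thesis
    using assms(1) by (simp add: mult.assoc[symmetric] ennreal_mult'[symmetric])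
qed

text \<open>The integrand is a product over the coordinates, and the integral in one coordinate is
  the case \<beta> = 1, c = d = 1 of the time integral above.\<close>

lemma integrable_exp_norm_square:
  assumes "l > 0"
  shows "integrable lborel (\<lambda>v::real^'n. exp (- (l * (norm v)\<^sup>2)))"
proof (rule integrableI_nonneg)
  have "integrable lborel (\<lambda>t::real. exp (- (l * t\<^sup>2)))"
    using has_bochner_integral_exp_radius[of 1 1 1 l] assms
    by (simp add: radius_def power_mult_distrib has_bochner_integral_iff)
  then have fin: "(\<integral>\<^sup>+t. ennreal (exp (- (l * t\<^sup>2))) \<partial>lborel) < \<infinity>"
    by (simp add: nn_integral_eq_integral)
  have "(\<integral>\<^sup>+v. ennreal (exp (- (l * (norm v)\<^sup>2))) \<partial>(lborel :: (real^'n) measure))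
      = (\<integral>\<^sup>+v. (\<Prod>b\<in>Basis. ennreal (exp (- (l * (v \<bullet> b)\<^sup>2)))) \<partial>(lborel :: (real^'n) measure))"
  proof (intro nn_integral_cong)
    fix v :: "real^'n"
    have "(norm v)\<^sup>2 = (\<Sum>b\<in>Basis. (v \<bullet> b)\<^sup>2)"
      unfolding power2_norm_eq_inner by (subst euclidean_inner) (simp add: power2_eq_square)
    then show "ennreal (exp (- (l * (norm v)\<^sup>2))) = (\<Prod>b\<in>Basis. ennreal (exp (- (l * (v \<bullet> b)\<^sup>2))))"
      by (simp add: prod_ennreal exp_sum[symmetric] sum_distrib_left sum_negf)
  qed
  also have "\<dots> = (\<Prod>b\<in>(Basis::(real^'n) set). (\<integral>\<^sup>+t. ennreal (exp (- (l * t\<^sup>2))) \<partial>lborel))"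
    by (rule nn_integral_lborel_prod) auto
  also have "\<dots> < \<infinity>"
    using fin by (simp add: power_less_top_ennreal)
  finally show "(\<integral>\<^sup>+v. ennreal (exp (- (l * (norm v)\<^sup>2))) \<partial>(lborel :: (real^'n) measure)) < \<infinity>" .
qed auto

section \<open>The Gaussian measure on three-dimensional space\<close>

definition gauss_density :: "real^3 \<Rightarrow> real" where
  "gauss_density v = exp (- (norm v)\<^sup>2) / (\<integral>v. exp (- (norm (v::real^3))\<^sup>2) \<partial>lborel)"

definition gauss :: "(real^3) measure" where
  "gauss = density lborel (\<lambda>v. ennreal (gauss_density v))"

text \<open>The constant is \<open>pi powr (3/2)\<close>; its positivity follows from the integrand
  vanishing nowhere.\<close>

lemma gauss_normalisation_pos: "(\<integral>v. exp (- (norm (v::real^3))\<^sup>2) \<partial>lborel) > 0"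
proof -
  have i: "integrable lborel (\<lambda>v::real^3. exp (- (norm v)\<^sup>2))"
    using integrable_exp_norm_square[of 1, where 'n=3] by simp
  have "\<not> (AE v in lborel. exp (- (norm (v::real^3))\<^sup>2) = 0)"
  proof
    assume "AE v in lborel. exp (- (norm (v::real^3))\<^sup>2) = 0"
    then have "AE v in (lborel::(real^3) measure). False" by simp
    then show False by (simp add: eventually_False ae_filter_eq_bot_iff)
  qed
  then show ?thesis
    using integral_nonneg_eq_0_iff_AE[OF i] integral_nonneg_AE[of "\<lambda>v. exp (- (norm (v::real^3))\<^sup>2)" lborel]
    by (auto simp: less_le)
qed

lemma gauss_density_measurable [measurable]: "gauss_density \<in> borel_measurable borel"
  unfolding gauss_density_def by measurable

lemma gauss_density_nonneg: "gauss_density v \<ge> 0"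
  unfolding gauss_density_def using gauss_normalisation_pos by simp

lemma nn_integral_gauss_density: "(\<integral>\<^sup>+v. ennreal (gauss_density v) \<partial>lborel) = 1"
proof -
  have i: "integrable lborel (\<lambda>v::real^3. exp (- (norm v)\<^sup>2))"
    using integrable_exp_norm_square[of 1, where 'n=3] by simp
  then have "(\<integral>\<^sup>+v. ennreal (gauss_density v) \<partial>lborel) = ennreal (\<integral>v. gauss_density v \<partial>lborel)"
    using gauss_density_nonneg by (intro nn_integral_eq_integral) (auto simp: gauss_density_def)
  also have "(\<integral>v. gauss_density v \<partial>lborel) = 1"
    using gauss_normalisation_pos by (simp add: gauss_density_def)
  finally show ?thesis by simp
qed

lemma sets_gauss [measurable_cong, simp]: "sets gauss = sets borel"
  and space_gauss [simp]: "space gauss = UNIV"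
  by (simp_all add: gauss_def)

interpretation gauss: prob_space gauss
  by standard (simp add: gauss_def emeasure_density nn_integral_gauss_density)

text \<open>The minorant for the change of the potential will grow linearly in |v|, so the first
  moment has to be finite.\<close>

lemma integrable_norm_gauss: "integrable gauss norm"
proof -
  define Z where "Z = (\<integral>v. exp (- (norm (v::real^3))\<^sup>2) \<partial>lborel)"
  have Z: "Z > 0" using gauss_normalisation_pos by (simp add: Z_def)
  have "integrable lborel (\<lambda>v::real^3. (1 / Z) * exp (- ((1/2) * (norm v)\<^sup>2)))"
    by (intro integrable_mult_right integrable_exp_norm_square) simp
  then have "integrable lborel (\<lambda>v. gauss_density v *\<^sub>R norm v)"
  proof (rule Bochner_Integration.integrable_bound)
    have "gauss_density v * norm v \<le> (1 / Z) * exp (- ((1/2) * (norm v)\<^sup>2))" for v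
    proof -
      have "norm v \<le> 1 + (1/2) * (norm v)\<^sup>2"
        using sum_squares_bound[of "norm v" 1] by simp
      also have "\<dots> \<le> exp ((1/2) * (norm v)\<^sup>2)" by (rule exp_ge_add_one_self)
      finally have "exp (- (norm v)\<^sup>2) * norm v \<le> exp (- (norm v)\<^sup>2) * exp ((1/2) * (norm v)\<^sup>2)"
        by (intro mult_left_mono) auto
      also have "\<dots> = exp (- ((1/2) * (norm v)\<^sup>2))" by (simp add: exp_add[symmetric])
      finally show ?thesis using Z by (simp add: gauss_density_def Z_def[symmetric] divide_right_mono)
    qed
    then show "AE v in lborel. norm (gauss_density v *\<^sub>R norm v) \<le> norm ((1 / Z) * exp (- ((1/2) * (norm v)\<^sup>2)))"
      using Z gauss_density_nonneg by (intro always_eventually allI) (simp add: abs_mult abs_of_nonneg)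
  qed measurable
  then show ?thesis
    unfolding gauss_def using gauss_density_nonneg by (subst integrable_density) auto
qed

text \<open>The left-hand side is the minimum over b of s |a + b|^2 + |b|^2 / \<tau>, attained at b
  = - s \<tau> a / (1 + s \<tau>); the proof expands the square that vanishes there.\<close>

lemma complete_square_bound:
  fixes a b :: "'a::real_inner"
  assumes "s \<ge> 0" "\<tau> > 0" "(norm b)\<^sup>2 \<le> \<tau> * n"
  shows "s * (norm a)\<^sup>2 / (1 + s * \<tau>) \<le> s * (norm (a + b))\<^sup>2 + n"
proof -
  have pos: "1 + s * \<tau> > 0" using assms by (simp add: add_pos_nonneg)
  have "0 \<le> (norm ((s * \<tau>) *\<^sub>R a + (1 + s * \<tau>) *\<^sub>R b))\<^sup>2" by simp
  also have "\<dots> = \<tau> * ((1 + s * \<tau>) * (s * (norm (a + b))\<^sup>2) - s * (norm a)\<^sup>2) + (1 + s * \<tau>) * (norm b)\<^sup>2"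
    unfolding power2_norm_eq_inner inner_add_left inner_add_right inner_scaleR_left inner_scaleR_right
      inner_commute[of b a] by algebra
  also have "\<dots> \<le> \<tau> * ((1 + s * \<tau>) * (s * (norm (a + b))\<^sup>2) - s * (norm a)\<^sup>2) + (1 + s * \<tau>) * (\<tau> * n)"
    using pos assms(3) by (intro add_left_mono mult_left_mono) auto
  also have "\<dots> = \<tau> * ((1 + s * \<tau>) * (s * (norm (a + b))\<^sup>2 + n) - s * (norm a)\<^sup>2)"
    by (simp add: algebra_simps)
  finally have "s * (norm a)\<^sup>2 \<le> (1 + s * \<tau>) * (s * (norm (a + b))\<^sup>2 + n)"
    using assms(2) by (simp add: zero_le_mult_iff)
  then show ?thesis using pos by (simp add: pos_divide_le_eq mult.commute)
qed

section \<open>Matrices that spread the Gaussian in at least two directions\<close>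

text \<open>The right-hand side is the exact value when \<open>D\<close> is \<open>sqrt \<tau>\<close> times the orthogonal projection onto
  a plane containing \<open>a\<close>.\<close>

definition disperses :: "real^3^3 \<Rightarrow> real \<Rightarrow> bool" where
  "disperses D \<tau> \<longleftrightarrow> (\<forall>s\<ge>0. \<forall>a. (\<integral>\<^sup>+v. ennreal (exp (- (s * (norm (a + D *v v))\<^sup>2))) \<partial>gauss)
     \<le> ennreal (exp (- (s * (norm a)\<^sup>2 / (1 + s * \<tau>))) / (1 + s * \<tau>)))"

text \<open>Completing the square leaves the quadratic form 1 + s D^T D, of which B is a square
  root; substituting B w costs \<open>1 / |det B|\<close>. By \<open>triple\<close>, D^T D acts as
  \<tau> on the range of D^T, so the minimizer is an explicit multiple of D^T a, and
  \<open>bound\<close> controls the minimum from below. Given \<open>triple\<close>, the condition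
  on the determinant for s > 0 says that D has rank at least two.\<close>

lemma dispersesI:
  fixes D :: "real^3^3"
  assumes "\<tau> > 0"
    and triple: "\<And>u. transpose D *v (D *v (transpose D *v u)) = \<tau> *\<^sub>R (transpose D *v u)"
    and bound: "\<And>u. (norm (D *v u))\<^sup>2 \<le> \<tau> * (norm u)\<^sup>2"
    and root: "\<And>s. s \<ge> 0 \<Longrightarrow> \<exists>B::real^3^3. (\<forall>w. (norm (B *v w))\<^sup>2 = (norm w)\<^sup>2 + s * (norm (D *v w))\<^sup>2) \<and> \<bar>det B\<bar> \<ge> 1 + s * \<tau>"
  shows "disperses D \<tau>"
  unfolding disperses_def
proof (intro allI impI)
  fix s :: real and a :: "real^3"
  assume s: "s \<ge> 0"
  from root[OF s] obtain B :: "real^3^3" where B: "\<And>w. (norm (B *v w))\<^sup>2 = (norm w)\<^sup>2 + s * (norm (D *v w))\<^sup>2"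
    "\<bar>det B\<bar> \<ge> 1 + s * \<tau>" by blast
  have pos: "1 + s * \<tau> > 0" using assms s by (simp add: add_pos_nonneg)
  define u where "u = transpose D *v a"
  define k where "k = - (s / (1 + s * \<tau>))"
  \<comment> \<open>the minimizer of the exponent \<open>s |a + D v|\<^sup>2 + |v|\<^sup>2\<close>\<close>
  define v0 where "v0 = k *\<^sub>R u"
  define Q where "Q = s * (norm (a + D *v v0))\<^sup>2 + (norm v0)\<^sup>2"
  have "transpose D *v (a + D *v v0) = (1 + k * \<tau>) *\<^sub>R u"
    unfolding v0_def using triple[of a]
    by (simp add: matrix_vector_right_distrib u_def[symmetric] matrix_vector_mult_scaleR algebra_simps
        del: transpose_matrix_vector)
  moreover have "s * (1 + k * \<tau>) = - k" using pos by (simp add: k_def field_simps)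
  \<comment> \<open>The gradient of the exponent vanishes at \<open>v0\<close>, which is what
    cancels the cross terms in \<open>split\<close>.\<close>
  ultimately have crit: "s *\<^sub>R (transpose D *v (a + D *v v0)) = - v0"
    by (simp add: v0_def)
  have split: "s * (norm (a + D *v (v0 + w)))\<^sup>2 + (norm (v0 + w))\<^sup>2 = Q + (norm (B *v w))\<^sup>2" for w
  proof -
    have "s * ((D *v w) \<bullet> (a + D *v v0)) = w \<bullet> (s *\<^sub>R (transpose D *v (a + D *v v0)))"
      by (simp add: inner_matrix_transpose del: transpose_matrix_vector)
    also have "\<dots> = - (w \<bullet> v0)" unfolding crit by simp
    finally have x: "s * ((D *v w) \<bullet> (a + D *v v0)) = - (w \<bullet> v0)" .
    have "a + D *v (v0 + w) = (a + D *v v0) + D *v w" by (simp add: matrix_vector_right_distrib)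
    then have "s * (norm (a + D *v (v0 + w)))\<^sup>2 = s * (norm (a + D *v v0))\<^sup>2
        + 2 * (s * ((D *v w) \<bullet> (a + D *v v0))) + s * (norm (D *v w))\<^sup>2"
      by (simp only: power2_norm_eq_inner inner_add_left inner_add_right) (simp add: inner_commute algebra_simps)
    moreover have "(norm (v0 + w))\<^sup>2 = (norm v0)\<^sup>2 + 2 * (w \<bullet> v0) + (norm w)\<^sup>2"
      by (simp only: power2_norm_eq_inner inner_add_left inner_add_right) (simp add: inner_commute)
    ultimately show ?thesis unfolding Q_def B(1) x by simp
  qed
  have Qb: "s * (norm a)\<^sup>2 / (1 + s * \<tau>) \<le> Q"
    unfolding Q_def by (intro complete_square_bound s assms(1) bound)
  have e: "gauss_density v * exp (- (s * (norm (a + D *v v))\<^sup>2))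
     = exp (- Q) * gauss_density (B *v (v - v0))" for v
    using split[of "v - v0"] by (simp add: gauss_density_def exp_add[symmetric])
  have "(\<integral>\<^sup>+v. ennreal (exp (- (s * (norm (a + D *v v))\<^sup>2))) \<partial>gauss)
     = (\<integral>\<^sup>+v. ennreal (exp (- Q) * gauss_density (B *v (v - v0))) \<partial>lborel)"
    unfolding gauss_def e[symmetric]
    by (simp add: nn_integral_density ennreal_mult'[symmetric] gauss_density_nonneg)
  also have "\<dots> = (\<integral>\<^sup>+v. ennreal (exp (- Q) * gauss_density (B *v (v - v0))) \<partial>distr lborel borel ((+) v0))"
    by (subst lborel_distr_plus) simp
  also have "\<dots> = (\<integral>\<^sup>+v. ennreal (exp (- Q)) * ennreal (gauss_density (B *v v)) \<partial>lborel)"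
    by (subst nn_integral_distr) (auto simp: ennreal_mult')
  also have "\<dots> = ennreal (exp (- Q)) * (\<integral>\<^sup>+v. ennreal (gauss_density (B *v v)) \<partial>lborel)"
    by (rule nn_integral_cmult) measurable
  also have "(\<integral>\<^sup>+v. ennreal (gauss_density (B *v v)) \<partial>lborel) = ennreal (1 / \<bar>det B\<bar>)"
    using B(2) pos by (subst nn_integral_matrix[where f="\<lambda>v. ennreal (gauss_density v)"]) (auto simp: nn_integral_gauss_density)
  also have "ennreal (exp (- Q)) * ennreal (1 / \<bar>det B\<bar>) = ennreal (exp (- Q) * (1 / \<bar>det B\<bar>))"
    by (simp add: ennreal_mult'[symmetric])
  also have "\<dots> \<le> ennreal (exp (- (s * (norm a)\<^sup>2 / (1 + s * \<tau>))) * (1 / (1 + s * \<tau>)))"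
    using Qb B(2) pos by (intro ennreal_leI mult_mono) (auto intro: divide_left_mono)
  finally show "(\<integral>\<^sup>+v. ennreal (exp (- (s * (norm (a + D *v v))\<^sup>2))) \<partial>gauss)
     \<le> ennreal (exp (- (s * (norm a)\<^sup>2 / (1 + s * \<tau>))) / (1 + s * \<tau>))" by simp
qed

text \<open>If \<open>3 - trace R\<close> were not positive, the norm bound would force R = 1. For
  the square root put A = R - 1: orthogonality of R gives A + A^T = - A^T A, so 1 + y A has the
  square 1 + (y^2 - y) A^T A, and its determinant is known.\<close>

lemma disperses_rotation_diff:
  fixes R :: "real^3^3"
  assumes R: "orthogonal_matrix R" "det R = 1" and ne: "R \<noteq> mat 1"
  shows "3 - trace R > 0" "disperses (R - mat 1) (3 - trace R)"
proof -
  have "\<not> trace R \<ge> 3"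
  proof
    assume "trace R \<ge> 3"
    then have "(3 - trace R) * (norm u)\<^sup>2 \<le> 0" for u :: "real^3"
      by (simp add: mult_le_0_iff)
    then have "(norm ((R - mat 1) *v u))\<^sup>2 \<le> 0" for u
      using rotation_diff_norm_le[OF R, of u] order_trans by blast
    then have "(R - mat 1) *v u = 0 *v u" for u by simp
    then have "R - mat 1 = 0" by (subst matrix_eq) simp
    with ne show False by simp
  qed
  then show pos: "3 - trace R > 0" by simp
  show "disperses (R - mat 1) (3 - trace R)"
  proof (rule dispersesI[OF pos])
    show "transpose (R - mat 1) *v ((R - mat 1) *v (transpose (R - mat 1) *v u)) = (3 - trace R) *\<^sub>R (transpose (R - mat 1) *v u)" for u
      by (rule rotation_diff_triple_product[OF R])
    show "(norm ((R - mat 1) *v u))\<^sup>2 \<le> (3 - trace R) * (norm u)\<^sup>2" for u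
      by (rule rotation_diff_norm_le[OF R])
    fix s :: real assume s: "s \<ge> 0"
    \<comment> \<open>chosen such that \<open>B\<close> below satisfies \<open>B\<^sup>T B = 1 + s (R - 1)\<^sup>T (R - 1)\<close>\<close>
    define y where "y = (1 - sqrt (1 + 4 * s)) / 2"
    have y: "y\<^sup>2 - y = s"
      using s by (simp add: y_def power2_eq_square field_simps)
    define B where "B = mat 1 + y *\<^sub>R (R - mat 1)"
    have "(norm (B *v w))\<^sup>2 = (norm w)\<^sup>2 + s * (norm ((R - mat 1) *v w))\<^sup>2" for w
    proof -
      define r where "r = R *v w"
      have nr: "r \<bullet> r = w \<bullet> w"
        using norm_orthogonal_matrix_mult[OF R(1), of w] by (simp add: r_def norm_eq)
      have Bw: "B *v w = w + y *\<^sub>R (r - w)"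
        by (simp add: B_def r_def matrix_vector_mult_add_rdistrib matrix_vector_mult_diff_rdistrib
            scaleR_matrix_vector_assoc[symmetric])
      have Dw: "(R - mat 1) *v w = r - w" by (simp add: r_def matrix_vector_mult_diff_rdistrib)
      show ?thesis unfolding Bw Dw power2_norm_eq_inner inner_add_left inner_add_right inner_diff_left
          inner_diff_right inner_scaleR_left inner_scaleR_right inner_commute[of r w] nr y[symmetric]
        by algebra
    qed
    moreover have "det B = 1 + s * (3 - trace R)"
      unfolding B_def det_rotation_affine[OF R] y ..
    ultimately show "\<exists>B::real^3^3. (\<forall>w. (norm (B *v w))\<^sup>2 = (norm w)\<^sup>2 + s * (norm ((R - mat 1) *v w))\<^sup>2)
        \<and> \<bar>det B\<bar> \<ge> 1 + s * (3 - trace R)"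
      by (intro exI[of _ B]) auto
  qed
qed

text \<open>An isometry spreads the Gaussian in all three directions, so the determinant of the root
  is (1 + s) powr (3/2), more than the required 1 + s.\<close>

lemma disperses_orthogonal:
  fixes R :: "real^3^3"
  assumes R: "orthogonal_matrix R"
  shows "disperses R 1"
proof (rule dispersesI)
  show "transpose R *v (R *v (transpose R *v u)) = 1 *\<^sub>R (transpose R *v u)" for u
    using R by (simp add: matrix_vector_mul_assoc orthogonal_matrix_def del: transpose_matrix_vector)
  show "(norm (R *v u))\<^sup>2 \<le> 1 * (norm u)\<^sup>2" for u
    using R by (simp add: norm_orthogonal_matrix_mult)
  fix s :: real assume s: "s \<ge> 0"
  define B where "B = sqrt (1 + s) *\<^sub>R (mat 1 :: real^3^3)"
  have "(norm (B *v w))\<^sup>2 = (norm w)\<^sup>2 + s * (norm (R *v w))\<^sup>2" for w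
    using s R by (simp add: B_def scaleR_matrix_vector_assoc[symmetric] power_mult_distrib
        norm_orthogonal_matrix_mult algebra_simps)
  moreover have "det B = (1 + s) * sqrt (1 + s)"
    using s by (simp add: B_def det_3 mat_def)
  moreover have "(1 + s) * 1 \<le> (1 + s) * sqrt (1 + s)"
    using s by (intro mult_left_mono) auto
  ultimately show "\<exists>B::real^3^3. (\<forall>w. (norm (B *v w))\<^sup>2 = (norm w)\<^sup>2 + s * (norm (R *v w))\<^sup>2)
        \<and> \<bar>det B\<bar> \<ge> 1 + s * 1"
    by (intro exI[of _ B]) auto
qed simp

lemma disperses_orthogonal_mult:
  assumes R: "orthogonal_matrix R" and D: "disperses D \<tau>"
  shows "disperses (R ** D) \<tau>"
  unfolding disperses_def
proof (intro allI impI)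
  fix s :: real and a :: "real^3" assume s: "s \<ge> 0"
  have T: "orthogonal_matrix (transpose R)" using R by (simp add: orthogonal_matrix_transpose)
  have "norm (a + (R ** D) *v v) = norm (transpose R *v a + D *v v)" for v
  proof -
    have "transpose R *v (a + (R ** D) *v v) = transpose R *v a + D *v v"
      using R by (simp add: matrix_vector_right_distrib matrix_vector_mul_assoc matrix_mul_assoc
          orthogonal_matrix_def del: transpose_matrix_vector)
    then show ?thesis using norm_orthogonal_matrix_mult[OF T] by metis
  qed
  then show "(\<integral>\<^sup>+v. ennreal (exp (- (s * (norm (a + (R ** D) *v v))\<^sup>2))) \<partial>gauss)
     \<le> ennreal (exp (- (s * (norm a)\<^sup>2 / (1 + s * \<tau>))) / (1 + s * \<tau>))"
    using D[unfolded disperses_def, rule_format, OF s, of "transpose R *v a"]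
      norm_orthogonal_matrix_mult[OF T, of a] by simp
qed

text \<open>A - B = B (B^T A - 1) reduces the claim to one rotation other than the identity.
  Determinant one enters here: if B^T A were a reflection, the difference would have rank
  one.\<close>

lemma disperses_orthogonal_diff:
  fixes A B :: "real^3^3"
  assumes A: "orthogonal_matrix A" and B: "orthogonal_matrix B"
    and det: "det A = 1" "det B = 1" and ne: "A \<noteq> B"
  shows "\<exists>\<tau>>0. disperses (A - B) \<tau>"
proof -
  define R where "R = transpose B ** A"
  have BR: "B ** R = A" using B by (simp add: R_def matrix_mul_assoc orthogonal_matrix_def)
  have R: "orthogonal_matrix R" "det R = 1" "R \<noteq> mat 1"
    using A B det ne BR by (auto simp: R_def orthogonal_matrix_mul orthogonal_matrix_transpose det_mul)
  have "B ** (R - mat 1) = A - B" 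
    unfolding matrix_eq BR[symmetric] by (simp only: matrix_vector_mul_assoc[symmetric]
      matrix_vector_mult_diff_rdistrib matrix_vector_mult_diff_distrib matrix_vector_mul_lid simp_thms)
  then show ?thesis
    using disperses_rotation_diff[OF R] disperses_orthogonal_mult[OF B] by metis
qed

section \<open>Comparison of the Laplace integrals after integration over time\<close>

text \<open>The difference between the Laplace integrals of the average and of \<open>N t powr (- \<alpha>)\<close> is split into two nonnegative
  parts that are separately integrable over \<open>s\<close> and \<open>t\<close>; the more obvious splitting, with \<open>s * \<tau> / (1 + s * \<tau>)\<close> in front
  of the wider Gaussian, diverges as \<open>s\<close> tends to infinity.\<close>

lemma time_integrals_comparison:
  fixes \<alpha> \<beta> \<tau> c d :: real
  assumes \<alpha>: "0 < \<alpha>" "\<alpha> < 2" and \<beta>: "\<beta> = 2 / (2 + \<alpha>)" and \<tau>: "\<tau> > 0" and cd: "c > 0" "d > 0"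
  defines "N \<equiv> radius \<beta> c d"
    and "w \<equiv> \<lambda>s. indicator {0<..} s * s powr (\<alpha> / 2 - 1)"
  shows "(\<integral>\<^sup>+t. (\<integral>\<^sup>+s. ennreal (w s * (1 / (1 + s * \<tau>)) *
      (exp (- (s / (1 + s * \<tau>) * (N t)\<^sup>2)) - exp (- (s * (N t)\<^sup>2)))) \<partial>lborel) \<partial>lborel)
    < (\<integral>\<^sup>+t. (\<integral>\<^sup>+s. ennreal (w s * (s * \<tau> / (1 + s * \<tau>)) * exp (- (s * (N t)\<^sup>2))) \<partial>lborel) \<partial>lborel)" (is "?J2 < ?J1")
   and "(\<integral>\<^sup>+t. (\<integral>\<^sup>+s. ennreal (w s * (s * \<tau> / (1 + s * \<tau>)) * exp (- (s * (N t)\<^sup>2))) \<partial>lborel) \<partial>lborel) < \<infinity>" (is "?J1 < \<infinity>")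
proof -
  define \<kappa> where "\<kappa> = 1 / (2 * \<beta>)"
  have \<kappa>: "\<kappa> = (2 + \<alpha>) / 4" using \<alpha> by (simp add: \<kappa>_def \<beta>)
  have \<beta>h: "\<beta> > 1/2" using \<alpha> by (simp add: \<beta> field_simps)
  define I0 where "I0 = (\<integral>t. exp (- (N t)\<^sup>2) \<partial>lborel)"
  have N_meas [measurable]: "N \<in> borel_measurable borel" unfolding N_def by measurable
  have w_meas [measurable]: "w \<in> borel_measurable borel" unfolding w_def by measurable
  have hb: "has_bochner_integral lborel (\<lambda>t. exp (- (l * (N t)\<^sup>2))) (l powr - \<kappa> * I0)" if "l > 0" for l
    using has_bochner_integral_exp_radius[OF \<beta>h cd that] by (simp add: N_def I0_def \<kappa>_def)
  have I0: "I0 > 0"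
  proof -
    have i: "integrable lborel (\<lambda>t. exp (- (N t)\<^sup>2))"
      using integrable_exp_radius[OF \<beta>h cd] by (simp add: N_def)
    have "\<not> (AE t in lborel. exp (- (N t)\<^sup>2) = 0)"
      by (simp add: eventually_False ae_filter_eq_bot_iff)
    then show ?thesis
      unfolding I0_def
      using integral_nonneg_eq_0_iff_AE[OF i] integral_nonneg_AE[of "\<lambda>t. exp (- (N t)\<^sup>2)" lborel]
      by (auto simp: less_le)
  qed
  \<comment> \<open>\<open>g1\<close> and \<open>g2\<close> are the inner integrals over t after
    exchanging the integrations, evaluated by the scaling law for Gaussians of the radius.\<close>
  define g1 where "g1 s = w s * (1 / (1 + s * \<tau>)) * ((s / (1 + s * \<tau>)) powr - \<kappa> * I0 - s powr - \<kappa> * I0)" for s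
  define g2 where "g2 s = w s * (s * \<tau> / (1 + s * \<tau>)) * (s powr - \<kappa> * I0)" for s
  have [measurable]: "g1 \<in> borel_measurable borel" "g2 \<in> borel_measurable borel"
    unfolding g1_def g2_def by measurable
  have pos: "1 + s * \<tau> > 1" if "s > 0" for s using that \<tau> by simp
  have w0: "w s = 0" if "\<not> s > 0" for s using that by (simp add: w_def)
  have wpos: "w s \<ge> 0" for s by (simp add: w_def)
  have J1: "?J1 = (\<integral>\<^sup>+s. ennreal (g2 s) \<partial>lborel)"
  proof -
    have "?J1 = (\<integral>\<^sup>+s. (\<integral>\<^sup>+t. ennreal (w s * (s * \<tau> / (1 + s * \<tau>)) * exp (- (s * (N t)\<^sup>2))) \<partial>lborel) \<partial>lborel)"
      by (rule lborel_pair.Fubini') measurable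
    also have "\<dots> = (\<integral>\<^sup>+s. ennreal (g2 s) \<partial>lborel)"
    proof (rule nn_integral_cong)
      fix s :: real
      show "(\<integral>\<^sup>+t. ennreal (w s * (s * \<tau> / (1 + s * \<tau>)) * exp (- (s * (N t)\<^sup>2))) \<partial>lborel) = ennreal (g2 s)"
      proof (cases "s > 0")
        case True
        note b = has_bochner_integral_mult_right[OF hb[OF True], of "w s * (s * \<tau> / (1 + s * \<tau>))"]
        show ?thesis
          using True pos[OF True] wpos \<tau> b[unfolded has_bochner_integral_iff]
          by (subst nn_integral_eq_integral) (auto simp: g2_def)
      qed (simp add: g2_def w0)
    qed
    finally show ?thesis .
  qed
  have J2: "?J2 = (\<integral>\<^sup>+s. ennreal (g1 s) \<partial>lborel)"
  proof -
    have "?J2 = (\<integral>\<^sup>+s. (\<integral>\<^sup>+t. ennreal (w s * (1 / (1 + s * \<tau>)) *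
      (exp (- (s / (1 + s * \<tau>) * (N t)\<^sup>2)) - exp (- (s * (N t)\<^sup>2)))) \<partial>lborel) \<partial>lborel)"
      by (rule lborel_pair.Fubini') measurable
    also have "\<dots> = (\<integral>\<^sup>+s. ennreal (g1 s) \<partial>lborel)"
    proof (rule nn_integral_cong)
      fix s :: real
      show "(\<integral>\<^sup>+t. ennreal (w s * (1 / (1 + s * \<tau>)) *
        (exp (- (s / (1 + s * \<tau>) * (N t)\<^sup>2)) - exp (- (s * (N t)\<^sup>2)))) \<partial>lborel) = ennreal (g1 s)"
      proof (cases "s > 0")
        case True
        have p1: "s / (1 + s * \<tau>) > 0" using True pos[OF True] by simp
        have "s / (1 + s * \<tau>) \<le> s" using True pos[OF True] by (simp add: divide_le_eq)
        then have le: "exp (- (s * (N t)\<^sup>2)) \<le> exp (- (s / (1 + s * \<tau>) * (N t)\<^sup>2))" for t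
          by (simp only: exp_le_cancel_iff neg_le_iff_le mult_right_mono[OF _ zero_le_power2])
        note b = has_bochner_integral_mult_right[OF has_bochner_integral_diff[OF hb[OF p1] hb[OF True]],
            of "w s * (1 / (1 + s * \<tau>))"]
        have nn: "0 \<le> w s * (1 / (1 + s * \<tau>)) * (exp (- (s / (1 + s * \<tau>) * (N t)\<^sup>2)) - exp (- (s * (N t)\<^sup>2)))" for t
          using le[of t] pos[OF True] wpos[of s] by (intro mult_nonneg_nonneg) auto
        show ?thesis
          unfolding g1_def has_bochner_integral_integral_eq[OF b, symmetric]
          using nn by (intro nn_integral_eq_integral integrable.intros[OF b]) auto
      qed (simp add: g1_def w0)
    qed
    finally show ?thesis .
  qed
  \<comment> \<open>After a common positive factor is taken out, the claim is
    \<open>x powr \<kappa> - 1 < x - 1\<close> for x = 1 + s \<tau>. It holds because \<kappa> < 1,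
    that is, \<alpha> < 2.\<close>
  have less: "g1 s < g2 s" if s: "s > 0" for s
  proof -
    define x where "x = 1 + s * \<tau>"
    have x: "x > 1" using pos[OF s] by (simp add: x_def)
    have "x powr \<kappa> < x powr 1" using x \<alpha> by (intro powr_less_mono) (auto simp: \<kappa>)
    then have "x powr \<kappa> - 1 < s * \<tau>" using x by (simp add: x_def)
    then have "(w s / x * (s powr - \<kappa> * I0)) * (x powr \<kappa> - 1) < (w s / x * (s powr - \<kappa> * I0)) * (s * \<tau>)"
      using s x I0 by (intro mult_strict_left_mono) (auto simp: w_def)
    moreover have e: "(s / x) powr - \<kappa> = s powr - \<kappa> * x powr \<kappa>"
      using s x by (simp add: powr_divide powr_minus_divide)
    have "g1 s = (w s / x * (s powr - \<kappa> * I0)) * (x powr \<kappa> - 1)"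
      unfolding g1_def x_def[symmetric] e by (simp add: algebra_simps diff_divide_distrib)
    moreover have "g2 s = (w s / x * (s powr - \<kappa> * I0)) * (s * \<tau>)"
      unfolding g2_def x_def[symmetric] by simp
    ultimately show ?thesis by simp
  qed
  have le: "g1 s \<le> g2 s" for s
    using less[of s] by (cases "s > 0") (auto simp: g1_def g2_def w0)
  \<comment> \<open>At infinity \<open>g2\<close> decays like
    \<open>s powr (\<alpha>/4 - 3/2)\<close>, integrable as \<alpha> < 2; at 0 the factor s \<tau>
    improves the power by one. The summands of 1 + \<tau> cover the constants 1 and \<tau> of these
    two regimes.\<close>
  define C where "C = I0 * (1 + \<tau>)"
  have bnd: "g2 s \<le> C * min (\<bar>s\<bar> powr - (1/2 - \<alpha>/4)) (\<bar>s\<bar> powr - (3/2 - \<alpha>/4))" for s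
  proof (cases "s > 0")
    case True
    have x: "1 + s * \<tau> > 1" using pos[OF True] .
    have exps: "\<alpha> / 2 - 1 + - \<kappa> = - (3/2 - \<alpha>/4)" "1 + - (3/2 - \<alpha>/4) = - (1/2 - \<alpha>/4)"
      by (simp_all add: \<kappa> field_simps)
    have e: "w s * s powr - \<kappa> = s powr - (3/2 - \<alpha>/4)" "s * s powr - (3/2 - \<alpha>/4) = s powr - (1/2 - \<alpha>/4)"
      using True powr_add[of s "\<alpha> / 2 - 1" "- \<kappa>"] powr_add[of s 1 "- (3/2 - \<alpha>/4)"] unfolding exps
      by (simp_all add: w_def)
    have g2: "g2 s = I0 * (s * \<tau> / (1 + s * \<tau>)) * s powr - (3/2 - \<alpha>/4)"
      unfolding g2_def e(1)[symmetric] by (simp add: mult_ac)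
    have "s * \<tau> / (1 + s * \<tau>) \<le> 1" using x by (simp add: divide_le_eq)
    also have "\<dots> \<le> 1 + \<tau>" using \<tau> by simp
    finally have 1: "g2 s \<le> C * s powr - (3/2 - \<alpha>/4)"
      unfolding g2 C_def using I0 by (intro mult_right_mono mult_left_mono) auto
    have "s * \<tau> / (1 + s * \<tau>) \<le> s * \<tau>" using x True \<tau> by (simp add: divide_le_eq)
    also have "\<dots> \<le> (1 + \<tau>) * s" using True by (simp add: algebra_simps)
    finally have "g2 s \<le> I0 * ((1 + \<tau>) * s) * s powr - (3/2 - \<alpha>/4)"
      unfolding g2 using I0 by (intro mult_right_mono mult_left_mono) auto
    also have "\<dots> = C * s powr - (1/2 - \<alpha>/4)" unfolding C_def e(2)[symmetric] by (simp add: mult_ac)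
    finally show ?thesis using 1 True by (simp add: min_def)
  next
    case False
    have "0 \<le> C" using I0 \<tau> by (simp add: C_def)
    then show ?thesis using False by (simp add: g2_def w0)
  qed
  have fin2: "(\<integral>\<^sup>+s. ennreal (g2 s) \<partial>lborel) < \<infinity>"
  proof -
    have "integrable lborel (\<lambda>s. C * min (\<bar>s\<bar> powr - (1/2 - \<alpha>/4)) (\<bar>s\<bar> powr - (3/2 - \<alpha>/4)))"
      using \<alpha> by (intro integrable_mult_right integrable_min_powr) auto
    moreover have "0 \<le> C * min (\<bar>s\<bar> powr - (1/2 - \<alpha>/4)) (\<bar>s\<bar> powr - (3/2 - \<alpha>/4))" for s
      using I0 \<tau> by (auto simp: C_def)
    ultimately have "(\<integral>\<^sup>+s. ennreal (C * min (\<bar>s\<bar> powr - (1/2 - \<alpha>/4)) (\<bar>s\<bar> powr - (3/2 - \<alpha>/4))) \<partial>lborel) < \<infinity>"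
      by (subst nn_integral_eq_integral) auto
    moreover have "(\<integral>\<^sup>+s. ennreal (g2 s) \<partial>lborel) \<le> (\<integral>\<^sup>+s. ennreal (C * min (\<bar>s\<bar> powr - (1/2 - \<alpha>/4)) (\<bar>s\<bar> powr - (3/2 - \<alpha>/4))) \<partial>lborel)"
      using bnd by (intro nn_integral_mono ennreal_leI)
    ultimately show ?thesis by (rule le_less_trans[rotated])
  qed
  show "?J1 < \<infinity>" unfolding J1 by (rule fin2)
  show "?J2 < ?J1"
    unfolding J1 J2
  proof (rule nn_integral_less)
    show "AE s in lborel. ennreal (g1 s) \<le> ennreal (g2 s)" using le by (auto intro: ennreal_leI)
    have "(\<integral>\<^sup>+s. ennreal (g1 s) \<partial>lborel) \<le> (\<integral>\<^sup>+s. ennreal (g2 s) \<partial>lborel)"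
      using le by (intro nn_integral_mono ennreal_leI)
    then show "(\<integral>\<^sup>+s. ennreal (g1 s) \<partial>lborel) \<noteq> \<infinity>" using fin2 by (auto simp: top_unique)
    show "\<not> (AE s in lborel. ennreal (g2 s) \<le> ennreal (g1 s))"
    proof
      assume "AE s in lborel. ennreal (g2 s) \<le> ennreal (g1 s)"
      then have "AE s in lborel. s \<notin> {0<..<(1::real)}"
      proof (rule eventually_mono)
        fix s assume a: "ennreal (g2 s) \<le> ennreal (g1 s)"
        \<comment> \<open>Positivity is used because \<open>ennreal\<close> sends all negative reals
          to 0 and so reflects the order only above a positive number.\<close>
        have "0 < g2 s" if "s > 0" 
          using that pos[OF that] \<tau> I0 unfolding g2_def
          by (intro mult_pos_pos divide_pos_pos add_pos_pos) (auto simp: w_def)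
        then show "s \<notin> {0<..<(1::real)}" using a less[of s] by (auto simp: ennreal_le_iff2)
      qed
      then have "emeasure lborel {0<..<(1::real)} = 0"
        by (subst (asm) AE_iff_measurable[where N="{0<..<1}"]) auto
      then show False by simp
    qed
  qed measurable
qed

section \<open>Averaging the change of the potential\<close>

text \<open>The form of a blow-up and of each difference of its components: a fixed vector on each
  half-line, scaled by a power of |t|.\<close>

definition homothetic :: "real \<Rightarrow> 'a \<Rightarrow> 'a \<Rightarrow> real \<Rightarrow> 'a::real_normed_vector" where
  "homothetic \<beta> a b t = \<bar>t\<bar> powr \<beta> *\<^sub>R (if t \<ge> 0 then a else b)"

text \<open>At x + y = 0 the default \<open>0 powr (- \<alpha>) = 0\<close> stands in place of an
  infinite value; along a homothetic path with nonzero vectors this concerns finitely many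
  times.\<close>

definition powr_change :: "real \<Rightarrow> 'a::real_normed_vector \<Rightarrow> 'a \<Rightarrow> real" where
  "powr_change \<alpha> x y = norm (x + y) powr - \<alpha> - norm x powr - \<alpha>"

lemma homothetic_measurable [measurable]:
  fixes a b :: "'a::euclidean_space"
  shows "homothetic \<beta> a b \<in> borel_measurable borel"
  unfolding homothetic_def by measurable

lemma norm_homothetic: "norm (homothetic \<beta> a b t) = radius \<beta> (norm a) (norm b) t"
  by (simp add: homothetic_def radius_def)

text \<open>Dropping the first power gives the bound used near the collision. For large |x| the
  estimate (1 + z) powr (- \<alpha>) >= (1 + z) powr (- 2) >= 1 - 2 z with z = |y| / |x| gains a
  factor 1 / |x|, which is what integrability over time at infinity requires.\<close>

lemma powr_change_lower_bound:
  fixes x y :: "'a::real_normed_vector"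
  assumes \<alpha>: "0 < \<alpha>" "\<alpha> < 2" and x: "x \<noteq> 0"
  shows "- ((1 + 2 * norm y) * min (norm x powr - \<alpha>) (norm x powr (- \<alpha> - 1))) \<le> powr_change \<alpha> x y"
proof -
  define r where "r = norm x"
  define z where "z = norm y / r"
  have r: "r > 0" using x by (simp add: r_def)
  have z: "z \<ge> 0" using r by (simp add: z_def)
  have y: "norm y = r * z" using r by (simp add: z_def)
  have e: "r powr (- \<alpha> - 1) = r powr - \<alpha> / r" using r by (simp add: powr_diff)
  have main: "- (2 * z) * r powr - \<alpha> \<le> powr_change \<alpha> x y" "- (r powr - \<alpha>) \<le> powr_change \<alpha> x y"
    if "x + y \<noteq> 0"
  proof -
    have "norm (x + y) \<le> r * (1 + z)"
      using norm_triangle_ineq[of x y] by (simp add: r_def[symmetric] y algebra_simps)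
    then have "(r * (1 + z)) powr - \<alpha> \<le> norm (x + y) powr - \<alpha>"
      using that \<alpha> by (intro powr_mono2') auto
    moreover have "(1 - 2 * z) \<le> (1 + z) powr - \<alpha>"
    proof -
      have "(1 - 2 * z) * (1 + z)\<^sup>2 = 1 - (3 * z\<^sup>2 + 2 * z * z\<^sup>2)"
        by (simp add: power2_eq_square algebra_simps)
      also have "\<dots> \<le> 1"
      proof -
        have "0 \<le> 3 * z\<^sup>2 + 2 * z * z\<^sup>2" using z by (intro add_nonneg_nonneg mult_nonneg_nonneg) auto
        then show ?thesis by linarith
      qed
      finally have "1 - 2 * z \<le> (1 + z) powr - 2"
        using z by (simp add: powr_minus_divide pos_le_divide_eq)
      also have "\<dots> \<le> (1 + z) powr - \<alpha>" using z \<alpha> by (intro powr_mono) auto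
      finally show ?thesis .
    qed
    then have "(1 - 2 * z) * r powr - \<alpha> \<le> (1 + z) powr - \<alpha> * r powr - \<alpha>"
      by (rule mult_right_mono) simp
    moreover have "(r * (1 + z)) powr - \<alpha> = (1 + z) powr - \<alpha> * r powr - \<alpha>"
      using r z by (simp add: powr_mult)
    moreover have "(1 - 2 * z) * r powr - \<alpha> = r powr - \<alpha> + - (2 * z) * r powr - \<alpha>"
      by (simp add: algebra_simps)
    ultimately show "- (2 * z) * r powr - \<alpha> \<le> powr_change \<alpha> x y"
      unfolding powr_change_def r_def[symmetric] by linarith
    show "- (r powr - \<alpha>) \<le> powr_change \<alpha> x y" by (simp add: powr_change_def r_def)
  qed
  have h1: "r powr - \<alpha> \<le> (1 + 2 * norm y) * r powr - \<alpha>"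
    using mult_right_mono[of 1 "1 + 2 * norm y" "r powr - \<alpha>"] by simp
  have h2: "2 * z * r powr - \<alpha> \<le> (1 + 2 * norm y) * r powr (- \<alpha> - 1)"
    unfolding y e using r z by (simp add: field_simps)
  show ?thesis
  proof (cases "x + y = 0")
    case True
    \<comment> \<open>Here the change is - r powr (- \<alpha>) by the default value; |y| = r makes
      up for the extra factor 1 / r in the second bound.\<close>
    then have "norm y = r" using norm_minus_cancel[of y] by (simp add: r_def eq_neg_iff_add_eq_0[symmetric])
    then have "r powr - \<alpha> \<le> (1 + 2 * norm y) * r powr (- \<alpha> - 1)"
      unfolding e using r by (simp add: field_simps)
    then have "r powr - \<alpha> \<le> (1 + 2 * norm y) * min (r powr - \<alpha>) (r powr (- \<alpha> - 1))"
      using h1 by (simp add: min_def)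
    then show ?thesis using True by (simp add: powr_change_def r_def)
  next
    case False
    then show ?thesis using main[OF False] h1 h2 unfolding r_def[symmetric] by (simp add: min_def)
  qed
qed

text \<open>For this \<beta> the condition \<open>\<alpha> * \<beta> < 1\<close> at the collision
  amounts to \<alpha> < 2, and \<open>(\<alpha> + 1) * \<beta> > 1\<close> at infinity to \<alpha> >
  0.\<close>

lemma integrable_min_radius:
  assumes \<alpha>: "0 < \<alpha>" "\<alpha> < 2" and \<beta>: "\<beta> = 2 / (2 + \<alpha>)" and cd: "c > 0" "d > 0"
  shows "integrable lborel (\<lambda>t. min (radius \<beta> c d t powr - \<alpha>) (radius \<beta> c d t powr (- \<alpha> - 1)))"
proof -
  define e where "e = min c d"
  have e: "e > 0" "e \<le> c" "e \<le> d" using cd by (auto simp: e_def)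
  define C where "C = e powr - \<alpha> + e powr (- \<alpha> - 1)"
  have "\<alpha> * \<beta> < 1" "1 < (\<alpha> + 1) * \<beta>" using \<alpha> by (simp_all add: \<beta> field_simps)
  then have "integrable lborel (\<lambda>t. C * min (\<bar>t\<bar> powr - (\<alpha> * \<beta>)) (\<bar>t\<bar> powr - ((\<alpha> + 1) * \<beta>)))"
    by (intro integrable_mult_right integrable_min_powr)
  then show ?thesis
  proof (rule Bochner_Integration.integrable_bound)
    have "min (radius \<beta> c d t powr - \<alpha>) (radius \<beta> c d t powr (- \<alpha> - 1))
      \<le> C * min (\<bar>t\<bar> powr - (\<alpha> * \<beta>)) (\<bar>t\<bar> powr - ((\<alpha> + 1) * \<beta>))" if "t \<noteq> 0" for t
    proof -
      have le: "\<bar>t\<bar> powr \<beta> * e \<le> radius \<beta> c d t" "\<bar>t\<bar> powr \<beta> * e > 0"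
        using e that by (auto simp: radius_def)
      have "radius \<beta> c d t powr - \<alpha> \<le> (\<bar>t\<bar> powr \<beta> * e) powr - \<alpha>"
        "radius \<beta> c d t powr (- \<alpha> - 1) \<le> (\<bar>t\<bar> powr \<beta> * e) powr (- \<alpha> - 1)"
        using le \<alpha> by (intro powr_mono2'; simp)+
      moreover have "(\<bar>t\<bar> powr \<beta> * e) powr - \<alpha> = e powr - \<alpha> * \<bar>t\<bar> powr - (\<alpha> * \<beta>)"
        "(\<bar>t\<bar> powr \<beta> * e) powr (- \<alpha> - 1) = e powr (- \<alpha> - 1) * \<bar>t\<bar> powr - ((\<alpha> + 1) * \<beta>)"
      proof -
        have "\<beta> * - \<alpha> = - (\<alpha> * \<beta>)" "\<beta> * (- \<alpha> - 1) = - ((\<alpha> + 1) * \<beta>)" by (simp_all add: algebra_simps)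
        then show "(\<bar>t\<bar> powr \<beta> * e) powr - \<alpha> = e powr - \<alpha> * \<bar>t\<bar> powr - (\<alpha> * \<beta>)"
          "(\<bar>t\<bar> powr \<beta> * e) powr (- \<alpha> - 1) = e powr (- \<alpha> - 1) * \<bar>t\<bar> powr - ((\<alpha> + 1) * \<beta>)"
          using e that by (simp_all only: powr_mult powr_powr mult.commute)
      qed
      moreover have "e powr - \<alpha> * \<bar>t\<bar> powr - (\<alpha> * \<beta>) \<le> C * \<bar>t\<bar> powr - (\<alpha> * \<beta>)"
        "e powr (- \<alpha> - 1) * \<bar>t\<bar> powr - ((\<alpha> + 1) * \<beta>) \<le> C * \<bar>t\<bar> powr - ((\<alpha> + 1) * \<beta>)"
        unfolding C_def by (intro mult_right_mono; simp)+
      ultimately have "radius \<beta> c d t powr - \<alpha> \<le> C * \<bar>t\<bar> powr - (\<alpha> * \<beta>)"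
        "radius \<beta> c d t powr (- \<alpha> - 1) \<le> C * \<bar>t\<bar> powr - ((\<alpha> + 1) * \<beta>)" by linarith+
      then show ?thesis by (auto simp: min_def)
    qed
    moreover have "AE t in lborel. t \<noteq> (0::real)" by (rule AE_lborel_singleton)
    ultimately show "AE t in lborel. norm (min (radius \<beta> c d t powr - \<alpha>) (radius \<beta> c d t powr (- \<alpha> - 1)))
      \<le> norm (C * min (\<bar>t\<bar> powr - (\<alpha> * \<beta>)) (\<bar>t\<bar> powr - ((\<alpha> + 1) * \<beta>)))"
      by (auto simp: abs_mult C_def)
  qed measurable
qed

text \<open>With x = 1 + s \<tau>, the bound for the averaged Gaussian minus the original one is
  split as (1 / x) (wide - narrow) - ((x - 1) / x) narrow. The negative terms are moved to the other
  side, so that everything is a sum of extended nonnegative numbers.\<close>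

lemma gauss_average_powr:
  fixes a :: "real^3" and D :: "real^3^3"
  assumes \<alpha>: "0 < \<alpha>" "\<alpha> < 2" and a: "a \<noteq> 0" and D: "disperses D \<tau>" and \<tau>: "\<tau> > 0"
  defines "w \<equiv> \<lambda>s. indicator {0<..} s * s powr (\<alpha> / 2 - 1)"
  shows "ennreal (Gamma (\<alpha>/2)) * (\<integral>\<^sup>+v. ennreal (norm (a + D *v v) powr - \<alpha>) \<partial>gauss)
      + (\<integral>\<^sup>+s. ennreal (w s * (s * \<tau> / (1 + s * \<tau>)) * exp (- (s * (norm a)\<^sup>2))) \<partial>lborel)
    \<le> ennreal (Gamma (\<alpha>/2)) * ennreal (norm a powr - \<alpha>)
      + (\<integral>\<^sup>+s. ennreal (w s * (1 / (1 + s * \<tau>)) *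
          (exp (- (s / (1 + s * \<tau>) * (norm a)\<^sup>2)) - exp (- (s * (norm a)\<^sup>2)))) \<partial>lborel)"
proof -
  have w_meas [measurable]: "w \<in> borel_measurable borel" unfolding w_def by measurable
  have w0: "w s = 0" if "\<not> s > 0" for s using that by (simp add: w_def)
  have wpos: "w s \<ge> 0" for s by (simp add: w_def)
  have G: "Gamma (\<alpha>/2) > 0" using \<alpha> by simp
  interpret pair_sigma_finite gauss lborel ..
  have lap: "ennreal (Gamma (\<alpha>/2)) * ennreal (norm x powr - \<alpha>)
     = (\<integral>\<^sup>+s. ennreal (w s * exp (- (s * (norm x)\<^sup>2))) \<partial>lborel)" if "x \<noteq> 0" for x :: "real^3"
  proof -
    have "((norm x)\<^sup>2) powr - (\<alpha>/2) = norm x powr - \<alpha>"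
      using that powr_powr[of "norm x" 2 "- (\<alpha>/2)"] by simp
    then show ?thesis
      using nn_integral_powr_exp[of "\<alpha>/2" "(norm x)\<^sup>2"] \<alpha> that G
      by (simp add: w_def ennreal_mult'[symmetric])
  qed
  \<comment> \<open>At x = 0 the Laplace integral is infinite while the power is 0 by default; the
    inequality still holds in the direction that an upper bound needs.\<close>
  have lap_le: "ennreal (Gamma (\<alpha>/2)) * ennreal (norm x powr - \<alpha>)
     \<le> (\<integral>\<^sup>+s. ennreal (w s * exp (- (s * (norm x)\<^sup>2))) \<partial>lborel)" for x :: "real^3"
    using lap[of x] by (cases "x = 0") auto
  have "ennreal (Gamma (\<alpha>/2)) * (\<integral>\<^sup>+v. ennreal (norm (a + D *v v) powr - \<alpha>) \<partial>gauss)
     = (\<integral>\<^sup>+v. ennreal (Gamma (\<alpha>/2)) * ennreal (norm (a + D *v v) powr - \<alpha>) \<partial>gauss)"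
    by (rule nn_integral_cmult[symmetric]) measurable
  also have "\<dots> \<le> (\<integral>\<^sup>+v. (\<integral>\<^sup>+s. ennreal (w s * exp (- (s * (norm (a + D *v v))\<^sup>2))) \<partial>lborel) \<partial>gauss)"
    by (intro nn_integral_mono lap_le)
  also have "\<dots> = (\<integral>\<^sup>+s. (\<integral>\<^sup>+v. ennreal (w s * exp (- (s * (norm (a + D *v v))\<^sup>2))) \<partial>gauss) \<partial>lborel)"
    by (rule Fubini'[symmetric]) measurable
  also have "\<dots> \<le> (\<integral>\<^sup>+s. ennreal (w s * (1 / (1 + s * \<tau>)) * exp (- (s / (1 + s * \<tau>) * (norm a)\<^sup>2))) \<partial>lborel)"
  proof (rule nn_integral_mono)
    fix s :: real
    show "(\<integral>\<^sup>+v. ennreal (w s * exp (- (s * (norm (a + D *v v))\<^sup>2))) \<partial>gauss)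
       \<le> ennreal (w s * (1 / (1 + s * \<tau>)) * exp (- (s / (1 + s * \<tau>) * (norm a)\<^sup>2)))"
    proof (cases "s > 0")
      case True
      have "(\<integral>\<^sup>+v. ennreal (w s * exp (- (s * (norm (a + D *v v))\<^sup>2))) \<partial>gauss)
         = ennreal (w s) * (\<integral>\<^sup>+v. ennreal (exp (- (s * (norm (a + D *v v))\<^sup>2))) \<partial>gauss)"
        using wpos by (subst nn_integral_cmult[symmetric]) (auto simp: ennreal_mult')
      also have "\<dots> \<le> ennreal (w s) * ennreal (exp (- (s * (norm a)\<^sup>2 / (1 + s * \<tau>))) / (1 + s * \<tau>))"
        using D True by (intro mult_left_mono) (auto simp: disperses_def)
      finally show ?thesis using wpos by (simp add: ennreal_mult'[symmetric])
    qed (simp add: w0)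
  qed
  finally have "ennreal (Gamma (\<alpha>/2)) * (\<integral>\<^sup>+v. ennreal (norm (a + D *v v) powr - \<alpha>) \<partial>gauss)
      + (\<integral>\<^sup>+s. ennreal (w s * (s * \<tau> / (1 + s * \<tau>)) * exp (- (s * (norm a)\<^sup>2))) \<partial>lborel)
    \<le> (\<integral>\<^sup>+s. ennreal (w s * (1 / (1 + s * \<tau>)) * exp (- (s / (1 + s * \<tau>) * (norm a)\<^sup>2))) \<partial>lborel)
      + (\<integral>\<^sup>+s. ennreal (w s * (s * \<tau> / (1 + s * \<tau>)) * exp (- (s * (norm a)\<^sup>2))) \<partial>lborel)"
    by (rule add_right_mono)
  also have "\<dots> = (\<integral>\<^sup>+s. ennreal (w s * (1 / (1 + s * \<tau>)) * exp (- (s / (1 + s * \<tau>) * (norm a)\<^sup>2)))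
      + ennreal (w s * (s * \<tau> / (1 + s * \<tau>)) * exp (- (s * (norm a)\<^sup>2))) \<partial>lborel)"
    by (rule nn_integral_add[symmetric]) measurable
  also have "\<dots> = (\<integral>\<^sup>+s. ennreal (w s * exp (- (s * (norm a)\<^sup>2)))
      + ennreal (w s * (1 / (1 + s * \<tau>)) * (exp (- (s / (1 + s * \<tau>) * (norm a)\<^sup>2)) - exp (- (s * (norm a)\<^sup>2)))) \<partial>lborel)"
  proof (rule nn_integral_cong)
    fix s :: real
    show "ennreal (w s * (1 / (1 + s * \<tau>)) * exp (- (s / (1 + s * \<tau>) * (norm a)\<^sup>2)))
      + ennreal (w s * (s * \<tau> / (1 + s * \<tau>)) * exp (- (s * (norm a)\<^sup>2)))
      = ennreal (w s * exp (- (s * (norm a)\<^sup>2)))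
      + ennreal (w s * (1 / (1 + s * \<tau>)) * (exp (- (s / (1 + s * \<tau>) * (norm a)\<^sup>2)) - exp (- (s * (norm a)\<^sup>2))))"
    proof (cases "s > 0")
      case True
      define x where "x = 1 + s * \<tau>"
      have x: "x > 1" using True \<tau> by (simp add: x_def)
      define A where "A = exp (- (s / x * (norm a)\<^sup>2))"
      define B where "B = exp (- (s * (norm a)\<^sup>2))"
      have "s / x \<le> s" using True x by (simp add: divide_le_eq)
      then have AB: "B \<le> A" unfolding A_def B_def
        by (simp only: exp_le_cancel_iff neg_le_iff_le mult_right_mono[OF _ zero_le_power2])
      have B0: "B > 0" by (simp add: B_def)
      have "w s * (1 / x) * A + w s * ((x - 1) / x) * B = w s * B + w s * (1 / x) * (A - B)"
        using x by (simp add: field_simps)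
      moreover have "ennreal (w s * (1 / x) * A) + ennreal (w s * ((x - 1) / x) * B)
        = ennreal (w s * (1 / x) * A + w s * ((x - 1) / x) * B)"
        using x AB B0 wpos[of s] by (intro ennreal_plus[symmetric]) auto
      moreover have "ennreal (w s * B) + ennreal (w s * (1 / x) * (A - B))
        = ennreal (w s * B + w s * (1 / x) * (A - B))"
        using x AB B0 wpos[of s] by (intro ennreal_plus[symmetric]) auto
      ultimately have "ennreal (w s * (1 / x) * A) + ennreal (w s * ((x - 1) / x) * B)
        = ennreal (w s * B) + ennreal (w s * (1 / x) * (A - B))" by simp
      moreover have "s * \<tau> = x - 1" by (simp add: x_def)
      ultimately show ?thesis unfolding x_def[symmetric] A_def[symmetric] B_def[symmetric] by simp
    qed (simp add: w0)
  qed
  also have "\<dots> = ennreal (Gamma (\<alpha>/2)) * ennreal (norm a powr - \<alpha>)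
      + (\<integral>\<^sup>+s. ennreal (w s * (1 / (1 + s * \<tau>)) * (exp (- (s / (1 + s * \<tau>) * (norm a)\<^sup>2)) - exp (- (s * (norm a)\<^sup>2)))) \<partial>lborel)"
    unfolding lap[OF a] by (rule nn_integral_add) measurable
  finally show ?thesis .
qed

text \<open>Since the integrand changes sign and \<open>|a(t)| powr (- \<alpha>)\<close> is not integrable at infinity, an integrable minorant
  \<open>- h\<close> is split off before the integrations are exchanged.\<close>

lemma average_powr_change:
  fixes \<xi> \<eta> :: "real^3" and D :: "real^3^3"
  assumes \<alpha>: "0 < \<alpha>" "\<alpha> < 2" and \<beta>: "\<beta> = 2 / (2 + \<alpha>)" and ne: "\<xi> \<noteq> 0" "\<eta> \<noteq> 0"
    and D: "disperses D \<tau>" and \<tau>: "\<tau> > 0"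
  defines "f \<equiv> \<lambda>(v, t). powr_change \<alpha> (homothetic \<beta> \<xi> \<eta> t) (D *v v)"
  shows "integrable (gauss \<Otimes>\<^sub>M lborel) f" "(\<integral>z. f z \<partial>(gauss \<Otimes>\<^sub>M lborel)) < 0"
proof -
  interpret pair_sigma_finite gauss lborel ..
  define a where "a = homothetic \<beta> \<xi> \<eta>"
  have a_meas [measurable]: "a \<in> borel_measurable borel" unfolding a_def by measurable
  define N where "N t = norm (a t)" for t
  have N: "N = radius \<beta> (norm \<xi>) (norm \<eta>)" by (simp add: N_def a_def norm_homothetic fun_eq_iff)
  have a0: "a t \<noteq> 0" if "t \<noteq> 0" for t using that ne by (simp add: a_def homothetic_def)
  obtain K where K: "K > 0" "\<And>v. norm (D *v v) \<le> norm v * K"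
    using bounded_linear.pos_bounded[OF matrix_vector_mul_bounded_linear[of D]] by auto
  define k where "k t = min (N t powr - \<alpha>) (N t powr (- \<alpha> - 1))" for t
  have N_meas [measurable]: "N \<in> borel_measurable borel" unfolding N by measurable
  have k_meas [measurable]: "k \<in> borel_measurable borel" unfolding k_def by measurable
  have k_int: "integrable lborel k"
    unfolding k_def N using ne by (intro integrable_min_radius \<alpha> \<beta>) auto
  have k0: "k t \<ge> 0" for t by (simp add: k_def)
  \<comment> \<open>Since K bounds D, h majorises the negative part of the change for every v, and
    it is a product of a function of v and a function of t.\<close>
  define h where "h v t = (1 + 2 * K * norm v) * k t" for v :: "real^3" and t
  have h0: "h v t \<ge> 0" for v t using K k0 by (simp add: h_def)
  have f_meas [measurable]: "f \<in> borel_measurable (gauss \<Otimes>\<^sub>M lborel)"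
    unfolding f_def a_def[symmetric] powr_change_def by measurable
  have h_meas [measurable]: "(\<lambda>(v, t). h v t) \<in> borel_measurable (gauss \<Otimes>\<^sub>M lborel)"
    unfolding h_def by measurable
  have fh: "0 \<le> f (v, t) + h v t" if "t \<noteq> 0" for v t
  proof -
    have "(1 + 2 * norm (D *v v)) * k t \<le> h v t"
      unfolding h_def using K(2)[of v] k0[of t] by (intro mult_right_mono) (auto simp: mult_ac)
    then show ?thesis
      using powr_change_lower_bound[OF \<alpha> a0[OF that], of "D *v v"]
      by (simp add: f_def a_def[symmetric] k_def N_def)
  qed
  define G where "G = ennreal (Gamma (\<alpha>/2))"
  have G: "G > 0" "G < \<infinity>" using \<alpha> by (auto simp: G_def)
  define w where "w s = indicator {0<..} s * s powr (\<alpha> / 2 - 1)" for s :: real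
  define J1 where "J1 t = (\<integral>\<^sup>+s. ennreal (w s * (s * \<tau> / (1 + s * \<tau>)) * exp (- (s * (N t)\<^sup>2))) \<partial>lborel)" for t
  define J2 where "J2 t = (\<integral>\<^sup>+s. ennreal (w s * (1 / (1 + s * \<tau>)) *
          (exp (- (s / (1 + s * \<tau>) * (N t)\<^sup>2)) - exp (- (s * (N t)\<^sup>2)))) \<partial>lborel)" for t
  have [measurable]: "w \<in> borel_measurable borel" unfolding w_def by measurable
  have [measurable]: "J1 \<in> borel_measurable borel" "J2 \<in> borel_measurable borel"
    unfolding J1_def J2_def by measurable
  have J: "(\<integral>\<^sup>+t. J2 t \<partial>lborel) < (\<integral>\<^sup>+t. J1 t \<partial>lborel)" "(\<integral>\<^sup>+t. J1 t \<partial>lborel) < \<infinity>"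
    using time_integrals_comparison[OF \<alpha> \<beta> \<tau>, of "norm \<xi>" "norm \<eta>"] ne
    unfolding J1_def J2_def w_def N by simp_all
  define X where "X t = (\<integral>\<^sup>+v. ennreal (f (v, t) + h v t) \<partial>gauss)" for t
  define Y where "Y t = (\<integral>\<^sup>+v. ennreal (h v t) \<partial>gauss)" for t
  have [measurable]: "X \<in> borel_measurable borel" "Y \<in> borel_measurable borel"
    unfolding X_def Y_def by measurable
  have Y: "Y t = ennreal ((\<integral>v. 1 + 2 * K * norm v \<partial>gauss) * k t)" for t
  proof -
    have "integrable gauss (\<lambda>v. 1 + 2 * K * norm v)"
      using integrable_norm_gauss by (intro Bochner_Integration.integrable_add integrable_mult_right) auto
    then have "integrable gauss (\<lambda>v. h v t)" unfolding h_def by (rule integrable_mult_left)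
    then have "Y t = ennreal (\<integral>v. h v t \<partial>gauss)"
      unfolding Y_def using h0 by (intro nn_integral_eq_integral) auto
    then show ?thesis by (simp add: h_def)
  qed
  have Yfin: "(\<integral>\<^sup>+t. Y t \<partial>lborel) < \<infinity>"
  proof -
    have "0 \<le> (\<integral>v. 1 + 2 * K * norm v \<partial>gauss)" using K by (intro integral_nonneg_AE) auto
    then show ?thesis
      unfolding Y using k_int k0 by (subst nn_integral_eq_integral) auto
  qed
  \<comment> \<open>The finite number \<open>N t powr (- \<alpha>)\<close> is added to undo the
    subtraction inside f and cancelled once the bound for the average has been applied.\<close>
  have ineq: "G * X t + J1 t \<le> J2 t + G * Y t" if t: "t \<noteq> 0" for t
  proof -
    have "X t + ennreal (N t powr - \<alpha>) = (\<integral>\<^sup>+v. ennreal (f (v, t) + h v t) + ennreal (N t powr - \<alpha>) \<partial>gauss)"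
      unfolding X_def by (subst nn_integral_add) (auto simp: gauss.emeasure_space_1[simplified])
    also have "\<dots> = (\<integral>\<^sup>+v. ennreal (norm (a t + D *v v) powr - \<alpha>) + ennreal (h v t) \<partial>gauss)"
    proof (intro nn_integral_cong)
      fix v
      have "ennreal (f (v, t) + h v t) + ennreal (N t powr - \<alpha>) = ennreal (f (v, t) + h v t + N t powr - \<alpha>)"
        using fh[OF t] by (intro ennreal_plus[symmetric]) auto
      also have "f (v, t) + h v t + N t powr - \<alpha> = norm (a t + D *v v) powr - \<alpha> + h v t"
        by (simp add: f_def powr_change_def a_def N_def)
      also have "ennreal \<dots> = ennreal (norm (a t + D *v v) powr - \<alpha>) + ennreal (h v t)"
        using h0 by (intro ennreal_plus) auto
      finally show "ennreal (f (v, t) + h v t) + ennreal (N t powr - \<alpha>)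
         = ennreal (norm (a t + D *v v) powr - \<alpha>) + ennreal (h v t)" .
    qed
    also have "\<dots> = (\<integral>\<^sup>+v. ennreal (norm (a t + D *v v) powr - \<alpha>) \<partial>gauss) + Y t"
      unfolding Y_def by (rule nn_integral_add) measurable
    finally have "G * X t + G * ennreal (N t powr - \<alpha>) + J1 t
        = G * (\<integral>\<^sup>+v. ennreal (norm (a t + D *v v) powr - \<alpha>) \<partial>gauss) + J1 t + G * Y t"
      by (simp add: distrib_left[symmetric] add_ac)
    also have "\<dots> \<le> G * ennreal (N t powr - \<alpha>) + J2 t + G * Y t"
      unfolding G_def J1_def J2_def N_def w_def
      by (intro add_right_mono gauss_average_powr[OF \<alpha> a0[OF t] D \<tau>])
    finally have "G * ennreal (N t powr - \<alpha>) + (G * X t + J1 t) \<le> G * ennreal (N t powr - \<alpha>) + (J2 t + G * Y t)"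
      by (simp add: add_ac)
    then show ?thesis
      using G by (subst (asm) ennreal_add_left_cancel_le) (auto simp: ennreal_mult_eq_top_iff)
  qed
  have total: "G * (\<integral>\<^sup>+t. X t \<partial>lborel) + (\<integral>\<^sup>+t. J1 t \<partial>lborel) \<le> (\<integral>\<^sup>+t. J2 t \<partial>lborel) + G * (\<integral>\<^sup>+t. Y t \<partial>lborel)"
  proof -
    have "AE t in lborel. t \<noteq> (0::real)" by (rule AE_lborel_singleton)
    then have "AE t in lborel. G * X t + J1 t \<le> J2 t + G * Y t"
      by (rule eventually_mono) (rule ineq)
    then have "(\<integral>\<^sup>+t. G * X t + J1 t \<partial>lborel) \<le> (\<integral>\<^sup>+t. J2 t + G * Y t \<partial>lborel)"
      by (rule nn_integral_mono_AE)
    then show ?thesis by (simp add: nn_integral_add nn_integral_cmult)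
  qed
  also have "\<dots> < (\<integral>\<^sup>+t. J1 t \<partial>lborel) + G * (\<integral>\<^sup>+t. Y t \<partial>lborel)"
  proof -
    have "G * (\<integral>\<^sup>+t. Y t \<partial>lborel) \<noteq> \<infinity>" using Yfin G by (auto simp: ennreal_mult_eq_top_iff)
    then have "G * (\<integral>\<^sup>+t. Y t \<partial>lborel) + (\<integral>\<^sup>+t. J2 t \<partial>lborel) < G * (\<integral>\<^sup>+t. Y t \<partial>lborel) + (\<integral>\<^sup>+t. J1 t \<partial>lborel)"
      using J(1) by (simp add: ennreal_add_left_cancel_less)
    then show ?thesis by (simp only: add.commute)
  qed
  finally have lt: "G * (\<integral>\<^sup>+t. X t \<partial>lborel) < G * (\<integral>\<^sup>+t. Y t \<partial>lborel)"
    using J(2) by (simp add: add.commute ennreal_add_left_cancel_less)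
  then have XY: "(\<integral>\<^sup>+t. X t \<partial>lborel) < (\<integral>\<^sup>+t. Y t \<partial>lborel)"
    by (metis mult_left_mono not_le zero_le)
  have AE0: "AE z in gauss \<Otimes>\<^sub>M lborel. snd z \<noteq> (0::real)"
  proof -
    have "AE v in gauss. AE t in lborel. snd (v, t) \<noteq> (0::real)"
      using AE_lborel_singleton[of "0::real"] by simp
    moreover have "{z \<in> space (gauss \<Otimes>\<^sub>M lborel). snd z \<noteq> (0::real)} \<in> sets (gauss \<Otimes>\<^sub>M lborel)"
      by measurable
    ultimately show ?thesis by (intro AE_pair_measure)
  qed
  have Xp: "(\<integral>\<^sup>+z. ennreal (f z + h (fst z) (snd z)) \<partial>(gauss \<Otimes>\<^sub>M lborel)) = (\<integral>\<^sup>+t. X t \<partial>lborel)"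
    unfolding X_def by (subst nn_integral_snd[symmetric]) auto
  have Yp: "(\<integral>\<^sup>+z. ennreal (h (fst z) (snd z)) \<partial>(gauss \<Otimes>\<^sub>M lborel)) = (\<integral>\<^sup>+t. Y t \<partial>lborel)"
    unfolding Y_def by (subst nn_integral_snd[symmetric]) auto
  have fh_nn: "AE z in gauss \<Otimes>\<^sub>M lborel. 0 \<le> f z + h (fst z) (snd z)"
    using AE0 by (rule eventually_mono) (use fh in auto)
  have i1: "integrable (gauss \<Otimes>\<^sub>M lborel) (\<lambda>z. f z + h (fst z) (snd z))"
    using fh_nn XY Xp by (intro integrableI_nonneg) (auto simp: less_top[symmetric] top_unique)
  have i2: "integrable (gauss \<Otimes>\<^sub>M lborel) (\<lambda>z. h (fst z) (snd z))"
    using h0 Yfin Yp by (intro integrableI_nonneg) auto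
  from Bochner_Integration.integrable_diff[OF i1 i2] show fi: "integrable (gauss \<Otimes>\<^sub>M lborel) f" by simp
  have "ennreal (\<integral>z. f z + h (fst z) (snd z) \<partial>(gauss \<Otimes>\<^sub>M lborel)) < ennreal (\<integral>z. h (fst z) (snd z) \<partial>(gauss \<Otimes>\<^sub>M lborel))"
    using XY unfolding Xp[symmetric] Yp[symmetric]
    using nn_integral_eq_integral[OF i1 fh_nn] nn_integral_eq_integral[OF i2] h0 by simp
  then have "(\<integral>z. f z + h (fst z) (snd z) \<partial>(gauss \<Otimes>\<^sub>M lborel)) < (\<integral>z. h (fst z) (snd z) \<partial>(gauss \<Otimes>\<^sub>M lborel))"
    by (rule ennreal_less_iff[THEN iffD1, rotated]) (rule integral_nonneg_AE[OF fh_nn])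
  then show "(\<integral>z. f z \<partial>(gauss \<Otimes>\<^sub>M lborel)) < 0"
    using fi i2 by simp
qed

text \<open>Otherwise the sum would be nonnegative for almost every v, as Fubini makes the time
  integrals exist almost everywhere, and so would its average. Averages add up, so a single v serves
  all pairs; pairs with D = 0 contribute 0, hence the demand for one nonzero D.\<close>

lemma ex_decreasing_direction:
  fixes \<xi> \<eta> :: "'i \<Rightarrow> real^3" and D :: "'i \<Rightarrow> real^3^3" and c :: "'i \<Rightarrow> real"
  assumes \<alpha>: "0 < \<alpha>" "\<alpha> < 2" and \<beta>: "\<beta> = 2 / (2 + \<alpha>)" and I: "finite I"
    and c: "\<And>i. i \<in> I \<Longrightarrow> c i > 0" and ne: "\<And>i. i \<in> I \<Longrightarrow> \<xi> i \<noteq> 0" "\<And>i. i \<in> I \<Longrightarrow> \<eta> i \<noteq> 0"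
    and D: "\<And>i. i \<in> I \<Longrightarrow> D i = 0 \<or> (\<exists>\<tau>>0. disperses (D i) \<tau>)"
    and ex: "\<exists>i\<in>I. D i \<noteq> 0"
  shows "\<exists>v. (\<forall>i\<in>I. integrable lborel (\<lambda>t. powr_change \<alpha> (homothetic \<beta> (\<xi> i) (\<eta> i) t) (D i *v v))) \<and>
     (\<Sum>i\<in>I. c i * (\<integral>t. powr_change \<alpha> (homothetic \<beta> (\<xi> i) (\<eta> i) t) (D i *v v) \<partial>lborel)) < 0"
proof (rule ccontr)
  assume neg: "\<not> ?thesis"
  interpret pair_sigma_finite gauss lborel ..
  define f where "f i = (\<lambda>(v, t). powr_change \<alpha> (homothetic \<beta> (\<xi> i) (\<eta> i) t) (D i *v v))" for i
  have f: "integrable (gauss \<Otimes>\<^sub>M lborel) (f i) \<and> (\<integral>z. f i z \<partial>(gauss \<Otimes>\<^sub>M lborel)) \<le> 0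
      \<and> (D i \<noteq> 0 \<longrightarrow> (\<integral>z. f i z \<partial>(gauss \<Otimes>\<^sub>M lborel)) < 0)" if i: "i \<in> I" for i
  proof (cases "D i = 0")
    case True
    then have "f i = (\<lambda>_. 0)" by (auto simp: f_def powr_change_def fun_eq_iff)
    with True show ?thesis by simp
  next
    case False
    then obtain \<tau> where \<tau>: "\<tau> > 0" "disperses (D i) \<tau>" using D[OF i] by blast
    show ?thesis
      using average_powr_change[OF \<alpha> \<beta> ne(1)[OF i] ne(2)[OF i] \<tau>(2,1)] unfolding f_def by simp
  qed
  have "AE v in gauss. integrable lborel (\<lambda>t. f i (v, t))" if "i \<in> I" for i
    using AE_integrable_fst'[of "f i"] f[OF that] by simp
  then have AE: "AE v in gauss. \<forall>i\<in>I. integrable lborel (\<lambda>t. f i (v, t))"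
    using I by (intro AE_finite_allI)
  have "AE v in gauss. 0 \<le> (\<Sum>i\<in>I. c i * (\<integral>t. f i (v, t) \<partial>lborel))"
    using AE by (rule eventually_mono) (use neg in \<open>auto simp: f_def not_less\<close>)
  then have "0 \<le> (\<integral>v. (\<Sum>i\<in>I. c i * (\<integral>t. f i (v, t) \<partial>lborel)) \<partial>gauss)"
    by (rule integral_nonneg_AE)
  also have "\<dots> = (\<Sum>i\<in>I. c i * (\<integral>v. (\<integral>t. f i (v, t) \<partial>lborel) \<partial>gauss))"
    using f integrable_fst' by (subst Bochner_Integration.integral_sum) auto
  also have "\<dots> = (\<Sum>i\<in>I. c i * (\<integral>z. f i z \<partial>(gauss \<Otimes>\<^sub>M lborel)))"
    using f integral_fst' by (intro sum.cong) auto
  also have "\<dots> < (\<Sum>i\<in>I. 0)"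
  proof (rule sum_strict_mono_ex1[OF I])
    show "\<forall>i\<in>I. c i * (\<integral>z. f i z \<partial>(gauss \<Otimes>\<^sub>M lborel)) \<le> 0"
      using f c by (auto simp: mult_le_0_iff less_imp_le)
    show "\<exists>i\<in>I. c i * (\<integral>z. f i z \<partial>(gauss \<Otimes>\<^sub>M lborel)) < 0"
      using f c ex by (meson mult_pos_neg)
  qed
  finally show False by simp
qed

section \<open>Scaling in the amplitude of the shift\<close>

lemma homothetic_scale: "C > 0 \<Longrightarrow> homothetic \<beta> a b (C * t) = C powr \<beta> *\<^sub>R homothetic \<beta> a b t"
  by (auto simp: homothetic_def abs_mult powr_mult zero_le_mult_iff)

lemma powr_change_scale: "r > 0 \<Longrightarrow> powr_change \<alpha> (r *\<^sub>R x) (r *\<^sub>R y) = r powr - \<alpha> * powr_change \<alpha> x y"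
  by (simp add: powr_change_def scaleR_add_right[symmetric] powr_mult right_diff_distrib)

text \<open>Rescaling time by C = r powr (1 / \<beta>) multiplies the path by r: the integrand
  contributes r powr (- \<alpha>) and the time element C. The exponent 1 / \<beta> - \<alpha> = 1 -
  \<alpha> / 2 is below 1, so for small r this beats any cost linear in r.\<close>

lemma integral_powr_change_scale:
  fixes a b y :: "'a::euclidean_space"
  assumes \<alpha>: "0 < \<alpha>" and \<beta>: "\<beta> = 2 / (2 + \<alpha>)" and r: "r > 0"
    and i: "integrable lborel (\<lambda>t. powr_change \<alpha> (homothetic \<beta> a b t) y)"
  shows "integrable lborel (\<lambda>t. powr_change \<alpha> (homothetic \<beta> a b t) (r *\<^sub>R y))"
    "(\<integral>t. powr_change \<alpha> (homothetic \<beta> a b t) (r *\<^sub>R y) \<partial>lborel)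
      = r powr (1 - \<alpha> / 2) * (\<integral>t. powr_change \<alpha> (homothetic \<beta> a b t) y \<partial>lborel)"
proof -
  define C where "C = r powr (1 / \<beta>)"
  have C: "C > 0" using r by (simp add: C_def)
  have "\<beta> \<noteq> 0" using \<alpha> by (simp add: \<beta>)
  then have "C powr \<beta> = r" using r by (simp add: C_def powr_powr)
  then have eq: "powr_change \<alpha> (homothetic \<beta> a b (0 + C * t)) (r *\<^sub>R y)
      = r powr - \<alpha> * powr_change \<alpha> (homothetic \<beta> a b t) y" for t
    using C r by (simp add: homothetic_scale powr_change_scale)
  show "integrable lborel (\<lambda>t. powr_change \<alpha> (homothetic \<beta> a b t) (r *\<^sub>R y))"
    using i C lborel_integrable_real_affine_iff[of C "\<lambda>t. powr_change \<alpha> (homothetic \<beta> a b t) (r *\<^sub>R y)" 0]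
    unfolding eq by simp
  have "C * r powr - \<alpha> = r powr (1 / \<beta> + - \<alpha>)" unfolding C_def by (rule powr_add[symmetric])
  also have "1 / \<beta> + - \<alpha> = 1 - \<alpha> / 2" using \<alpha> by (simp add: \<beta> field_simps)
  finally have "C * r powr - \<alpha> = r powr (1 - \<alpha> / 2)" .
  then show "(\<integral>t. powr_change \<alpha> (homothetic \<beta> a b t) (r *\<^sub>R y) \<partial>lborel)
      = r powr (1 - \<alpha> / 2) * (\<integral>t. powr_change \<alpha> (homothetic \<beta> a b t) y \<partial>lborel)"
    using C lborel_integral_real_affine[of C "\<lambda>t. powr_change \<alpha> (homothetic \<beta> a b t) (r *\<^sub>R y)" 0]
    unfolding eq by (simp add: mult.assoc[symmetric])
qed

section \<open>The action along the standard variation\<close>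

definition cluster_pairs :: "'n::linorder set \<Rightarrow> ('n \<times> 'n) set" where
  "cluster_pairs k = {(i, j). i \<in> k \<and> j \<in> k \<and> i < j}"

lemma finite_cluster_pairs [simp]: "finite (cluster_pairs (k :: 'n::{finite,linorder} set))"
  by (rule finite_subset[OF subset_UNIV]) simp

lemma homothetic_component: "homothetic \<beta> a b t $ i = homothetic \<beta> (a $ i) (b $ i) t"
  by (simp add: homothetic_def)

lemma homothetic_diff: "homothetic \<beta> a b t - homothetic \<beta> c d t = homothetic \<beta> (a - c) (b - d) t"
  by (simp add: homothetic_def scaleR_diff_right)

lemma homothetic_component_diff:
  "homothetic \<beta> a b t $ i - homothetic \<beta> a b t $ j = homothetic \<beta> (a $ i - a $ j) (b $ i - b $ j) t"
  by (simp add: homothetic_component homothetic_diff)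

lemma homothetic_eq_0_iff: "a \<noteq> 0 \<Longrightarrow> b \<noteq> 0 \<Longrightarrow> homothetic \<beta> a b t = 0 \<longleftrightarrow> t = 0"
  by (simp add: homothetic_def)

text \<open>On each half-line the norm of y determines |t|. Consequently a constant shift creates
  collisions at finitely many times only.\<close>

lemma finite_homothetic_eq:
  fixes a b y :: "'a::real_normed_vector"
  assumes "\<beta> > 0" "a \<noteq> 0" "b \<noteq> 0"
  shows "finite {t. homothetic \<beta> a b t = y}"
proof (rule finite_subset)
  define c where "c z = (norm y / norm z) powr (1 / \<beta>)" for z :: 'a
  show "finite {c a, - c a, c b, - c b, 0}" by simp
  show "{t. homothetic \<beta> a b t = y} \<subseteq> {c a, - c a, c b, - c b, 0}"
  proof
    fix t assume "t \<in> {t. homothetic \<beta> a b t = y}"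
    then have n: "\<bar>t\<bar> powr \<beta> * norm (if t \<ge> 0 then a else b) = norm y"
      by (auto simp: homothetic_def)
    define z where "z = (if t \<ge> 0 then a else b)"
    have z: "norm z > 0" using assms by (simp add: z_def)
    have "\<bar>t\<bar> powr \<beta> = norm y / norm z" using n z by (simp add: z_def[symmetric] field_simps)
    then have "c z = (\<bar>t\<bar> powr \<beta>) powr (1 / \<beta>)" by (simp add: c_def)
    also have "\<dots> = \<bar>t\<bar>" using assms by (simp add: powr_powr)
    finally show "t \<in> {c a, - c a, c b, - c b, 0}" by (auto simp: z_def split: if_splits)
  qed
qed

definition homothetic_deriv :: "real \<Rightarrow> 'a \<Rightarrow> 'a \<Rightarrow> real \<Rightarrow> 'a::real_normed_vector" where
  "homothetic_deriv \<beta> a b t = (\<beta> * \<bar>t\<bar> powr (\<beta> - 1) * sgn t) *\<^sub>R (if t \<ge> 0 then a else b)"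

lemma has_vector_derivative_homothetic:
  assumes "t \<noteq> 0"
  shows "(homothetic \<beta> a b has_vector_derivative homothetic_deriv \<beta> a b t) (at t)"
proof (cases "t > 0")
  case True
  have "((\<lambda>t. t powr \<beta> *\<^sub>R a) has_vector_derivative (\<beta> * t powr (\<beta> - 1)) *\<^sub>R a) (at t)"
    using True by (intro derivative_eq_intros has_real_derivative_powr
        has_vector_derivative_scaleR[OF _ has_vector_derivative_const, THEN has_vector_derivative_eq_rhs]) (auto)
  then have "((\<lambda>t. t powr \<beta> *\<^sub>R a) has_vector_derivative homothetic_deriv \<beta> a b t) (at t)"
    using True by (simp add: homothetic_deriv_def)
  then show ?thesis
    by (rule has_vector_derivative_transform_within_open[of _ _ t "{0<..}"]) (use True in \<open>auto simp: homothetic_def\<close>)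
next
  case False
  with assms have t: "t < 0" by simp
  have "((\<lambda>t. (- t) powr \<beta>) has_real_derivative - (\<beta> * (- t) powr (\<beta> - 1))) (at t)"
    using t by (auto intro!: derivative_eq_intros)
  then have "((\<lambda>t. (- t) powr \<beta> *\<^sub>R b) has_vector_derivative (- (\<beta> * (- t) powr (\<beta> - 1))) *\<^sub>R b) (at t)"
    by (intro has_vector_derivative_scaleR[OF _ has_vector_derivative_const, THEN has_vector_derivative_eq_rhs]) auto
  then have "((\<lambda>t. (- t) powr \<beta> *\<^sub>R b) has_vector_derivative homothetic_deriv \<beta> a b t) (at t)"
    using t by (simp add: homothetic_deriv_def)
  then show ?thesis
    by (rule has_vector_derivative_transform_within_open[of _ _ t "{..<0}"]) (use t in \<open>auto simp: homothetic_def\<close>)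
qed

text \<open>The variation is piecewise linear in time with corners at the excluded times. Its ramps
  have unit speed whatever \<delta> is, so their cost per unit time can be bounded independently of
  \<delta>.\<close>

lemma has_vector_derivative_standard_variation:
  fixes \<delta> :: "real^3^'n"
  assumes \<delta>: "\<delta> \<noteq> 0" and R: "R > norm \<delta>" and t: "\<bar>t\<bar> \<noteq> R" "\<bar>t\<bar> \<noteq> R - norm \<delta>"
  shows "(standard_variation R \<delta> has_vector_derivative
     (if R - norm \<delta> < \<bar>t\<bar> \<and> \<bar>t\<bar> < R then - (sgn t / norm \<delta>) *\<^sub>R \<delta> else 0)) (at t)"
proof -
  define T where "T = R - norm \<delta>"
  have T: "0 < T" "T < R" using \<delta> R by (auto simp: T_def)
  have n: "norm \<delta> > 0" using \<delta> by simp
  have sv: "standard_variation R \<delta> t =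
     (if \<bar>t\<bar> \<le> T then \<delta> else if \<bar>t\<bar> \<le> R then ((R - \<bar>t\<bar>) / norm \<delta>) *\<^sub>R \<delta> else 0)" for t
    by (simp add: standard_variation_def T_def)
  consider "\<bar>t\<bar> < T" | "T < t" "t < R" | "- R < t" "t < - T" | "\<bar>t\<bar> > R"
    using t unfolding T_def[symmetric] by linarith
  then have "(standard_variation R \<delta> has_vector_derivative
     (if T < \<bar>t\<bar> \<and> \<bar>t\<bar> < R then - (sgn t / norm \<delta>) *\<^sub>R \<delta> else 0)) (at t)"
  proof cases
    case 1
    have "((\<lambda>_. \<delta>) has_vector_derivative 0) (at t)" by (rule has_vector_derivative_const)
    then have "(standard_variation R \<delta> has_vector_derivative 0) (at t)"
      by (rule has_vector_derivative_transform_within_open[of _ _ t "{- T<..<T}"]) (use 1 in \<open>auto simp: sv\<close>)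
    with 1 show ?thesis by simp
  next
    case 2
    have "((\<lambda>t. ((R - t) / norm \<delta>) *\<^sub>R \<delta>) has_vector_derivative (- 1 / norm \<delta>) *\<^sub>R \<delta>) (at t)"
      using n by (intro has_vector_derivative_scaleR[OF _ has_vector_derivative_const, THEN has_vector_derivative_eq_rhs])
        (auto intro!: derivative_eq_intros)
    then have "(standard_variation R \<delta> has_vector_derivative (- 1 / norm \<delta>) *\<^sub>R \<delta>) (at t)"
      by (rule has_vector_derivative_transform_within_open[of _ _ t "{T<..<R}"]) (use 2 T in \<open>auto simp: sv\<close>)
    with 2 T show ?thesis by simp
  next
    case 3
    have "((\<lambda>t. ((R + t) / norm \<delta>) *\<^sub>R \<delta>) has_vector_derivative (1 / norm \<delta>) *\<^sub>R \<delta>) (at t)"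
      using n by (intro has_vector_derivative_scaleR[OF _ has_vector_derivative_const, THEN has_vector_derivative_eq_rhs])
        (auto intro!: derivative_eq_intros)
    then have "(standard_variation R \<delta> has_vector_derivative (1 / norm \<delta>) *\<^sub>R \<delta>) (at t)"
      by (rule has_vector_derivative_transform_within_open[of _ _ t "{- R<..<- T}"]) (use 3 T in \<open>auto simp: sv\<close>)
    with 3 T show ?thesis by simp
  next
    case 4
    have "open {t::real. R < \<bar>t\<bar>}" by (intro open_Collect_less continuous_intros)
    then have "(standard_variation R \<delta> has_vector_derivative 0) (at t)"
      using 4 T by (intro has_vector_derivative_transform_within_open[OF has_vector_derivative_const, of "{t. R < \<bar>t\<bar>}" t 0])
        (auto simp: sv)
    with 4 show ?thesis by simp
  qed
  then show ?thesis by (simp add: T_def)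
qed

text \<open>Away from collisions the Lagrangian is a finite real number, which makes the difference
  of two of them meaningful.\<close>

lemma lagrangian_noncollision:
  fixes x :: "real \<Rightarrow> real^3^'n::{finite,linorder}"
  assumes d: "(x has_vector_derivative x') (at t)" and m: "\<And>i. m i > 0"
    and ne: "\<And>i j. (i, j) \<in> cluster_pairs k \<Longrightarrow> x t $ i \<noteq> x t $ j"
  shows "lagrangian m \<alpha> k x t = ennreal ((\<Sum>i\<in>k. m i / 2 * (norm (x' $ i))\<^sup>2) +
    (\<Sum>(i, j)\<in>cluster_pairs k. m i * m j * norm (x t $ i - x t $ j) powr - \<alpha>))"
proof -
  have "potential m \<alpha> k (x t) = (\<Sum>p\<in>cluster_pairs k. ennreal (m (fst p) * m (snd p) * norm (x t $ fst p - x t $ snd p) powr - \<alpha>))"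
    unfolding potential_def cluster_pairs_def[symmetric]
    using ne by (intro sum.cong) (auto)
  also have "\<dots> = ennreal (\<Sum>p\<in>cluster_pairs k. m (fst p) * m (snd p) * norm (x t $ fst p - x t $ snd p) powr - \<alpha>)"
    using m by (intro sum_ennreal) (simp add: less_imp_le)
  finally have "potential m \<alpha> k (x t) = ennreal (\<Sum>(i, j)\<in>cluster_pairs k. m i * m j * norm (x t $ i - x t $ j) powr - \<alpha>)"
    by (simp add: case_prod_beta)
  moreover have "0 \<le> (\<Sum>i\<in>k. m i / 2 * (norm (x' $ i))\<^sup>2)"
    using m by (intro sum_nonneg) (simp add: less_imp_le)
  moreover have "0 \<le> (\<Sum>(i, j)\<in>cluster_pairs k. m i * m j * norm (x t $ i - x t $ j) powr - \<alpha>)"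
    using m by (intro sum_nonneg) (auto simp: less_imp_le)
  ultimately show ?thesis
    by (simp add: lagrangian_def vector_derivative_at[OF d] ennreal_plus)
qed

lemma norm_homothetic_ge:
  assumes "\<beta> > 0" "\<bar>t\<bar> \<ge> T" "T \<ge> (c / min (norm a) (norm b)) powr (1 / \<beta>)" "a \<noteq> 0" "b \<noteq> 0" "c > 0"
  shows "norm (homothetic \<beta> a b t) \<ge> c"
proof -
  define e where "e = min (norm a) (norm b)"
  have e: "e > 0" using assms by (simp add: e_def)
  have "c / e = ((c / e) powr (1 / \<beta>)) powr \<beta>" using assms e by (simp add: powr_powr)
  also have "\<dots> \<le> \<bar>t\<bar> powr \<beta>" using assms by (intro powr_mono2) (auto simp: e_def)
  finally have "c \<le> \<bar>t\<bar> powr \<beta> * e" using e by (simp add: field_simps)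
  also have "\<dots> \<le> norm (homothetic \<beta> a b t)"
    by (auto simp: homothetic_def e_def intro!: mult_left_mono)
  finally show ?thesis .
qed

lemma borel_measurable_vec_nth [measurable]:
  "(\<lambda>x :: 'a::real_normed_vector^'n. x $ i) \<in> borel_measurable borel"
  by (intro borel_measurable_continuous_onI continuous_on_component continuous_on_id)

lemma powr_change_0 [simp]: "powr_change \<alpha> x 0 = 0"
  by (simp add: powr_change_def)

lemma abs_powr_change_le_1:
  assumes "\<alpha> > 0" "norm x \<ge> 1" "norm (x + y) \<ge> 1"
  shows "\<bar>powr_change \<alpha> x y\<bar> \<le> 1"
proof -
  have "z powr - \<alpha> \<le> 1" if "z \<ge> 1" for z :: real
    using that assms(1) powr_mono2'[of "- \<alpha>" 1 z] by simp
  from this[OF assms(2)] this[OF assms(3)] show ?thesis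
    unfolding powr_change_def by (smt (verit) powr_ge_zero)
qed

lemma abs_norm_square_diff_le:
  fixes x y :: "'a::real_inner"
  assumes "norm y \<le> 1"
  shows "\<bar>(norm (x + y))\<^sup>2 - (norm x)\<^sup>2\<bar> \<le> 2 * norm x + 1"
proof -
  have "(norm (x + y))\<^sup>2 - (norm x)\<^sup>2 = 2 * (x \<bullet> y) + (norm y)\<^sup>2"
    by (simp add: power2_norm_eq_inner inner_add_left inner_add_right inner_commute)
  moreover have "\<bar>x \<bullet> y\<bar> \<le> norm x * norm y" by (rule Cauchy_Schwarz_ineq2)
  moreover have "norm x * norm y \<le> norm x * 1" using assms by (intro mult_left_mono) auto
  moreover have "(norm y)\<^sup>2 \<le> 1" using assms by (simp add: power_le_one)
  ultimately show ?thesis using zero_le_power2[of "norm y"] by linarith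
qed

lemma norm_homothetic_deriv_le:
  assumes "0 < \<beta>" "\<beta> < 1" "\<bar>t\<bar> \<ge> 1"
  shows "norm (homothetic_deriv \<beta> a b t) \<le> \<beta> * (norm a + norm b)"
proof -
  have "\<bar>t\<bar> powr (\<beta> - 1) \<le> 1"
    using assms powr_mono2'[of "\<beta> - 1" 1 "\<bar>t\<bar>"] by simp
  then have "\<beta> * \<bar>t\<bar> powr (\<beta> - 1) * norm (if t \<ge> 0 then a else b) \<le> \<beta> * 1 * (norm a + norm b)"
    using assms by (intro mult_mono) auto
  moreover have "t \<noteq> 0" using assms by auto
  ultimately show ?thesis
    using assms by (simp add: homothetic_deriv_def abs_mult abs_sgn_eq)
qed

text \<open>While the shift is constant only the potential changes; on the two ramps, of total
  length 2 |\<delta>|, the change is at most a constant independent of \<delta>; beyond R there is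
  none. As the plateau grows, its contribution tends to the full integral, so the strict inequality
  \<open>neg\<close> survives for a finite plateau.\<close>

lemma standard_variation_decreases:
  fixes \<delta> sp sm :: "real^3^'n::{finite,linorder}" and k :: "'n set" and m :: "'n \<Rightarrow> real"
  assumes \<beta>: "0 < \<beta>" "\<beta> < 1" and \<alpha>: "\<alpha> > 0" and m: "\<And>i. m i > 0"
    and sp: "\<And>i j. (i, j) \<in> cluster_pairs k \<Longrightarrow> sp $ i \<noteq> sp $ j"
    and sm: "\<And>i j. (i, j) \<in> cluster_pairs k \<Longrightarrow> sm $ i \<noteq> sm $ j"
    and \<delta>: "\<delta> \<noteq> 0"
    and int: "\<And>i j. (i, j) \<in> cluster_pairs k \<Longrightarrow> integrable lborel
        (\<lambda>t. powr_change \<alpha> (homothetic \<beta> (sp $ i - sp $ j) (sm $ i - sm $ j) t) (\<delta> $ i - \<delta> $ j))"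
    and neg: "(\<Sum>(i, j)\<in>cluster_pairs k. m i * m j *
        (\<integral>t. powr_change \<alpha> (homothetic \<beta> (sp $ i - sp $ j) (sm $ i - sm $ j) t) (\<delta> $ i - \<delta> $ j) \<partial>lborel))
      + 2 * norm \<delta> * ((\<Sum>i\<in>k. m i * (\<beta> * (norm (sp $ i) + norm (sm $ i)) + 1 / 2))
        + (\<Sum>(i, j)\<in>cluster_pairs k. m i * m j)) < 0"
  defines "q \<equiv> homothetic \<beta> sp sm"
  shows "\<exists>R > norm \<delta>.
        let q' = (\<lambda>t. q t + standard_variation R \<delta> t);
            dL = (\<lambda>t. enn2real (lagrangian m \<alpha> k q' t) - enn2real (lagrangian m \<alpha> k q t))
        in (AE t in lborel. lagrangian m \<alpha> k q' t < \<infinity> \<and> lagrangian m \<alpha> k q t < \<infinity>) \<and>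
           integrable lborel dL \<and> (LINT t|lborel. dL t) < 0"
proof -
  define P where "P = cluster_pairs k"
  have Pfin [simp]: "finite P" by (simp add: P_def)
  define M where "M p = m (fst p) * m (snd p)" for p
  have M: "M p > 0" for p using m by (simp add: M_def)
  define h where "h p = homothetic \<beta> (sp $ fst p - sp $ snd p) (sm $ fst p - sm $ snd p)" for p
  define y where "y p = \<delta> $ fst p - \<delta> $ snd p" for p
  have ne: "sp $ fst p - sp $ snd p \<noteq> 0" "sm $ fst p - sm $ snd p \<noteq> 0" if "p \<in> P" for p
    using that sp sm by (cases p; force simp: P_def)+
  have h_meas [measurable]: "h p \<in> borel_measurable borel" for p unfolding h_def by measurable
  define \<Phi> where "\<Phi> t = (\<Sum>p\<in>P. M p * powr_change \<alpha> (h p t) (y p))" for t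
  have F_int: "integrable lborel (\<lambda>t. powr_change \<alpha> (h p t) (y p))" if "p \<in> P" for p
    using int[of "fst p" "snd p"] that by (simp add: P_def h_def y_def)
  then have \<Phi>_int: "integrable lborel \<Phi>"
    unfolding \<Phi>_def by (intro Bochner_Integration.integrable_sum integrable_mult_right) auto
  define C where "C = (\<Sum>i\<in>k. m i * (\<beta> * (norm (sp $ i) + norm (sm $ i)) + 1 / 2)) + (\<Sum>p\<in>P. M p)"
  have C0: "C \<ge> 0"
    unfolding C_def using m M \<beta> by (intro add_nonneg_nonneg sum_nonneg mult_nonneg_nonneg) (auto simp: less_imp_le)
  have n: "norm \<delta> > 0" using \<delta> by simp
  have "(\<integral>t. \<Phi> t \<partial>lborel) = (\<Sum>p\<in>P. M p * (\<integral>t. powr_change \<alpha> (h p t) (y p) \<partial>lborel))"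
    unfolding \<Phi>_def using F_int by (subst Bochner_Integration.integral_sum) auto
  then have neg': "(\<integral>t. \<Phi> t \<partial>lborel) + 2 * norm \<delta> * C < 0"
    using neg by (simp add: C_def P_def M_def h_def y_def case_prod_beta)
  have y_le: "norm (y p) \<le> 2 * norm \<delta>" for p
  proof -
    have "norm (y p) \<le> norm (\<delta> $ fst p) + norm (\<delta> $ snd p)" unfolding y_def by (rule norm_triangle_ineq4)
    also have "\<dots> \<le> norm \<delta> + norm \<delta>" by (intro add_mono Finite_Cartesian_Product.norm_nth_le)
    finally show ?thesis by simp
  qed
  \<comment> \<open>The shift alters a mutual distance by at most 2 |\<delta>|, so a distance of at
    least c remains at least 1.\<close>
  define c where "c = 2 * norm \<delta> + 1"
  have c: "c > 0" using n unfolding c_def by linarith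
  have lim: "(\<lambda>n. \<integral>t. indicator {- real n<..<real n} t * \<Phi> t \<partial>lborel) \<longlonglongrightarrow> (\<integral>t. \<Phi> t \<partial>lborel)"
  proof (rule integral_dominated_convergence[where w="\<lambda>t. \<bar>\<Phi> t\<bar>"])
    show "AE t in lborel. (\<lambda>n. indicator {- real n<..<real n} t * \<Phi> t) \<longlonglongrightarrow> \<Phi> t"
    proof (intro always_eventually allI)
      fix t :: real
      have "eventually (\<lambda>n. real n \<ge> \<bar>t\<bar> + 1) sequentially"
        using filterlim_real_sequentially unfolding filterlim_at_top by blast
      then have "eventually (\<lambda>n. indicator {- real n<..<real n} t * \<Phi> t = \<Phi> t) sequentially"
        by (rule eventually_mono) (auto simp: indicator_def)
      then show "(\<lambda>n. indicator {- real n<..<real n} t * \<Phi> t) \<longlonglongrightarrow> \<Phi> t"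
        by (rule tendsto_eventually)
    qed
  qed (use \<Phi>_int in \<open>auto simp: indicator_def\<close>)
  have "eventually (\<lambda>n. (\<integral>t. indicator {- real n<..<real n} t * \<Phi> t \<partial>lborel) < - (2 * norm \<delta> * C)) sequentially"
    using neg' by (intro order_tendstoD(2)[OF lim]) simp
  moreover have "eventually (\<lambda>n. \<forall>p\<in>P. real n \<ge> (c / min (norm (sp $ fst p - sp $ snd p)) (norm (sm $ fst p - sm $ snd p))) powr (1 / \<beta>)) sequentially"
    using filterlim_real_sequentially unfolding filterlim_at_top by (intro eventually_ball_finite) auto
  moreover have "eventually (\<lambda>n. real n \<ge> 1) sequentially"
    using filterlim_real_sequentially unfolding filterlim_at_top by blast
  ultimately have "eventually (\<lambda>n. (\<integral>t. indicator {- real n<..<real n} t * \<Phi> t \<partial>lborel) < - (2 * norm \<delta> * C)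
     \<and> (\<forall>p\<in>P. real n \<ge> (c / min (norm (sp $ fst p - sp $ snd p)) (norm (sm $ fst p - sm $ snd p))) powr (1 / \<beta>))
     \<and> real n \<ge> 1) sequentially"
    by eventually_elim simp
  then obtain N :: nat where N: "(\<integral>t. indicator {- real N<..<real N} t * \<Phi> t \<partial>lborel) < - (2 * norm \<delta> * C)"
     "\<And>p. p \<in> P \<Longrightarrow> real N \<ge> (c / min (norm (sp $ fst p - sp $ snd p)) (norm (sm $ fst p - sm $ snd p))) powr (1 / \<beta>)"
     "real N \<ge> 1"
    by (auto simp: eventually_sequentially)
  define T where "T = real N"
  define R where "R = T + norm \<delta>"
  have T: "T \<ge> 1" "T > 0" using N(3) by (auto simp: T_def)
  have R: "R > norm \<delta>" "R > T" "R - norm \<delta> = T" using T n by (auto simp: R_def)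
  have h_large: "norm (h p t) \<ge> c" if "p \<in> P" "\<bar>t\<bar> \<ge> T" for p t
    unfolding h_def using ne[OF that(1)] that(2) N(2)[OF that(1)] \<beta> c
    by (intro norm_homothetic_ge[where T=T]) (auto simp: T_def)
  \<comment> \<open>The exceptional times: the collision of q, the corners of the variation, and the
    collisions that the full shift creates.\<close>
  define X where "X = {0, R, - R, T, - T} \<union> (\<Union>p\<in>P. {t. h p t = - y p})"
  have X: "finite X"
    unfolding X_def h_def using ne \<beta> by (auto intro!: finite_homothetic_eq)
  define Kin where "Kin x = (\<Sum>i\<in>k. m i / 2 * (norm (x $ i))\<^sup>2)" for x :: "real^3^'n::_"
  define qd where "qd = homothetic_deriv \<beta> sp sm"
  define vd where "vd t = - (sgn t / norm \<delta>) *\<^sub>R \<delta>" for t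
  \<comment> \<open>The change of the Lagrangian on the ramps, where the shift has velocity
    \<open>vd\<close>.\<close>
  define e where "e t = Kin (qd t + vd t) - Kin (qd t) + (\<Sum>p\<in>P. M p * powr_change \<alpha> (h p t) (((R - \<bar>t\<bar>) / norm \<delta>) *\<^sub>R y p))" for t
  define A where "A = {- R..- T} \<union> {T..R}"
  define g where "g t = indicator {- T<..<T} t * \<Phi> t + indicator A t * e t" for t
  have L_q: "lagrangian m \<alpha> k q t = ennreal (Kin (qd t) + (\<Sum>p\<in>P. M p * norm (h p t) powr - \<alpha>))" if "t \<noteq> 0" for t
  proof -
    have "q t $ i \<noteq> q t $ j" if "(i, j) \<in> cluster_pairs k" for i j
      using homothetic_component_diff[of \<beta> sp sm t i j] sp[OF that] sm[OF that] \<open>t \<noteq> 0\<close>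
        homothetic_eq_0_iff[of "sp $ i - sp $ j" "sm $ i - sm $ j" \<beta> t] unfolding q_def by auto
    then have "lagrangian m \<alpha> k q t = ennreal (Kin (qd t) +
        (\<Sum>(i, j)\<in>cluster_pairs k. m i * m j * norm (q t $ i - q t $ j) powr - \<alpha>))"
      unfolding Kin_def q_def qd_def
      by (intro lagrangian_noncollision has_vector_derivative_homothetic that m) auto
    then show ?thesis
      by (simp add: q_def homothetic_component_diff P_def M_def h_def case_prod_beta)
  qed
  define \<theta> where "\<theta> t = (if \<bar>t\<bar> \<le> T then 1 else if \<bar>t\<bar> \<le> R then (R - \<bar>t\<bar>) / norm \<delta> else 0)" for t
  have sv: "standard_variation R \<delta> t = \<theta> t *\<^sub>R \<delta>" for t
    by (simp add: standard_variation_def R(3) \<theta>_def)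
  have \<theta>: "0 \<le> \<theta> t" "\<theta> t \<le> 1" for t
    using n by (auto simp: \<theta>_def R_def divide_le_eq)
  have far: "norm (h p t + \<theta> t *\<^sub>R y p) \<ge> 1" if "p \<in> P" "\<bar>t\<bar> \<ge> T" for p t
  proof -
    have "norm (\<theta> t *\<^sub>R y p) \<le> 1 * (2 * norm \<delta>)"
      unfolding norm_scaleR using \<theta>[of t] y_le[of p] by (intro mult_mono) auto
    then have "norm (h p t) - 2 * norm \<delta> \<le> norm (h p t + \<theta> t *\<^sub>R y p)"
      using norm_diff_ineq[of "h p t" "\<theta> t *\<^sub>R y p"] by linarith
    then show ?thesis using h_large[OF that] by (simp add: c_def)
  qed
  define w where "w t = (if T < \<bar>t\<bar> \<and> \<bar>t\<bar> < R then vd t else 0)" for t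
  have L_q': "lagrangian m \<alpha> k (\<lambda>t. q t + standard_variation R \<delta> t) t
     = ennreal (Kin (qd t + w t) + (\<Sum>p\<in>P. M p * norm (h p t + \<theta> t *\<^sub>R y p) powr - \<alpha>))" if t: "t \<notin> X" for t
  proof -
    have t': "t \<noteq> 0" "\<bar>t\<bar> \<noteq> R" "\<bar>t\<bar> \<noteq> R - norm \<delta>" using t T R by (auto simp: X_def)
    have diff: "(q t + standard_variation R \<delta> t) $ i - (q t + standard_variation R \<delta> t) $ j
       = h (i, j) t + \<theta> t *\<^sub>R y (i, j)" for i j
      by (simp add: sv h_def y_def q_def homothetic_component_diff[symmetric] scaleR_diff_right)
    have nz: "h p t + \<theta> t *\<^sub>R y p \<noteq> 0" if p: "p \<in> P" for p
    proof (cases "\<bar>t\<bar> \<ge> T")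
      case True
      then show ?thesis using far[OF p True] by auto
    next
      case False
      then have "\<theta> t = 1" by (simp add: \<theta>_def)
      then show ?thesis using t p by (auto simp: X_def add_eq_0_iff2)
    qed
    have "((\<lambda>t. q t + standard_variation R \<delta> t) has_vector_derivative qd t + w t) (at t)"
      unfolding q_def qd_def
      using has_vector_derivative_standard_variation[OF \<delta> R(1) t'(2,3)]
      by (intro has_vector_derivative_add has_vector_derivative_homothetic t') (simp only: w_def vd_def R(3))
    then have "lagrangian m \<alpha> k (\<lambda>t. q t + standard_variation R \<delta> t) t = ennreal (Kin (qd t + w t) +
        (\<Sum>(i, j)\<in>cluster_pairs k. m i * m j * norm ((q t + standard_variation R \<delta> t) $ i - (q t + standard_variation R \<delta> t) $ j) powr - \<alpha>))"
      unfolding Kin_def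
    proof (rule lagrangian_noncollision[OF _ m])
      fix i j assume "(i, j) \<in> cluster_pairs k"
      then show "(q t + standard_variation R \<delta> t) $ i \<noteq> (q t + standard_variation R \<delta> t) $ j"
        using nz[of "(i, j)"] diff[of i j] by (auto simp: P_def)
    qed
    then show ?thesis by (simp only: diff) (simp add: P_def M_def case_prod_beta)
  qed
  have Kin0: "Kin x \<ge> 0" for x unfolding Kin_def using m by (intro sum_nonneg) (simp add: less_imp_le)
  have U0: "(\<Sum>p\<in>P. M p * norm (z p) powr - \<alpha>) \<ge> 0" for z :: "_ \<Rightarrow> real^3"
    using M by (intro sum_nonneg) (simp add: less_imp_le)
  define dL where "dL t = enn2real (lagrangian m \<alpha> k (\<lambda>t. q t + standard_variation R \<delta> t) t) - enn2real (lagrangian m \<alpha> k q t)" for t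
  have dL: "dL t = g t" if t: "t \<notin> X" for t
  proof -
    have t0: "t \<noteq> 0" using t by (simp add: X_def)
    have "dL t = Kin (qd t + w t) - Kin (qd t) + (\<Sum>p\<in>P. M p * powr_change \<alpha> (h p t) (\<theta> t *\<^sub>R y p))"
      unfolding dL_def L_q[OF t0] L_q'[OF t] enn2real_ennreal[OF add_nonneg_nonneg[OF Kin0 U0]]
      by (simp add: powr_change_def right_diff_distrib sum_subtractf)
    moreover consider "\<bar>t\<bar> < T" | "T < \<bar>t\<bar>" "\<bar>t\<bar> < R" | "\<bar>t\<bar> > R"
      using t T R by (auto simp: X_def) linarith
    then have "Kin (qd t + w t) - Kin (qd t) + (\<Sum>p\<in>P. M p * powr_change \<alpha> (h p t) (\<theta> t *\<^sub>R y p)) = g t"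
    proof cases
      case 1
      then have "t \<in> {- T<..<T}" "t \<notin> A" by (auto simp: A_def)
      with 1 show ?thesis by (simp add: g_def w_def \<theta>_def \<Phi>_def)
    next
      case 2
      then have "t \<notin> {- T<..<T}" "t \<in> A" by (auto simp: A_def)
      with 2 show ?thesis by (simp add: g_def w_def \<theta>_def e_def)
    next
      case 3
      then have "t > R \<or> t < - R" by linarith
      then have "t \<notin> {- T<..<T}" "t \<notin> A" using R(2) T(2) by (auto simp: A_def)
      with 3 R show ?thesis by (simp add: g_def w_def \<theta>_def)
    qed
    ultimately show ?thesis by simp
  qed
  have Kin_meas [measurable]: "Kin \<in> borel_measurable borel"
    unfolding Kin_def by measurable
  have qd_meas [measurable]: "qd \<in> borel_measurable borel"
    unfolding qd_def homothetic_deriv_def by measurable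
  have vd_meas [measurable]: "vd \<in> borel_measurable borel"
    unfolding vd_def by measurable
  have e_meas [measurable]: "e \<in> borel_measurable borel"
    unfolding e_def powr_change_def by measurable
  have A_meas [measurable]: "A \<in> sets borel" by (simp add: A_def)
  \<comment> \<open>Each body contributes m_i / 2 times 2 |q_i'| + 1, the velocity q_i' being
    bounded for |t| >= 1 and \<open>vd\<close> having norm 1; each pair contributes m_i m_j, since
    its distance is at least 1 before and after the shift.\<close>
  have e_bound: "\<bar>e t\<bar> \<le> C" if t: "t \<in> A" for t
  proof -
    have tT: "\<bar>t\<bar> \<ge> T" "\<bar>t\<bar> \<le> R" "\<bar>t\<bar> \<ge> 1" "t \<noteq> 0" using t T by (auto simp: A_def)
    have "\<bar>Kin (qd t + vd t) - Kin (qd t)\<bar> = \<bar>\<Sum>i\<in>k. m i / 2 * ((norm (qd t $ i + vd t $ i))\<^sup>2 - (norm (qd t $ i))\<^sup>2)\<bar>"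
      by (simp add: Kin_def sum_subtractf right_diff_distrib)
    also have "\<dots> \<le> (\<Sum>i\<in>k. \<bar>m i / 2 * ((norm (qd t $ i + vd t $ i))\<^sup>2 - (norm (qd t $ i))\<^sup>2)\<bar>)"
      by (rule sum_abs)
    also have "\<dots> \<le> (\<Sum>i\<in>k. m i * (\<beta> * (norm (sp $ i) + norm (sm $ i)) + 1 / 2))"
    proof (rule sum_mono)
      fix i
      have "norm (vd t) = 1" using n tT by (simp add: vd_def abs_sgn_eq)
      then have "norm (vd t $ i) \<le> 1" using Finite_Cartesian_Product.norm_nth_le[of "vd t" i] by simp
      then have "\<bar>(norm (qd t $ i + vd t $ i))\<^sup>2 - (norm (qd t $ i))\<^sup>2\<bar> \<le> 2 * norm (qd t $ i) + 1"
        by (rule abs_norm_square_diff_le)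
      also have "2 * norm (qd t $ i) + 1 \<le> 2 * (\<beta> * (norm (sp $ i) + norm (sm $ i))) + 1"
      proof -
        have "qd t $ i = homothetic_deriv \<beta> (sp $ i) (sm $ i) t"
          by (simp add: qd_def homothetic_deriv_def)
        then show ?thesis using norm_homothetic_deriv_le[OF \<beta> tT(3)] by simp
      qed
      finally have "m i / 2 * \<bar>(norm (qd t $ i + vd t $ i))\<^sup>2 - (norm (qd t $ i))\<^sup>2\<bar>
          \<le> m i / 2 * (2 * (\<beta> * (norm (sp $ i) + norm (sm $ i))) + 1)"
        using m[of i] by (intro mult_left_mono) auto
      also have "\<dots> = m i * (\<beta> * (norm (sp $ i) + norm (sm $ i)) + 1 / 2)"
        by (simp add: field_simps)
      finally show "\<bar>m i / 2 * ((norm (qd t $ i + vd t $ i))\<^sup>2 - (norm (qd t $ i))\<^sup>2)\<bar>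
          \<le> m i * (\<beta> * (norm (sp $ i) + norm (sm $ i)) + 1 / 2)"
        using m[of i] by (simp only: abs_mult)
    qed
    finally have 1: "\<bar>Kin (qd t + vd t) - Kin (qd t)\<bar> \<le> (\<Sum>i\<in>k. m i * (\<beta> * (norm (sp $ i) + norm (sm $ i)) + 1 / 2))" .
    have "\<theta> t = (R - \<bar>t\<bar>) / norm \<delta>"
      using tT n by (auto simp: \<theta>_def R_def)
    moreover have "\<bar>powr_change \<alpha> (h p t) (\<theta> t *\<^sub>R y p)\<bar> \<le> 1" if "p \<in> P" for p
    proof -
      have "norm (h p t) \<ge> 1" using h_large[OF that tT(1)] n unfolding c_def by linarith
      then show ?thesis by (rule abs_powr_change_le_1[OF \<alpha> _ far[OF that tT(1)]])
    qed
    ultimately have "\<bar>powr_change \<alpha> (h p t) (((R - \<bar>t\<bar>) / norm \<delta>) *\<^sub>R y p)\<bar> \<le> 1" if "p \<in> P" for p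
      using that by metis
    then have "\<bar>\<Sum>p\<in>P. M p * powr_change \<alpha> (h p t) (((R - \<bar>t\<bar>) / norm \<delta>) *\<^sub>R y p)\<bar> \<le> (\<Sum>p\<in>P. M p * 1)"
      using M by (intro order_trans[OF sum_abs] sum_mono) (auto simp: abs_mult less_imp_le abs_of_pos intro!: mult_left_mono)
    with 1 show ?thesis unfolding e_def C_def by simp
  qed
  have A_int: "integrable lborel (\<lambda>t. indicator A t * C)"
  proof -
    have "emeasure lborel A < \<infinity>"
      unfolding A_def by (rule emeasure_bounded_finite) auto
    then show ?thesis by (intro integrable_mult_left integrable_real_indicator) auto
  qed
  have e_int: "integrable lborel (\<lambda>t. indicator A t * e t)"
    using e_bound by (intro Bochner_Integration.integrable_bound[OF A_int]) (auto simp: indicator_def abs_of_nonneg[OF C0])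
  have \<Phi>T_int: "integrable lborel (\<lambda>t. indicator {- T<..<T} t * \<Phi> t)"
    using \<Phi>_int by (intro Bochner_Integration.integrable_bound[OF \<Phi>_int]) (auto simp: indicator_def)
  have g_int: "integrable lborel g"
    unfolding g_def using \<Phi>T_int e_int by (rule Bochner_Integration.integrable_add)
  have "(\<integral>t. indicator A t * e t \<partial>lborel) \<le> (\<integral>t. indicator A t * C \<partial>lborel)"
    using e_bound by (intro integral_mono e_int A_int) (auto simp: indicator_def abs_le_iff)
  also have "\<dots> = measure lborel A * C" by simp
  also have "measure lborel A = 2 * norm \<delta>"
  proof -
    have "measure lborel A = measure lborel {- R..- T} + measure lborel {T..R}"
      unfolding A_def by (rule measure_Union) (use T in \<open>auto simp: emeasure_lborel_Icc_eq\<close>)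
    then show ?thesis using R T by (simp add: R_def)
  qed
  finally have "(\<integral>t. indicator A t * e t \<partial>lborel) \<le> 2 * norm \<delta> * C" .
  then have g_neg: "(\<integral>t. g t \<partial>lborel) < 0"
    unfolding g_def using N(1) by (subst Bochner_Integration.integral_add[OF \<Phi>T_int e_int]) (simp add: T_def)
  have X0: "countable X" using X by (rule countable_finite)
  have dL_int: "integrable lborel dL \<longleftrightarrow> integrable lborel g"
    using dL by (intro integrable_discrete_difference[OF X0]) auto
  have dL_eq: "(\<integral>t. dL t \<partial>lborel) = (\<integral>t. g t \<partial>lborel)"
    using dL by (intro integral_discrete_difference[OF X0]) auto
  have AE_X: "AE t in lborel. t \<notin> X"
    using X0 by (intro AE_not_in countable_imp_null_set_lborel)
  have fin: "AE t in lborel. lagrangian m \<alpha> k (\<lambda>t. q t + standard_variation R \<delta> t) t < \<infinity> \<and> lagrangian m \<alpha> k q t < \<infinity>"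
    using AE_X
  proof (rule eventually_mono)
    fix t assume t: "t \<notin> X"
    then have "t \<noteq> 0" by (simp add: X_def)
    then show "lagrangian m \<alpha> k (\<lambda>t. q t + standard_variation R \<delta> t) t < \<infinity> \<and> lagrangian m \<alpha> k q t < \<infinity>"
      by (simp add: L_q L_q'[OF t])
  qed
  show ?thesis
    using R(1) fin dL_int g_int dL_eq g_neg unfolding Let_def dL_def by (intro exI[of _ R]) simp
qed

section \<open>The symmetry group of the blow-up\<close>

lemma sym_group_mult:
  "g \<otimes>\<^bsub>sym_group T0 k\<^esub> h = (fst g \<otimes>\<^bsub>O_circle T0\<^esub> fst h, rho g ** rho h, perm g \<otimes>\<^bsub>BijGroup k\<^esub> perm h)"
  by (cases g; cases h; cases "snd g"; cases "snd h") (simp add: sym_group_def DirProd_def O3_def rho_def perm_def)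

lemma sym_group_one: "\<one>\<^bsub>sym_group T0 k\<^esub> = ((1, 0), mat 1, restrict (\<lambda>x. x) k)"
  by (simp add: sym_group_def DirProd_def O_circle_def O3_def BijGroup_def)

lemma sym_group_carrier_iff:
  "g \<in> carrier (sym_group T0 k) \<longleftrightarrow>
    fst g \<in> carrier (O_circle T0) \<and> orthogonal_matrix (rho g) \<and> perm g \<in> Bij k"
  by (cases g; cases "snd g") (simp add: sym_group_def DirProd_def O3_def rho_def perm_def BijGroup_def)

lemma perm_mult:
  assumes "g \<in> carrier (sym_group T0 k)" "h \<in> carrier (sym_group T0 k)" "j \<in> k"
  shows "perm (g \<otimes>\<^bsub>sym_group T0 k\<^esub> h) j = perm g (perm h j)"
  using assms by (simp add: sym_group_mult perm_def[of "(_, _, _)"] sym_group_carrier_iff BijGroup_def compose_def)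

lemma rho_mult: "rho (g \<otimes>\<^bsub>sym_group T0 k\<^esub> h) = rho g ** rho h"
  by (simp add: sym_group_mult rho_def[of "(_, _, _)"])

lemma tau_0_iff: "tau g 0 = 0 \<longleftrightarrow> snd (fst g) = 0"
  by (simp add: tau_def)

text \<open>The elements of G whose restrictions form \<open>G_star G k\<close>. They are kept
  unrestricted because the action on loops involves all bodies.\<close>

definition cluster_stabiliser :: "'n sym set \<Rightarrow> 'n set \<Rightarrow> 'n sym set" where
  "cluster_stabiliser G k = {g \<in> G. tau g 0 = 0 \<and> perm g ` k = k}"

definition restrict_sym :: "'n set \<Rightarrow> 'n sym \<Rightarrow> 'n sym" where
  "restrict_sym k g = (fst g, rho g, restrict (perm g) k)"

lemma G_star_eq: "G_star G k = restrict_sym k ` cluster_stabiliser G k"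
  by (simp add: G_star_def restrict_sym_def cluster_stabiliser_def)

lemma restrict_sym_simps [simp]:
  "fst (restrict_sym k g) = fst g" "rho (restrict_sym k g) = rho g" "perm (restrict_sym k g) = restrict (perm g) k"
  by (simp_all add: restrict_sym_def rho_def perm_def)

context
  fixes T0 :: real and G :: "'n sym set"
  assumes T0: "T0 > 0" and G: "subgroup G (sym_group T0 UNIV)"
begin

interpretation full: group "sym_group T0 UNIV :: 'n sym monoid" by (rule group_sym_group[OF T0])

lemma stabiliser_carrier: "g \<in> cluster_stabiliser G k \<Longrightarrow> g \<in> carrier (sym_group T0 UNIV)"
  using subgroup.subset[OF G] by (auto simp: cluster_stabiliser_def)

lemma stabiliser_inj:
  assumes "g \<in> cluster_stabiliser G k"
  shows "inj (perm g)"
  using stabiliser_carrier[OF assms] by (auto simp: sym_group_carrier_iff Bij_def bij_def)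

lemma restrict_sym_carrier:
  assumes "g \<in> cluster_stabiliser G k"
  shows "restrict_sym k g \<in> carrier (sym_group T0 k)"
proof -
  have "bij_betw (perm g) k k"
    using stabiliser_inj[OF assms] assms by (auto simp: bij_betw_def cluster_stabiliser_def intro: inj_on_subset)
  then show ?thesis
    using stabiliser_carrier[OF assms] by (auto simp: sym_group_carrier_iff Bij_def bij_betw_restrict_eq)
qed

lemma stabiliser_mult:
  assumes g: "g \<in> cluster_stabiliser G k" and h: "h \<in> cluster_stabiliser G k"
  shows "g \<otimes>\<^bsub>sym_group T0 UNIV\<^esub> h \<in> cluster_stabiliser G k"
    "restrict_sym k (g \<otimes>\<^bsub>sym_group T0 UNIV\<^esub> h) = restrict_sym k g \<otimes>\<^bsub>sym_group T0 k\<^esub> restrict_sym k h"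
proof -
  let ?gh = "g \<otimes>\<^bsub>sym_group T0 UNIV\<^esub> h"
  have p: "perm ?gh j = perm g (perm h j)" for j
    using perm_mult[OF stabiliser_carrier[OF g] stabiliser_carrier[OF h], of j] by simp
  have "?gh \<in> G" using g h subgroup.m_closed[OF G] by (auto simp: cluster_stabiliser_def)
  moreover have "tau ?gh 0 = 0"
    using g h by (cases g; cases h) (auto simp: sym_group_mult tau_0_iff cluster_stabiliser_def O_circle_def split: prod.splits)
  moreover have "perm ?gh ` k = perm g ` (perm h ` k)" unfolding image_image p ..
  ultimately show "?gh \<in> cluster_stabiliser G k"
    using g h by (simp add: cluster_stabiliser_def)
  have "restrict (perm g) k \<otimes>\<^bsub>BijGroup k\<^esub> restrict (perm h) k = restrict (perm ?gh) k"
  proof -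
    have "perm h j \<in> k" if "j \<in> k" for j using h that by (auto simp: cluster_stabiliser_def)
    then show ?thesis
      using restrict_sym_carrier[OF g] restrict_sym_carrier[OF h] p
      by (auto simp: BijGroup_def sym_group_carrier_iff compose_def restrict_def fun_eq_iff)
  qed
  moreover have "fst ?gh = fst g \<otimes>\<^bsub>O_circle T0\<^esub> fst h" by (simp add: sym_group_mult)
  ultimately show "restrict_sym k ?gh = restrict_sym k g \<otimes>\<^bsub>sym_group T0 k\<^esub> restrict_sym k h"
    by (simp add: restrict_sym_def[of k ?gh] rho_mult sym_group_mult[where g="restrict_sym k g"])
qed

lemma stabiliser_one:
  "\<one>\<^bsub>sym_group T0 UNIV\<^esub> \<in> cluster_stabiliser G k"
  "restrict_sym k \<one>\<^bsub>sym_group T0 UNIV\<^esub> = \<one>\<^bsub>sym_group T0 k\<^esub>"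
proof -
  have "\<one>\<^bsub>sym_group T0 UNIV\<^esub> \<in> G" by (rule subgroup.one_closed[OF G])
  then show "\<one>\<^bsub>sym_group T0 UNIV\<^esub> \<in> cluster_stabiliser G k"
    by (simp add: cluster_stabiliser_def sym_group_one tau_def perm_def)
  show "restrict_sym k \<one>\<^bsub>sym_group T0 UNIV\<^esub> = \<one>\<^bsub>sym_group T0 k\<^esub>"
    by (simp add: restrict_sym_def sym_group_one rho_def perm_def restrict_def fun_eq_iff)
qed

lemma stabiliser_inv:
  assumes g: "g \<in> cluster_stabiliser G k"
  shows "inv\<^bsub>sym_group T0 UNIV\<^esub> g \<in> cluster_stabiliser G k"
proof -
  let ?f = "inv\<^bsub>sym_group T0 UNIV\<^esub> g"
  note gc = stabiliser_carrier[OF g]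
  have fc: "?f \<in> carrier (sym_group T0 UNIV)" using gc by simp
  have one: "?f \<otimes>\<^bsub>sym_group T0 UNIV\<^esub> g = \<one>\<^bsub>sym_group T0 UNIV\<^esub>" using gc by (rule full.l_inv)
  have "?f \<in> G" using g subgroup.m_inv_closed[OF G] by (auto simp: cluster_stabiliser_def)
  \<comment> \<open>Composing with g, whose translation part is 0, shows that the translation part c
    of the inverse is 0 modulo T0; as c is the representative in [0, T0), it is 0 itself.\<close>
  moreover have "tau ?f 0 = 0"
  proof -
    obtain e c where f: "fst ?f = (e, c)" by (cases "fst ?f")
    have c: "0 \<le> c" "c < T0" using fc f by (auto simp: sym_group_carrier_iff O_circle_def)
    have "fst ?f \<otimes>\<^bsub>O_circle T0\<^esub> fst g = (1, 0)" using one by (simp add: sym_group_one sym_group_mult)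
    moreover have "snd (fst g) = 0" using g by (simp add: cluster_stabiliser_def tau_0_iff)
    ultimately have "c rmod T0 = 0" by (cases "fst g") (auto simp: f O_circle_def)
    moreover have "c rmod T0 = c" using c T0 by (intro rmod_unique[where n = 0]) auto
    ultimately show ?thesis by (simp add: tau_0_iff f)
  qed
  moreover have "perm ?f ` k = k"
  proof -
    have "perm ?f (perm g j) = j" for j
      using perm_mult[OF fc gc, of j] unfolding one by (simp add: sym_group_one perm_def)
    then have "perm ?f ` (perm g ` k) = k" by (simp add: image_image)
    then show ?thesis using g by (simp add: cluster_stabiliser_def)
  qed
  ultimately show ?thesis by (simp add: cluster_stabiliser_def)
qed

text \<open>Restriction to k is a homomorphism on the stabiliser of the time 0 and of k, and
  \<open>G_star G k\<close> is its image.\<close>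

lemma subgroup_G_star: "subgroup (G_star G k) (sym_group T0 k)"
proof -
  interpret group "sym_group T0 k" by (rule group_sym_group[OF T0])
  show ?thesis
  proof (rule subgroupI)
    show "G_star G k \<subseteq> carrier (sym_group T0 k)"
      using restrict_sym_carrier by (auto simp: G_star_eq)
    show "G_star G k \<noteq> {}" using stabiliser_one(1)[of k] by (auto simp: G_star_eq)
    fix g assume "g \<in> G_star G k"
    then obtain g' where g': "g' \<in> cluster_stabiliser G k" "g = restrict_sym k g'" by (auto simp: G_star_eq)
    let ?f = "inv\<^bsub>sym_group T0 UNIV\<^esub> g'"
    note f = stabiliser_inv[OF g'(1)]
    have "restrict_sym k ?f \<otimes>\<^bsub>sym_group T0 k\<^esub> g = \<one>\<^bsub>sym_group T0 k\<^esub>"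
      unfolding g'(2) stabiliser_mult(2)[OF f g'(1), symmetric]
        full.l_inv[OF stabiliser_carrier[OF g'(1)]] stabiliser_one(2) ..
    then have "inv\<^bsub>sym_group T0 k\<^esub> g = restrict_sym k ?f"
      using restrict_sym_carrier[OF f] restrict_sym_carrier[OF g'(1)] g'(2) by (intro inv_equality) auto
    then show "inv\<^bsub>sym_group T0 k\<^esub> g \<in> G_star G k" using f by (auto simp: G_star_eq)
  next
    fix g h assume "g \<in> G_star G k" "h \<in> G_star G k"
    then obtain g' h' where "g' \<in> cluster_stabiliser G k" "g = restrict_sym k g'"
      "h' \<in> cluster_stabiliser G k" "h = restrict_sym k h'" by (auto simp: G_star_eq)
    then show "g \<otimes>\<^bsub>sym_group T0 k\<^esub> h \<in> G_star G k"
      using stabiliser_mult[of g' k h'] by (metis G_star_eq imageI)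
  qed
qed

lemma G_star_perm_in: "g \<in> G_star G k \<Longrightarrow> j \<in> k \<Longrightarrow> perm g j \<in> k"
  by (auto simp: G_star_eq cluster_stabiliser_def)

lemma G_star_orthogonal: "g \<in> G_star G k \<Longrightarrow> orthogonal_matrix (rho g)"
  using subgroup.subset[OF subgroup_G_star, of k] by (auto simp: sym_group_carrier_iff)

lemma G_star_mult:
  assumes "g \<in> G_star G k" "h \<in> G_star G k"
  shows "g \<otimes>\<^bsub>sym_group T0 k\<^esub> h \<in> G_star G k"
    "j \<in> k \<Longrightarrow> perm (g \<otimes>\<^bsub>sym_group T0 k\<^esub> h) j = perm g (perm h j)"
    "rho (g \<otimes>\<^bsub>sym_group T0 k\<^esub> h) = rho g ** rho h"
proof -
  have "g \<in> carrier (sym_group T0 k)" "h \<in> carrier (sym_group T0 k)"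
    using assms subgroup.subset[OF subgroup_G_star, of k] by auto
  then show "j \<in> k \<Longrightarrow> perm (g \<otimes>\<^bsub>sym_group T0 k\<^esub> h) j = perm g (perm h j)"
    by (rule perm_mult)
  show "g \<otimes>\<^bsub>sym_group T0 k\<^esub> h \<in> G_star G k"
    using assms by (rule subgroup.m_closed[OF subgroup_G_star])
qed (rule rho_mult)

lemma G_star_inv:
  assumes g: "g \<in> G_star G k"
  shows "inv\<^bsub>sym_group T0 k\<^esub> g \<in> G_star G k"
    "j \<in> k \<Longrightarrow> perm (inv\<^bsub>sym_group T0 k\<^esub> g) (perm g j) = j"
proof -
  interpret group "sym_group T0 k" by (rule group_sym_group[OF T0])
  show i: "inv\<^bsub>sym_group T0 k\<^esub> g \<in> G_star G k" using subgroup.m_inv_closed[OF subgroup_G_star g] .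
  assume j: "j \<in> k"
  have "inv\<^bsub>sym_group T0 k\<^esub> g \<otimes>\<^bsub>sym_group T0 k\<^esub> g = \<one>\<^bsub>sym_group T0 k\<^esub>"
    using g subgroup.subset[OF subgroup_G_star, of k] by (intro l_inv) auto
  then show "perm (inv\<^bsub>sym_group T0 k\<^esub> g) (perm g j) = j"
    using G_star_mult(2)[OF i g j] j by (simp add: sym_group_one perm_def)
qed

text \<open>The element h^-1 g fixes i. This is what makes the definite description in
  \<open>iota\<close> refer to a unique element.\<close>

lemma G_star_eq_if_trivial_isotropy:
  assumes H: "perm_isotropy G k i = {\<one>\<^bsub>sym_group T0 k\<^esub>}" and i: "i \<in> k"
    and g: "g \<in> G_star G k" and h: "h \<in> G_star G k" and eq: "perm g i = perm h i"
  shows "g = h"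
proof -
  interpret group "sym_group T0 k" by (rule group_sym_group[OF T0])
  have c: "g \<in> carrier (sym_group T0 k)" "h \<in> carrier (sym_group T0 k)"
    using g h subgroup.subset[OF subgroup_G_star, of k] by auto
  let ?x = "inv\<^bsub>sym_group T0 k\<^esub> h \<otimes>\<^bsub>sym_group T0 k\<^esub> g"
  have "?x \<in> G_star G k" by (intro G_star_mult(1) G_star_inv(1) g h)
  moreover have "perm ?x i = i"
    using G_star_mult(2)[OF G_star_inv(1)[OF h] g i] G_star_inv(2)[OF h i] eq by simp
  ultimately have "?x = \<one>\<^bsub>sym_group T0 k\<^esub>" using H by (auto simp: perm_isotropy_def)
  then have "inv\<^bsub>sym_group T0 k\<^esub> g = inv\<^bsub>sym_group T0 k\<^esub> h"
    using c by (intro inv_equality) auto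
  then have "inv\<^bsub>sym_group T0 k\<^esub> (inv\<^bsub>sym_group T0 k\<^esub> g) = inv\<^bsub>sym_group T0 k\<^esub> (inv\<^bsub>sym_group T0 k\<^esub> h)"
    by simp
  then show ?thesis using c by (simp only: inv_inv)
qed

end

section \<open>The equivariant sphere through its component matrices\<close>

definition iota_matrix :: "'n sym set \<Rightarrow> 'n set \<Rightarrow> 'n \<Rightarrow> 'n \<Rightarrow> real^3^3" where
  "iota_matrix G k i j = (if \<exists>g\<in>G_star G k. perm g i = j
     then rho (THE g. g \<in> G_star G k \<and> perm g i = j) else 0)"

lemma iota_component: "iota G k i v $ j = iota_matrix G k i j *v v"
  by (simp add: iota_def iota_matrix_def)

lemma iota_scaleR: "iota G k i (r *\<^sub>R v) = r *\<^sub>R iota G k i v"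
  by (simp add: vec_eq_iff[of "iota G k i (r *\<^sub>R v)"] iota_component matrix_vector_mult_scaleR)

lemma iota_matrix_outside: "\<not> (\<exists>g\<in>G_star G k. perm g i = j) \<Longrightarrow> iota_matrix G k i j = 0"
  by (simp add: iota_matrix_def)

lemma orthogonal_matrix_uminus: "orthogonal_matrix R \<Longrightarrow> orthogonal_matrix (- R :: real^3^3)"
  by (simp add: orthogonal_matrix orthogonal_matrix_orthonormal_rows row_def orthogonal_def inner_vec_def vec_eq_iff
      transpose_def matrix_matrix_mult_def)

context
  fixes T0 :: real and G :: "'n::finite sym set" and k :: "'n set" and i :: 'n
  assumes T0: "T0 > 0" and G: "subgroup G (sym_group T0 UNIV)"
    and i: "i \<in> k" and H: "perm_isotropy G k i = {\<one>\<^bsub>sym_group T0 k\<^esub>}"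
begin

lemma iota_matrix_orbit:
  assumes "g \<in> G_star G k"
  shows "iota_matrix G k i (perm g i) = rho g"
proof -
  have "(THE h. h \<in> G_star G k \<and> perm h i = perm g i) = g"
    using assms G_star_eq_if_trivial_isotropy[OF T0 G H i] by (intro the_equality) auto
  then show ?thesis using assms by (auto simp: iota_matrix_def)
qed

lemma iota_matrix_base: "iota_matrix G k i i = mat 1"
proof -
  have "\<one>\<^bsub>sym_group T0 k\<^esub> \<in> G_star G k" "perm \<one>\<^bsub>sym_group T0 k\<^esub> i = i"
    using H by (auto simp: perm_isotropy_def)
  then show ?thesis
    using iota_matrix_orbit[of "\<one>\<^bsub>sym_group T0 k\<^esub>"] by (simp add: sym_group_one rho_def)
qed

text \<open>On the orbit of i the relation is multiplicativity of \<open>rho\<close>; off the orbit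
  both sides vanish, because the complement of an orbit is invariant.\<close>

lemma iota_fixed: "iota G k i v \<in> fixed_configurations G k"
proof -
  have "iota G k i v $ j = 0" if "j \<notin> k" for j
    using that G_star_perm_in[OF T0 G _ i] by (auto simp: iota_component intro!: iota_matrix_outside[THEN arg_cong[where f="\<lambda>A. A *v v"], THEN trans])
  moreover have "iota G k i v $ perm g j = rho g *v (iota G k i v $ j)" if g: "g \<in> G_star G k" and j: "j \<in> k" for g j
  proof (cases "\<exists>h\<in>G_star G k. perm h i = j")
    case True
    then obtain h where h: "h \<in> G_star G k" "perm h i = j" by blast
    have "iota_matrix G k i (perm g j) = rho g ** rho h"
      using iota_matrix_orbit[OF G_star_mult(1)[OF T0 G g h(1)]] G_star_mult(2)[OF T0 G g h(1) i]
        G_star_mult(3)[OF T0 G g h(1)] h(2) by simp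
    then show ?thesis using iota_matrix_orbit[OF h(1)] h(2) by (simp add: iota_component matrix_vector_mul_assoc)
  next
    case False
    have "\<not> (\<exists>h\<in>G_star G k. perm h i = perm g j)"
    proof
      assume "\<exists>h\<in>G_star G k. perm h i = perm g j"
      then obtain h where h: "h \<in> G_star G k" "perm h i = perm g j" by blast
      let ?f = "inv\<^bsub>sym_group T0 k\<^esub> g \<otimes>\<^bsub>sym_group T0 k\<^esub> h"
      have "?f \<in> G_star G k" by (intro G_star_mult(1)[OF T0 G] G_star_inv(1)[OF T0 G] g h)
      moreover have "perm ?f i = j"
        using G_star_mult(2)[OF T0 G G_star_inv(1)[OF T0 G g] h(1) i] h(2) G_star_inv(2)[OF T0 G g j] by simp
      ultimately show False using False by blast
    qed
    then show ?thesis using False by (simp add: iota_component iota_matrix_outside)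
  qed
  ultimately show ?thesis by (simp add: fixed_configurations_def cluster_space_def)
qed

text \<open>The number of bodies of the pair in the orbit of i decides the type: none gives 0, one
  gives an orthogonal matrix up to sign, and two give a difference of rotations, which may again be
  0.\<close>

lemma disperses_iota_matrix_diff:
  assumes det: "\<forall>g\<in>G_star G k. det (rho g) = 1"
  shows "iota_matrix G k i j - iota_matrix G k i l = 0 \<or> (\<exists>\<tau>>0. disperses (iota_matrix G k i j - iota_matrix G k i l) \<tau>)"
proof -
  have cases: "iota_matrix G k i j = 0 \<or> (\<exists>g\<in>G_star G k. iota_matrix G k i j = rho g)" for j
    using iota_matrix_outside iota_matrix_orbit by metis
  note orth = G_star_orthogonal[OF T0 G]
  consider "iota_matrix G k i j = 0" "iota_matrix G k i l = 0"
    | g where "g \<in> G_star G k" "iota_matrix G k i j = rho g" "iota_matrix G k i l = 0"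
    | h where "h \<in> G_star G k" "iota_matrix G k i j = 0" "iota_matrix G k i l = rho h"
    | g h where "g \<in> G_star G k" "iota_matrix G k i j = rho g" "h \<in> G_star G k" "iota_matrix G k i l = rho h"
    using cases[of j] cases[of l] by blast
  then show ?thesis
  proof cases
    case 2
    then have "disperses (iota_matrix G k i j - iota_matrix G k i l) 1"
      using disperses_orthogonal[OF orth[OF 2(1)]] by simp
    then show ?thesis using zero_less_one by blast
  next
    case 3
    then have "disperses (iota_matrix G k i j - iota_matrix G k i l) 1"
      using disperses_orthogonal[OF orthogonal_matrix_uminus[OF orth[OF 3(1)]]] by simp
    then show ?thesis using zero_less_one by blast
  next
    case 4
    then show ?thesis
      using disperses_orthogonal_diff[OF orth[OF 4(1)] orth[OF 4(3)]] det by (cases "rho g = rho h") auto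
  qed simp
qed

text \<open>A nonzero matrix at j puts j into the orbit of i, and the element carrying i to j then
  acts trivially on space. As it fixes the time 0, equivariance identifies the two positions at that
  time.\<close>

lemma coincidence_if_iota_matrix_const:
  assumes const: "\<And>j. j \<in> k \<Longrightarrow> iota_matrix G k i j = mat 1"
    and y: "y \<in> equivariant_loops T0 G" and j: "j \<in> k"
  shows "y 0 $ j = y 0 $ i"
proof -
  have "(mat 1 :: real^3^3) \<noteq> 0" by (simp add: vec_eq_iff mat_def)
  then obtain g where g: "g \<in> G_star G k" "perm g i = j"
    using const[OF j] iota_matrix_outside[of G k i j] by metis
  have r: "rho g = mat 1" using iota_matrix_orbit[OF g(1)] g(2) const[OF j] by simp
  obtain h where h: "h \<in> cluster_stabiliser G k" "g = restrict_sym k h" using g by (auto simp: G_star_eq)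
  have hp: "perm h i = j" "rho h = mat 1" using h(2) g(2) r i by auto
  have "tau_inv h 0 = 0" using h(1) by (simp add: cluster_stabiliser_def tau_0_iff tau_inv_def)
  moreover have "inv_into UNIV (perm h) j = i"
    using stabiliser_inj[OF T0 G h(1)] hp(1) by (metis inv_f_f)
  moreover have "loop_act h y = y" using y h(1) by (auto simp: equivariant_loops_def cluster_stabiliser_def)
  then have "loop_act h y 0 $ j = y 0 $ j" by simp
  ultimately show ?thesis by (simp add: loop_act_def hp(2))
qed

end

section \<open>Existence of a V-variation\<close>

theorem mainTheorem2:
  fixes T0 \<alpha> :: real
    and \<omega> :: "real^3"
    and m :: "'n::{finite,linorder} \<Rightarrow> real"
    and G :: "'n::{finite,linorder} sym set"
    and x q :: "real \<Rightarrow> real^3^('n::{finite,linorder})"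
    and k :: "'n::{finite,linorder} set"
    and i :: "'n::{finite,linorder}"
  assumes "T0 > 0" and "0 < \<alpha>" and "\<alpha> < 2" and "\<forall>j. m j > 0"
    and "finite G" and "symmetry_group_of_action T0 \<alpha> \<omega> m G"
    and "local_minimizer T0 \<alpha> \<omega> m G x"
    and "colliding_cluster x k"
    (* The symmetry does not force all bodies of k to coincide at time 0; implied by
       "G is not bound to collisions" and necessary: if it fails, all components of iota_i(v) in k
       agree, so that the variation changes no mutual distance and only adds kinetic energy.
       It fails, e.g., for two equal masses and G generated by x_2(t) = x_1(-t). *)
    and "\<exists>y\<in>equivariant_loops T0 G. \<exists>a\<in>k. \<exists>b\<in>k. y 0 $ a \<noteq> y 0 $ b"
    and "blow_up m \<alpha> G k x q"
    and "\<forall>g\<in>G_star G k. det (rho g) = 1"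
    and "i \<in> k" and "perm_isotropy G k i = {\<one>\<^bsub>sym_group T0 k\<^esub>}"
  shows "\<exists>\<delta>. V_variation m \<alpha> G k q \<delta> \<and> (\<exists>r>0. \<exists>v\<in>sphere 0 r. \<delta> = iota G k i v)"
proof -
  have T0: "T0 > 0" and \<alpha>: "0 < \<alpha>" "\<alpha> < 2" and m: "\<And>j. m j > 0" and i: "i \<in> k"
    and H: "perm_isotropy G k i = {\<one>\<^bsub>sym_group T0 k\<^esub>}" using assms by auto
  have G: "subgroup G (sym_group T0 UNIV)" using assms(6) by (simp add: symmetry_group_of_action_def)
  define \<beta> where "\<beta> = 2 / (2 + \<alpha>)"
  have \<beta>: "0 < \<beta>" "\<beta> < 1" using \<alpha> by (simp_all add: \<beta>_def)
  from assms(10) obtain sp sm where sp: "central_configuration m \<alpha> k sp" and sm: "central_configuration m \<alpha> k sm"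
    and q: "\<And>t. q t = \<bar>t\<bar> powr (2 / (2 + \<alpha>)) *\<^sub>R (if t \<ge> 0 then sp else sm)"
    unfolding blow_up_def by blast
  have q_eq: "q = homothetic \<beta> sp sm" by (simp add: q homothetic_def \<beta>_def fun_eq_iff)
  have sp_ne: "sp $ a \<noteq> sp $ b" and sm_ne: "sm $ a \<noteq> sm $ b" if "(a, b) \<in> cluster_pairs k" for a b
    using sp sm that by (auto simp: central_configuration_def cluster_pairs_def)
  define A where "A = iota_matrix G k i"
  have A_comp: "iota G k i v $ j = A j *v v" for v j by (simp add: A_def iota_component)
  \<comment> \<open>If all differences vanished, every matrix would equal the one at i, the
    identity, and all equivariant loops would have the bodies of k together at time 0.\<close>
  have "\<exists>p\<in>cluster_pairs k. A (fst p) - A (snd p) \<noteq> 0"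
  proof (rule ccontr)
    assume *: "\<not> ?thesis"
    have "A j = mat 1" if "j \<in> k" for j
    proof -
      have "A i = A j"
        using * i that by (cases j i rule: linorder_cases) (auto simp: cluster_pairs_def)
      then show ?thesis using iota_matrix_base[OF T0 G i H] by (simp add: A_def)
    qed
    then have "y 0 $ a = y 0 $ i" if "y \<in> equivariant_loops T0 G" "a \<in> k" for y a
      using coincidence_if_iota_matrix_const[OF T0 G i H _ that] by (simp add: A_def)
    then show False using assms(9) by metis
  qed
  then have "\<exists>v. (\<forall>p\<in>cluster_pairs k. integrable lborel (\<lambda>t. powr_change \<alpha>
        (homothetic \<beta> (sp $ fst p - sp $ snd p) (sm $ fst p - sm $ snd p) t) ((A (fst p) - A (snd p)) *v v))) \<and>
     (\<Sum>p\<in>cluster_pairs k. (m (fst p) * m (snd p)) * (\<integral>t. powr_change \<alpha>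
        (homothetic \<beta> (sp $ fst p - sp $ snd p) (sm $ fst p - sm $ snd p) t) ((A (fst p) - A (snd p)) *v v) \<partial>lborel)) < 0"
    using m sp_ne sm_ne disperses_iota_matrix_diff[OF T0 G i H assms(11)]
    by (intro ex_decreasing_direction[OF \<alpha> \<beta>_def]) (auto simp: A_def)
  then obtain v where v_int: "\<And>p. p \<in> cluster_pairs k \<Longrightarrow> integrable lborel (\<lambda>t. powr_change \<alpha>
        (homothetic \<beta> (sp $ fst p - sp $ snd p) (sm $ fst p - sm $ snd p) t) ((A (fst p) - A (snd p)) *v v))"
    and v_neg: "(\<Sum>p\<in>cluster_pairs k. (m (fst p) * m (snd p)) * (\<integral>t. powr_change \<alpha>
        (homothetic \<beta> (sp $ fst p - sp $ snd p) (sm $ fst p - sm $ snd p) t) ((A (fst p) - A (snd p)) *v v) \<partial>lborel)) < 0"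
    by blast
  define \<delta>1 where "\<delta>1 = iota G k i v"
  define S where "S = (\<Sum>(a, b)\<in>cluster_pairs k. m a * m b * (\<integral>t. powr_change \<alpha>
        (homothetic \<beta> (sp $ a - sp $ b) (sm $ a - sm $ b) t) (\<delta>1 $ a - \<delta>1 $ b) \<partial>lborel))"
  have S: "S < 0"
    using v_neg by (simp add: S_def \<delta>1_def A_comp matrix_vector_mult_diff_rdistrib case_prod_beta)
  have int1: "integrable lborel (\<lambda>t. powr_change \<alpha>
        (homothetic \<beta> (sp $ a - sp $ b) (sm $ a - sm $ b) t) (\<delta>1 $ a - \<delta>1 $ b))" if "(a, b) \<in> cluster_pairs k" for a b
    using v_int[OF that] by (simp add: \<delta>1_def A_comp matrix_vector_mult_diff_rdistrib)
  have \<delta>1: "\<delta>1 \<noteq> 0"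
  proof
    assume "\<delta>1 = 0"
    then have "S = 0" by (simp add: S_def)
    then show False using S by simp
  qed
  \<comment> \<open>The bound on the ramps. It does not involve \<delta>, hence stays the same when
    the direction found is rescaled.\<close>
  define C where "C = (\<Sum>j\<in>k. m j * (\<beta> * (norm (sp $ j) + norm (sm $ j)) + 1 / 2)) + (\<Sum>(a, b)\<in>cluster_pairs k. m a * m b)"
  have C: "C \<ge> 0"
    unfolding C_def using m \<beta>
    by (intro add_nonneg_nonneg sum_nonneg) (auto simp: less_imp_le intro!: mult_nonneg_nonneg)
  define K where "K = 2 * norm \<delta>1 * C"
  have K: "K \<ge> 0" using C by (simp add: K_def)
  \<comment> \<open>r solves \<open>r powr (\<alpha> / 2) * (K + 1) = - S\<close>; the summand 1
    makes \<open>S + r powr (\<alpha> / 2) * K\<close> strictly negative. Multiplied by r powr (1 -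
    \<alpha> / 2), this compares the scaled gain with the cost r K.\<close>
  define r where "r = (- S / (K + 1)) powr (2 / \<alpha>)"
  have r: "r > 0" using S K by (auto simp: r_def)
  have "r powr (\<alpha> / 2) = - S / (K + 1)" using S K \<alpha> by (simp add: r_def powr_powr)
  then have "r powr (\<alpha> / 2) + r powr (\<alpha> / 2) * K = - S" using K by (simp add: field_simps)
  moreover have "r powr (\<alpha> / 2) > 0" using r by simp
  ultimately have "S + r powr (\<alpha> / 2) * K < 0" by linarith
  then have "r powr (1 - \<alpha> / 2) * (S + r powr (\<alpha> / 2) * K) < 0"
    using r by (intro mult_pos_neg) auto
  also have "r powr (1 - \<alpha> / 2) * (S + r powr (\<alpha> / 2) * K) = r powr (1 - \<alpha> / 2) * S + r * K"
    using r powr_add[of r "1 - \<alpha> / 2" "\<alpha> / 2"] by (simp add: distrib_left mult.assoc[symmetric])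
  finally have small: "r powr (1 - \<alpha> / 2) * S + r * K < 0" .
  define \<delta> where "\<delta> = iota G k i (r *\<^sub>R v)"
  have \<delta>: "\<delta> = r *\<^sub>R \<delta>1" by (simp add: \<delta>_def \<delta>1_def iota_scaleR)
  have comp: "\<delta> $ a - \<delta> $ b = r *\<^sub>R (\<delta>1 $ a - \<delta>1 $ b)" for a b by (simp add: \<delta> scaleR_diff_right)
  have int: "integrable lborel (\<lambda>t. powr_change \<alpha> (homothetic \<beta> (sp $ a - sp $ b) (sm $ a - sm $ b) t) (\<delta> $ a - \<delta> $ b))"
    and val: "(\<integral>t. powr_change \<alpha> (homothetic \<beta> (sp $ a - sp $ b) (sm $ a - sm $ b) t) (\<delta> $ a - \<delta> $ b) \<partial>lborel)
      = r powr (1 - \<alpha> / 2) * (\<integral>t. powr_change \<alpha> (homothetic \<beta> (sp $ a - sp $ b) (sm $ a - sm $ b) t) (\<delta>1 $ a - \<delta>1 $ b) \<partial>lborel)"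
    if "(a, b) \<in> cluster_pairs k" for a b
    unfolding comp using integral_powr_change_scale[OF \<alpha>(1) \<beta>_def r int1[OF that]] by auto
  have "(\<Sum>(a, b)\<in>cluster_pairs k. m a * m b *
      (\<integral>t. powr_change \<alpha> (homothetic \<beta> (sp $ a - sp $ b) (sm $ a - sm $ b) t) (\<delta> $ a - \<delta> $ b) \<partial>lborel)) = r powr (1 - \<alpha> / 2) * S"
    unfolding S_def sum_distrib_left by (intro sum.cong) (auto simp: val)
  moreover have "2 * norm \<delta> * C = r * K" using r by (simp add: \<delta> K_def)
  ultimately have neg: "(\<Sum>(a, b)\<in>cluster_pairs k. m a * m b *
      (\<integral>t. powr_change \<alpha> (homothetic \<beta> (sp $ a - sp $ b) (sm $ a - sm $ b) t) (\<delta> $ a - \<delta> $ b) \<partial>lborel)) + 2 * norm \<delta> * C < 0"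
    using small by simp
  have \<delta>0: "\<delta> \<noteq> 0" using \<delta>1 r by (simp add: \<delta>)
  have "V_variation m \<alpha> G k q \<delta>"
    unfolding V_variation_def q_eq
    using standard_variation_decreases[OF \<beta> \<alpha>(1) m sp_ne sm_ne \<delta>0 int neg[unfolded C_def]]
      iota_fixed[OF T0 G i H, of "r *\<^sub>R v"] \<delta>0 by (simp add: \<delta>_def)
  \<comment> \<open>This gives the sphere through r v a positive radius.\<close>
  moreover have "v \<noteq> 0"
  proof
    assume "v = 0"
    then have "\<delta>1 $ j = 0" for j by (simp add: \<delta>1_def A_comp)
    then have "\<delta>1 = 0" unfolding vec_eq_iff by simp
    with \<delta>1 show False by simp
  qed
  ultimately show ?thesis
    using r by (intro exI[of _ \<delta>] conjI exI[of _ "norm (r *\<^sub>R v)"] bexI[of _ "r *\<^sub>R v"]) (auto simp: \<delta>_def)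
qed

end
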